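(* Let $q(y,z|x)$ be a discrete memoryless broadcast channel with finite alphabets. Let $r(u,v,w)$ be a pmf on finite sets $\mathcal U\times\mathcal V\times\mathcal W$ and $r(x|u_1,v_1,w_1,u_2,v_2,w_2)$ a conditional pmf on $\mathcal X$. Define $\tilde r(x|u,v,w)=\sum_{u',v',w'}r(x|u',v',w',u,v,w)\,r(u',v',w')$, and let $(U_1,V_1,W_1,U_2,V_2,W_2,X_1,X_2,Y_1,Y_2,Z_1,Z_2)$ have joint pmf $$r(u_1,v_1,w_1)\,r(u_2,v_2,w_2)\,r(x_2|u_1,v_1,w_1,u_2,v_2,w_2)\,q(y_2,z_2|x_2)\,\tilde r(x_1|u_1,v_1,w_1)\,q(y_1,z_1|x_1).$$ Then every rate triple $(R_0,R_1,R_2)$ with $R_0,R_1,R_2\ge0$ and $R_0+R_1<I(U_2W_2;Y_1Y_2U_1W_1)$, $R_0+R_2<I(V_2W_2;Z_1Z_2V_1W_1)$, $R_0+R_1+R_2<I(V_2;Z_1Z_2V_1W_1|W_2)+I(U_2W_2;Y_1Y_2U_1W_1)-I(U_2;V_2|W_2)$, $R_0+R_1+R_2<I(U_2;Y_1Y_2U_1W_1|W_2)+I(V_2W_2;Z_1Z_2V_1W_1)-I(U_2;V_2|W_2)$, $2R_0+R_1+R_2<I(U_2W_2;Y_1Y_2U_1W_1)+I(V_2W_2;Z_1Z_2V_1W_1)-I(U_2;V_2|W_2)$ is achievable for the broadcast channel $q$.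
   Context: A two-receiver discrete memoryless broadcast channel has finite alphabets $\mathcal X,\mathcal Y,\mathcal Z$ and transition law $q(y,z|x)$, used memorylessly. A rate triple $(R_0,R_1,R_2)$ is achievable if for every $\epsilon>0$ and all sufficiently large $n$ there is a length-$n$ code sending a common message of rate $R_0$ to both receivers and private messages of rates $R_1$ to receiver $Y$ and $R_2$ to receiver $Z$ with average error probability at most $\epsilon$ (equivalently, the triple lies in the capacity region, the closure of the achievable set). *)

theory Defs
  imports Complex_Main
begin

text \<open>A joint pmf is a nonnegative function P on a finite outcome type summing to 1.
  Random variables are functions of the outcome. Logarithms are to base 2.\<close>

definition dist :: "('o::finite \<Rightarrow> real) \<Rightarrow> ('o \<Rightarrow> 'a) \<Rightarrow> 'a \<Rightarrow> real" where
  "dist P X a = (\<Sum>\<omega>\<in>{\<omega>. X \<omega> = a}. P \<omega>)"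

definition cond_mutual_info ::
  "('o::finite \<Rightarrow> real) \<Rightarrow> ('o \<Rightarrow> 'a) \<Rightarrow> ('o \<Rightarrow> 'b) \<Rightarrow> ('o \<Rightarrow> 'c) \<Rightarrow> real" where
  "cond_mutual_info P A B C =
     (\<Sum>t\<in>range (\<lambda>\<omega>. (A \<omega>, B \<omega>, C \<omega>)).
        (case t of (a, b, c) \<Rightarrow>
          (let pabc = dist P (\<lambda>\<omega>. (A \<omega>, B \<omega>, C \<omega>)) (a, b, c);
               pc = dist P C c;
               pac = dist P (\<lambda>\<omega>. (A \<omega>, C \<omega>)) (a, c);
               pbc = dist P (\<lambda>\<omega>. (B \<omega>, C \<omega>)) (b, c)
           in if pabc = 0 then 0 else pabc * log 2 (pabc * pc / (pac * pbc)))))"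

definition mutual_info ::
  "('o::finite \<Rightarrow> real) \<Rightarrow> ('o \<Rightarrow> 'a) \<Rightarrow> ('o \<Rightarrow> 'b) \<Rightarrow> real" where
  "mutual_info P A B = cond_mutual_info P A B (\<lambda>_. ())"

text \<open>A DM broadcast channel q x y z = q(y,z|x). Sequences of length n are lists.\<close>

definition channel_prob ::
  "('x \<Rightarrow> 'y \<Rightarrow> 'z \<Rightarrow> real) \<Rightarrow> nat \<Rightarrow> 'x list \<Rightarrow> 'y list \<Rightarrow> 'z list \<Rightarrow> real" where
  "channel_prob q n xs ys zs = (\<Prod>i<n. q (xs ! i) (ys ! i) (zs ! i))"

definition avg_error ::
  "('x \<Rightarrow> 'y \<Rightarrow> 'z \<Rightarrow> real) \<Rightarrow> nat \<Rightarrow> nat \<Rightarrow> nat \<Rightarrow> nat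
   \<Rightarrow> (nat \<Rightarrow> nat \<Rightarrow> nat \<Rightarrow> 'x list) \<Rightarrow> ('y list \<Rightarrow> nat \<times> nat) \<Rightarrow> ('z list \<Rightarrow> nat \<times> nat) \<Rightarrow> real" where
  "avg_error q n M0 M1 M2 enc dec1 dec2 =
     (1 / (real M0 * real M1 * real M2)) *
     (\<Sum>m0<M0. \<Sum>m1<M1. \<Sum>m2<M2.
        \<Sum>ys\<in>{ys. length ys = n}. \<Sum>zs\<in>{zs. length zs = n}.
          channel_prob q n (enc m0 m1 m2) ys zs *
          (if dec1 ys = (m0, m1) \<and> dec2 zs = (m0, m2) then 0 else 1))"

definition achievable ::
  "('x::finite \<Rightarrow> 'y::finite \<Rightarrow> 'z::finite \<Rightarrow> real) \<Rightarrow> real \<Rightarrow> real \<Rightarrow> real \<Rightarrow> bool" where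
  "achievable q R0 R1 R2 \<longleftrightarrow>
     (\<forall>\<epsilon>>0. \<exists>N. \<forall>n\<ge>N. \<exists>M0 M1 M2 enc dec1 dec2.
        real M0 \<ge> 2 powr (real n * R0) \<and> real M1 \<ge> 2 powr (real n * R1) \<and>
        real M2 \<ge> 2 powr (real n * R2) \<and>
        (\<forall>m0<M0. \<forall>m1<M1. \<forall>m2<M2. length (enc m0 m1 m2) = n) \<and>
        avg_error q n M0 M1 M2 enc dec1 dec2 \<le> \<epsilon>)"

end

theory Submission
  imports Defs "HOL-Probability.Probability"
begin

text \<open>
  The block-Markov scheme is replaced by a single random code of Marton type. Codewords
  \<open>(u\<^sub>i, v\<^sub>i, w\<^sub>i)\<close>, \<open>i = 0, \<dots>, n\<close>, have iid letters with law \<open>r\<close>, and the \<open>i\<close>-th channel input is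
  drawn from \<open>rc\<close> applied to the letters \<open>i\<close> and \<open>i + 1\<close>. Receiver \<open>Y\<close> tests a candidate \<open>(u, w)\<close> with
  the product over \<open>i\<close> of the single-letter densities relating \<open>(u\<^sub>2, w\<^sub>2)\<close> to \<open>(y\<^sub>1, y\<^sub>2, u\<^sub>1, w\<^sub>1)\<close>,
  evaluated along consecutive letters of the candidate itself. For an independent candidate this product
  has mean at most 1 (sum out the last letter first), so a wrong candidate passes the threshold
  \<open>2\<^sup>t\<close> with probability at most \<open>2\<^sup>-\<^sup>t\<close>; for the true codeword its logarithm is a sum of
  weakly dependent terms with mean exactly the mutual information of the theorem, and Chebyshev's
  inequality applies.

  The pair \<open>(u, v)\<close> inside a bin is selected with probability proportional to
  \<open>g = p(u, v | w) / (p(u | w) p(v | w))\<close>. Jensen's inequality for \<open>1 / x\<close> shows that the selected pair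
  behaves like a sample of \<open>p(u, v | w)\<close> as soon as the number of pairs exceeds typical values of \<open>g\<close>;
  no typicality or mutual covering lemma is needed. Rate splitting and Fourier--Motzkin elimination
  then give the five inequalities.
\<close>

subsection \<open>Expectations of finitely supported distributions\<close>


text \<open>The test of receiver Y involves (U1, W1), which a block-Markov decoder would already
  know; here it is read off the candidate itself. For a wrong candidate these letters bear no
  prescribed relation to the output, so a bound that averages under p(y1, y2, u1, w1) would be
  useless. The way out: the mean of p(a, b | c) / (p(a | c) p(b | c)) under p(a | c) is at most 1
  for every single value of b, so earlier letters and outputs may be arbitrary when the newest
  letter is summed out. Satellites are judged by bin. A second word in the correct bin is
  statistically tied to the selected one, but it leads to the right message; words of other bins are
  independent of the output given the cloud centre. Each receiver combines two thresholds, since a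
  wrong cloud centre and a wrong bin under the right centre have different exponents: an
  unconditional information and one conditioned on W2. The letters at the start of the block that no
  window reaches cost only a constant factor, so no rate is lost.\<close>

definition expect :: "'a pmf \<Rightarrow> ('a \<Rightarrow> real) \<Rightarrow> real" where
  "expect p f = (\<Sum>x\<in>set_pmf p. pmf p x * f x)"

lemma expect_superset:
  assumes "finite A" "set_pmf p \<subseteq> A"
  shows "expect p f = (\<Sum>x\<in>A. pmf p x * f x)"
  unfolding expect_def using assms
  by (intro sum.mono_neutral_left) (auto simp: set_pmf_iff)

lemma expect_UNIV: "expect p f = (\<Sum>x\<in>UNIV. pmf p x * f x)" for p :: "'a::finite pmf"
  by (rule expect_superset) auto

lemma expect_eq_expectation:
  "finite (set_pmf p) \<Longrightarrow> expect p f = measure_pmf.expectation p f"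
  unfolding expect_def by (subst integral_measure_pmf[of "set_pmf p"]) auto

lemma expect_mono: "(\<And>x. x \<in> set_pmf p \<Longrightarrow> f x \<le> g x) \<Longrightarrow> expect p f \<le> expect p g"
  unfolding expect_def by (intro sum_mono mult_left_mono) auto

lemma expect_cong: "(\<And>x. x \<in> set_pmf p \<Longrightarrow> f x = g x) \<Longrightarrow> expect p f = expect p g"
  unfolding expect_def by (intro sum.cong) auto

lemma expect_nonneg: "(\<And>x. x \<in> set_pmf p \<Longrightarrow> 0 \<le> f x) \<Longrightarrow> 0 \<le> expect p f"
  unfolding expect_def by (intro sum_nonneg) auto

lemma expect_add: "expect p (\<lambda>x. f x + g x) = expect p f + expect p g"
  unfolding expect_def by (simp add: distrib_left sum.distrib)

lemma expect_diff: "expect p (\<lambda>x. f x - g x) = expect p f - expect p g"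
  unfolding expect_def by (simp add: right_diff_distrib sum_subtractf)

lemma expect_cmult: "expect p (\<lambda>x. c * f x) = c * expect p f"
  unfolding expect_def by (simp add: sum_distrib_left mult.left_commute)

lemma expect_multc: "expect p (\<lambda>x. f x * c) = expect p f * c"
  unfolding expect_def by (simp add: sum_distrib_right mult.assoc)

lemma expect_sum: "expect p (\<lambda>x. \<Sum>i\<in>I. f i x) = (\<Sum>i\<in>I. expect p (f i))"
  unfolding expect_def unfolding sum_distrib_left by (rule sum.swap)

text \<open>Over an infinite support \<open>expect\<close> is 0 by the convention for
  \<open>sum\<close>, so linearity, monotonicity and exchange hold outright; finiteness enters only
  with total masses and changes of variables.\<close>

lemma expect_swap: "expect p (\<lambda>x. expect q (f x)) = expect q (\<lambda>y. expect p (\<lambda>x. f x y))"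
  unfolding expect_def unfolding sum_distrib_left by (subst sum.swap) (simp add: mult.left_commute)

lemma expect_const: "finite (set_pmf p) \<Longrightarrow> expect p (\<lambda>_. c) = c"
  by (simp add: expect_eq_expectation)

lemma expect_le_const:
  "finite (set_pmf p) \<Longrightarrow> (\<And>x. x \<in> set_pmf p \<Longrightarrow> f x \<le> c) \<Longrightarrow> expect p f \<le> c"
  using expect_mono[of p f "\<lambda>_. c"] by (simp add: expect_const)

lemma expect_ge_const:
  "finite (set_pmf p) \<Longrightarrow> (\<And>x. x \<in> set_pmf p \<Longrightarrow> c \<le> f x) \<Longrightarrow> c \<le> expect p f"
  using expect_mono[of p "\<lambda>_. c" f] by (simp add: expect_const)

lemma expect_return [simp]: "expect (return_pmf x) f = f x"
  by (simp add: expect_def)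

lemma expect_map: "finite (set_pmf p) \<Longrightarrow> expect (map_pmf h p) f = expect p (\<lambda>x. f (h x))"
  by (simp add: expect_eq_expectation)

lemma expect_bind:
  assumes "finite (set_pmf p)" "\<And>x. x \<in> set_pmf p \<Longrightarrow> finite (set_pmf (h x))"
  shows "expect (bind_pmf p h) f = expect p (\<lambda>x. expect (h x) f)"
proof -
  have "expect (bind_pmf p h) f = measure_pmf.expectation (bind_pmf p h) f"
    using assms by (intro expect_eq_expectation) auto
  also have "\<dots> = (\<Sum>a\<in>set_pmf p. pmf p a * measure_pmf.expectation (h a) f)"
    using assms by (subst pmf_expectation_bind[of "set_pmf p"]) auto
  also have "\<dots> = expect p (\<lambda>x. expect (h x) f)"
    unfolding expect_def[of p] using assms by (intro sum.cong) (auto simp: expect_eq_expectation)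
  finally show ?thesis .
qed

lemma expect_pair:
  assumes "finite (set_pmf p)" "finite (set_pmf q)"
  shows "expect (pair_pmf p q) f = expect p (\<lambda>x. expect q (\<lambda>y. f (x, y)))"
  using assms by (simp add: pair_pmf_def expect_bind)

text \<open>First moment method; it fixes the codebook in \<open>exists_code\<close> and
  derandomizes the encoder in \<open>exists_input\<close>.\<close>

lemma expect_exists_le:
  assumes "finite (set_pmf p)" "expect p f \<le> c"
  shows "\<exists>x. f x \<le> c"
proof (rule ccontr)
  assume "\<not> ?thesis"
  then have "0 < f x - c" for x
    by (simp add: not_le)
  then have "0 < expect p (\<lambda>x. f x - c)"
    unfolding expect_def using assms(1) 
    by (intro sum_pos) (auto simp: set_pmf_not_empty pmf_positive)
  then show False
    using assms by (simp add: expect_diff expect_const)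
qed

lemma expect_markov:
  assumes "\<And>x. x \<in> set_pmf p \<Longrightarrow> 0 \<le> f x" "0 < t"
  shows "expect p (\<lambda>x. of_bool (t \<le> f x)) \<le> expect p f / t"
proof -
  have "expect p (\<lambda>x. of_bool (t \<le> f x)) \<le> expect p (\<lambda>x. f x * (1 / t))"
    using assms by (intro expect_mono) (auto simp: field_simps)
  then show ?thesis
    by (simp only: expect_multc) simp
qed

lemma expect_nested_markov:
  assumes "expect p (\<lambda>x. expect (k x) (f x)) \<le> 1" "\<And>x y. 0 \<le> f x y" "0 < t"
  shows "expect p (\<lambda>x. expect (k x) (\<lambda>y. of_bool (t \<le> f x y))) \<le> 1 / t"
proof -
  have "expect p (\<lambda>x. expect (k x) (\<lambda>y. of_bool (t \<le> f x y))) \<le> expect p (\<lambda>x. expect (k x) (f x) * (1 / t))"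
    using expect_markov[of "k _" "f _" t] assms by (intro expect_mono) auto
  also have "\<dots> = expect p (\<lambda>x. expect (k x) (f x)) * (1 / t)" by (rule expect_multc)
  also have "\<dots> \<le> 1 * (1 / t)" using assms by (intro mult_right_mono) auto
  finally show ?thesis by simp
qed

subsection \<open>Products of finitely supported distributions\<close>

lemma finite_set_Pi_pmf:
  assumes "finite I" "\<And>i. i \<in> I \<Longrightarrow> finite (set_pmf (p i))"
  shows "finite (set_pmf (Pi_pmf I d p))"
  using assms by (simp add: set_Pi_pmf) (intro finite_PiE_dflt, auto)

lemma expect_Pi_insert:
  assumes "finite I" "i \<notin> I" "\<And>j. j \<in> insert i I \<Longrightarrow> finite (set_pmf (p j))"
  shows "expect (Pi_pmf (insert i I) d p) F =
    expect (Pi_pmf I d p) (\<lambda>f. expect (p i) (\<lambda>x. F (f(i := x))))"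
proof -
  have fin: "finite (set_pmf (p i))" "finite (set_pmf (Pi_pmf I d p))"
    using assms finite_set_Pi_pmf[of I p d] by auto
  have "expect (Pi_pmf (insert i I) d p) F
    = expect (p i) (\<lambda>x. expect (Pi_pmf I d p) (\<lambda>f. F (f(i := x))))"
    using assms(1,2) fin by (simp add: Pi_pmf_insert expect_map expect_pair)
  then show ?thesis by (simp add: expect_swap[of "p i"])
qed

lemma expect_Pi_component:
  assumes "finite I" "i \<in> I" "\<And>j. j \<in> I \<Longrightarrow> finite (set_pmf (p j))"
  shows "expect (Pi_pmf I d p) (\<lambda>f. F (f i)) = expect (p i) F"
proof -
  have "expect (map_pmf (\<lambda>f. f i) (Pi_pmf I d p)) F = expect (Pi_pmf I d p) (\<lambda>f. F (f i))"
    using assms by (intro expect_map finite_set_Pi_pmf) auto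
  then show ?thesis using assms by (simp add: Pi_pmf_component)
qed

lemma expect_Pi_split:
  assumes "finite I" "J \<subseteq> I" "\<And>j. j \<in> I \<Longrightarrow> finite (set_pmf (p j))"
  shows "expect (Pi_pmf I d p) F = expect (Pi_pmf J d p) (\<lambda>f.
    expect (Pi_pmf (I - J) d p) (\<lambda>g. F (\<lambda>x. if x \<in> J then f x else g x)))"
proof -
  have fin: "finite (set_pmf (Pi_pmf J d p))" "finite (set_pmf (Pi_pmf (I - J) d p))"
    using assms by (auto intro!: finite_set_Pi_pmf intro: finite_subset)
  have "I = J \<union> (I - J)" using assms by auto
  then have "Pi_pmf I d p = map_pmf (\<lambda>(f,g) x. if x \<in> J then f x else g x)
             (pair_pmf (Pi_pmf J d p) (Pi_pmf (I - J) d p))"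
    using assms finite_subset[of J I] Pi_pmf_union[of J "I - J" d p] by auto
  then show ?thesis using fin by (simp add: expect_map expect_pair)
qed

lemma expect_Pi_pair:
  assumes "finite I" "i \<in> I" "j \<in> I" "i \<noteq> j" "\<And>k. k \<in> I \<Longrightarrow> finite (set_pmf (p k))"
  shows "expect (Pi_pmf I d p) (\<lambda>f. F (f i) (f j)) =
    expect (p i) (\<lambda>x. expect (p j) (\<lambda>y. F x y))"
proof -
  have I: "I = insert j (I - {j})" using assms by auto
  have "expect (Pi_pmf I d p) (\<lambda>f. F (f i) (f j)) =
    expect (Pi_pmf (I - {j}) d p) (\<lambda>f. expect (p j) (\<lambda>x. F (f i) x))"
    using assms by (subst I, subst expect_Pi_insert) auto
  also have "\<dots> = expect (p i) (\<lambda>x. expect (p j) (\<lambda>y. F x y))"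
    using assms expect_Pi_component[of "I - {j}" i p d "\<lambda>z. expect (p j) (\<lambda>x. F z x)"] by auto
  finally show ?thesis .
qed

lemma expect_Pi_triple:
  assumes "finite I" "i \<in> I" "j \<in> I" "k \<in> I" "i \<noteq> j" "i \<noteq> k" "j \<noteq> k"
    "\<And>l. l \<in> I \<Longrightarrow> finite (set_pmf (p l))"
  shows "expect (Pi_pmf I d p) (\<lambda>f. F (f i) (f j) (f k)) =
    expect (p i) (\<lambda>x. expect (p j) (\<lambda>y. expect (p k) (\<lambda>z. F x y z)))"
proof -
  have I: "I = insert k (I - {k})" using assms by auto
  have "expect (Pi_pmf I d p) (\<lambda>f. F (f i) (f j) (f k)) =
    expect (Pi_pmf (I - {k}) d p) (\<lambda>f. expect (p k) (\<lambda>z. F (f i) (f j) z))"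
    using assms by (subst I, subst expect_Pi_insert) auto
  also have "\<dots> = expect (p i) (\<lambda>x. expect (p j) (\<lambda>y. expect (p k) (\<lambda>z. F x y z)))"
    using assms expect_Pi_pair[of "I - {k}" i j p d "\<lambda>x y. expect (p k) (\<lambda>z. F x y z)"] by auto
  finally show ?thesis .
qed

text \<open>Integrating the last letter first makes the product of one-step densities telescope.\<close>

lemma expect_Pi_chain_le_1:
  fixes m :: "nat \<Rightarrow> 'a \<Rightarrow> 'a \<Rightarrow> real"
  assumes fin: "\<And>i. finite (set_pmf (p i))"
    and m0: "\<And>i a b. 0 \<le> m i a b"
    and m1: "\<And>i a. i < N \<Longrightarrow> expect (p (Suc (Suc i))) (m i a) \<le> 1"
  shows "expect (Pi_pmf {..<Suc (Suc N)} d p) (\<lambda>f. \<Prod>i<N. m i (f (Suc i)) (f (Suc (Suc i)))) \<le> 1"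
  using m1
proof (induction N)
  case 0
  then show ?case using fin by (simp add: expect_const finite_set_Pi_pmf)
next
  case (Suc N)
  let ?P = "Pi_pmf {..<Suc (Suc N)} d p"
  have eq: "{..<Suc (Suc (Suc N))} = insert (Suc (Suc N)) {..<Suc (Suc N)}" by auto
  have "expect (Pi_pmf {..<Suc (Suc (Suc N))} d p) (\<lambda>f. \<Prod>i<Suc N. m i (f (Suc i)) (f (Suc (Suc i))))
    = expect ?P (\<lambda>f. expect (p (Suc (Suc N))) (\<lambda>x.
        (\<Prod>i<N. m i (f (Suc i)) (f (Suc (Suc i)))) * m N (f (Suc N)) x))"
    unfolding eq using fin by (subst expect_Pi_insert) auto
  also have "\<dots> = expect ?P (\<lambda>f.
        (\<Prod>i<N. m i (f (Suc i)) (f (Suc (Suc i)))) * expect (p (Suc (Suc N))) (m N (f (Suc N))))"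
    by (simp add: expect_cmult)
  also have "\<dots> \<le> expect ?P (\<lambda>f. \<Prod>i<N. m i (f (Suc i)) (f (Suc (Suc i))))"
    using Suc.prems[of N] m0 by (intro expect_mono mult_left_le prod_nonneg) auto
  also have "\<dots> \<le> 1" using Suc by auto
  finally show ?case .
qed

text \<open>A product of mixtures is a mixture of products. This peels off the layers of the
  superposition code: \<open>w\<close> first, then \<open>u\<close> and \<open>v\<close>; or inputs
  first, then outputs.\<close>

lemma expect_Pi_bind:
  assumes "finite I" "\<And>i. finite (set_pmf (p i))" "\<And>i x. finite (set_pmf (k i x))"
  shows "expect (Pi_pmf I d (\<lambda>i. bind_pmf (p i) (k i))) F =
    expect (Pi_pmf I d' p) (\<lambda>f. expect (Pi_pmf I d (\<lambda>i. k i (f i))) F)"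
  using assms by (subst Pi_pmf_bind[where d'=d']) (auto intro!: expect_bind finite_set_Pi_pmf)

lemma expect_Pi_map:
  assumes "finite I" "\<And>i. finite (set_pmf (p i))"
  shows "expect (Pi_pmf I d (\<lambda>i. map_pmf (h i) (p i))) F =
    expect (Pi_pmf I d' p) (\<lambda>f. F (\<lambda>i. if i \<in> I then h i (f i) else d))"
  unfolding map_pmf_def using assms by (subst expect_Pi_bind[where d'=d']) auto

lemma Pi_pmf_default:
  assumes "finite I" "f \<in> set_pmf (Pi_pmf I d p)" "i \<notin> I"
  shows "f i = d"
  using set_Pi_pmf_subset[OF assms(1), of d p] assms by auto

lemma Pi_pmf_member:
  assumes "finite I" "f \<in> set_pmf (Pi_pmf I d p)" "i \<in> I"
  shows "f i \<in> set_pmf (p i)"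
  using assms by (auto simp: set_Pi_pmf PiE_dflt_def)

text \<open>\<open>\<gamma>\<close> is the density of \<open>p'\<close> with respect to
  \<open>p\<close>, and densities of product measures multiply. It serves to replace letters
  weighted by the encoder's weights by letters of the true law.\<close>

lemma expect_Pi_change_of_measure:
  assumes "finite I" "finite (set_pmf p)" "finite (set_pmf p')"
    and \<gamma>: "\<And>x. pmf p' x = pmf p x * \<gamma> x"
  shows "expect (Pi_pmf I d (\<lambda>_. p)) (\<lambda>f. (\<Prod>i\<in>I. \<gamma> (f i)) * F f) = expect (Pi_pmf I d (\<lambda>_. p')) F"
  using assms(1)
proof (induction I arbitrary: F rule: finite_induct)
  case empty
  then show ?case by simp
next
  case (insert i I)
  have one: "expect p (\<lambda>x. \<gamma> x * H x) = expect p' H" for H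
  proof -
    have "set_pmf p' \<subseteq> set_pmf p" using \<gamma> by (auto simp: set_pmf_iff)
    then have "expect p' H = (\<Sum>x\<in>set_pmf p. pmf p' x * H x)"
      using assms by (intro expect_superset)
    then show ?thesis by (simp add: expect_def \<gamma> mult.assoc)
  qed
  have "expect (Pi_pmf (insert i I) d (\<lambda>_. p)) (\<lambda>f. (\<Prod>i\<in>insert i I. \<gamma> (f i)) * F f)
    = expect (Pi_pmf I d (\<lambda>_. p)) (\<lambda>f. expect p (\<lambda>x. (\<Prod>j\<in>I. \<gamma> (f j)) * (\<gamma> x * F (f(i := x)))))"
    using insert assms
    by (subst expect_Pi_insert)
       (auto intro!: expect_cong prod.cong simp: mult.left_commute mult.assoc)
  also have "\<dots> = expect (Pi_pmf I d (\<lambda>_. p)) (\<lambda>f. (\<Prod>j\<in>I. \<gamma> (f j)) * expect p' (\<lambda>x. F (f(i := x))))"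
    by (simp only: expect_cmult one)
  also have "\<dots> = expect (Pi_pmf I d (\<lambda>_. p')) (\<lambda>f. expect p' (\<lambda>x. F (f(i := x))))"
    by (rule insert.IH)
  also have "\<dots> = expect (Pi_pmf (insert i I) d (\<lambda>_. p')) F"
    using insert assms by (subst expect_Pi_insert) auto
  finally show ?case .
qed

lemma expect_Pi_prod_le_1:
  assumes "finite I" "\<And>i. finite (set_pmf (p i))" "\<And>i x. 0 \<le> f i x" "\<And>i. expect (p i) (f i) \<le> 1"
  shows "expect (Pi_pmf I d p) (\<lambda>h. \<Prod>i\<in>I. f i (h i)) \<le> 1"
proof -
  have "expect (Pi_pmf I d p) (\<lambda>h. \<Prod>i\<in>I. f i (h i)) = (\<Prod>i\<in>I. measure_pmf.expectation (p i) (f i))"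
    using assms by (subst expect_eq_expectation)
      (auto intro!: expectation_prod_Pi_pmf finite_set_Pi_pmf integrable_measure_pmf_finite)
  also have "\<dots> = (\<Prod>i\<in>I. expect (p i) (f i))" using assms(2) by (simp add: expect_eq_expectation)
  also have "\<dots> \<le> 1" using assms by (intro prod_le_1) (auto intro: expect_nonneg)
  finally show ?thesis .
qed

subsection \<open>A one-shot Marton code\<close>

text \<open>Jensen's inequality for \<open>1 / x\<close> is used in the form of the tangent bound \<open>1 / S \<ge> 2 / c - S / c\<^sup>2\<close> at
  \<open>c = G + K1 * K2\<close>, an upper bound for the conditional mean of the total weight \<open>S\<close>.\<close>

lemma likelihood_encoder:
  fixes g \<Phi> :: "'u \<Rightarrow> 'v \<Rightarrow> real" and K1 K2 :: nat
  assumes fin: "finite (set_pmf pu)" "finite (set_pmf pv)"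
    and g0: "\<And>u v. 0 \<le> g u v" and \<Phi>0: "\<And>u v. 0 \<le> \<Phi> u v"
    and Eu: "\<And>v. expect pu (\<lambda>u. g u v) \<le> 1" and Ev: "\<And>u. expect pv (\<lambda>v. g u v) \<le> 1"
    and G: "\<And>u v. \<Phi> u v \<noteq> 0 \<Longrightarrow> g u v \<le> G" and G0: "0 \<le> G"
    and K: "0 < K1" "0 < K2"
  defines "KK \<equiv> {..<K1} \<times> {..<K2}"
  shows "expect pu (\<lambda>u. expect pv (\<lambda>v. g u v * \<Phi> u v)) * (real (K1 * K2) / (G + real (K1 * K2))) \<le>
    expect (Pi_pmf {..<K1} d1 (\<lambda>_. pu)) (\<lambda>U. expect (Pi_pmf {..<K2} d2 (\<lambda>_. pv)) (\<lambda>V.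
      \<Sum>k\<in>KK. g (U (fst k)) (V (snd k)) / (\<Sum>k'\<in>KK. g (U (fst k')) (V (snd k')))
         * \<Phi> (U (fst k)) (V (snd k))))"
proof -
  let ?PU = "Pi_pmf {..<K1} d1 (\<lambda>_. pu)" and ?PV = "Pi_pmf {..<K2} d2 (\<lambda>_. pv)"
  define \<psi> where "\<psi> u v = g u v * \<Phi> u v" for u v
  define e0 where "e0 = expect pu (\<lambda>u. expect pv (\<lambda>v. \<psi> u v))"
  define c where "c = G + real (K1 * K2)"
  define S where "S U V = (\<Sum>k'\<in>KK. g (U (fst k')) (V (snd k')))" for U V
  have \<psi>0: "0 \<le> \<psi> u v" for u v using g0 \<Phi>0 by (simp add: \<psi>_def)
  have e00: "0 \<le> e0" unfolding e0_def by (intro expect_nonneg \<psi>0)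
  have cpos: "0 < c" using G0 K unfolding c_def
    by (metis add_nonneg_pos nat_0_less_mult_iff of_nat_0_less_iff)
  have S0: "0 \<le> S U V" for U V unfolding S_def by (intro sum_nonneg g0)
  have finK: "finite KK" by (simp add: KK_def)
  have tangent: "\<psi> (U (fst k)) (V (snd k)) * (2 / c) - \<psi> (U (fst k)) (V (snd k)) * S U V * (1 / c\<^sup>2)
      \<le> g (U (fst k)) (V (snd k)) / S U V * \<Phi> (U (fst k)) (V (snd k))" if k: "k \<in> KK" for U V k
  proof (cases "S U V = 0")
    \<comment> \<open>All weights vanish; the quotient is then 0 by convention, and so is the left
      side.\<close>
    case True
    then have "g (U (fst k)) (V (snd k)) = 0"
      using k finK g0 unfolding S_def by (subst (asm) sum_nonneg_eq_0_iff) auto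
    then show ?thesis by (simp add: \<psi>_def)
  next
    case False
    then have Sp: "0 < S U V" using S0[of U V] by linarith
    have "0 \<le> (S U V - c)\<^sup>2 / (S U V * c\<^sup>2)" using Sp by simp
    also have "\<dots> = 1 / S U V - (2 / c - S U V / c\<^sup>2)"
      using Sp cpos by (simp add: field_simps power2_eq_square)
    finally have "\<psi> (U (fst k)) (V (snd k)) * (2 / c - S U V / c\<^sup>2) \<le> \<psi> (U (fst k)) (V (snd k)) * (1 / S U V)"
      by (intro mult_left_mono \<psi>0) simp
    then show ?thesis by (simp add: \<psi>_def algebra_simps)
  qed
  have one: "expect ?PU (\<lambda>U. expect ?PV (\<lambda>V. \<psi> (U (fst k)) (V (snd k)))) = e0" if k: "k \<in> KK" for k
  proof -
    have "expect ?PU (\<lambda>U. expect ?PV (\<lambda>V. \<psi> (U (fst k)) (V (snd k))))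
      = expect ?PU (\<lambda>U. expect pv (\<lambda>v. \<psi> (U (fst k)) v))"
      using k fin by (intro expect_cong expect_Pi_component) (auto simp: KK_def)
    also have "\<dots> = e0" unfolding e0_def
      using k fin expect_Pi_component[of "{..<K1}" "fst k" "\<lambda>_. pu" d1 "\<lambda>u. expect pv (\<lambda>v. \<psi> u v)"]
      by (auto simp: KK_def)
    finally show ?thesis .
  qed
  \<comment> \<open>For \<open>k \<noteq> k'\<close> some coordinate of \<open>k'\<close> is a fresh
    word, independent of everything in \<open>\<psi>\<close>; averaging \<open>g\<close> over it
    alone gives at most 1, whatever the other coordinate is. The diagonal term is where the cap
    \<open>G\<close> on the support of \<open>\<Phi>\<close> acts.\<close>
  have two: "expect ?PU (\<lambda>U. expect ?PV (\<lambda>V. \<psi> (U (fst k)) (V (snd k)) * g (U (fst k')) (V (snd k'))))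
      \<le> (if k = k' then G * e0 else e0)" if k: "k \<in> KK" and k': "k' \<in> KK" for k k'
  proof -
    consider "k = k'" | "fst k \<noteq> fst k'" | "fst k = fst k'" "snd k \<noteq> snd k'"
      by (metis prod_eqI)
    then show ?thesis
    proof cases
      case 1
      have "\<psi> u v * g u v \<le> G * \<psi> u v" for u v
        using G[of u v] \<psi>0[of u v] g0[of u v] 
        by (cases "\<Phi> u v = 0") (auto simp: mult.commute \<psi>_def intro!: mult_right_mono \<Phi>0)
      then have "expect ?PU (\<lambda>U. expect ?PV (\<lambda>V. \<psi> (U (fst k)) (V (snd k)) * g (U (fst k')) (V (snd k'))))
        \<le> expect ?PU (\<lambda>U. expect ?PV (\<lambda>V. G * \<psi> (U (fst k)) (V (snd k))))"
        using 1 by (intro expect_mono) auto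
      also have "\<dots> = G * e0" by (simp add: expect_cmult one[OF k])
      finally show ?thesis using 1 by simp
    next
      case 2
      have *: "expect ?PU (\<lambda>U. \<psi> (U (fst k)) v * g (U (fst k')) v') \<le> expect ?PU (\<lambda>U. \<psi> (U (fst k)) v)" for v v'
      proof -
        have "expect ?PU (\<lambda>U. \<psi> (U (fst k)) v * g (U (fst k')) v')
          = expect pu (\<lambda>u. expect pu (\<lambda>u'. \<psi> u v * g u' v'))"
          using k k' 2 fin by (intro expect_Pi_pair[where F="\<lambda>u u'. \<psi> u v * g u' v'"]) (auto simp: KK_def)
        also have "\<dots> = expect pu (\<lambda>u. \<psi> u v) * expect pu (\<lambda>u'. g u' v')"
          by (simp add: expect_cmult expect_multc)
        also have "\<dots> \<le> expect pu (\<lambda>u. \<psi> u v)"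
          by (intro mult_left_le Eu expect_nonneg \<psi>0)
        also have "\<dots> = expect ?PU (\<lambda>U. \<psi> (U (fst k)) v)"
          using k fin by (intro expect_Pi_component[symmetric, where F="\<lambda>u. \<psi> u v"]) (auto simp: KK_def)
        finally show ?thesis .
      qed
      have "expect ?PV (\<lambda>V. expect ?PU (\<lambda>U. \<psi> (U (fst k)) (V (snd k)) * g (U (fst k')) (V (snd k'))))
        \<le> expect ?PV (\<lambda>V. expect ?PU (\<lambda>U. \<psi> (U (fst k)) (V (snd k))))"
        by (intro expect_mono *)
      then show ?thesis
        unfolding expect_swap[of ?PV ?PU] one[OF k] using 2 by auto
    next
      case 3
      have *: "expect ?PV (\<lambda>V. \<psi> u (V (snd k)) * g u' (V (snd k'))) \<le> expect ?PV (\<lambda>V. \<psi> u (V (snd k)))" for u u'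
      proof -
        have "expect ?PV (\<lambda>V. \<psi> u (V (snd k)) * g u' (V (snd k')))
          = expect pv (\<lambda>v. expect pv (\<lambda>v'. \<psi> u v * g u' v'))"
          using k k' 3 fin by (intro expect_Pi_pair[where F="\<lambda>v v'. \<psi> u v * g u' v'"]) (auto simp: KK_def)
        also have "\<dots> = expect pv (\<lambda>v. \<psi> u v) * expect pv (\<lambda>v'. g u' v')"
          by (simp add: expect_cmult expect_multc)
        also have "\<dots> \<le> expect pv (\<lambda>v. \<psi> u v)"
          by (intro mult_left_le Ev expect_nonneg \<psi>0)
        also have "\<dots> = expect ?PV (\<lambda>V. \<psi> u (V (snd k)))"
          using k fin by (intro expect_Pi_component[symmetric, where F="\<lambda>v. \<psi> u v"]) (auto simp: KK_def)
        finally show ?thesis .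
      qed
      have "expect ?PU (\<lambda>U. expect ?PV (\<lambda>V. \<psi> (U (fst k)) (V (snd k)) * g (U (fst k')) (V (snd k'))))
        \<le> expect ?PU (\<lambda>U. expect ?PV (\<lambda>V. \<psi> (U (fst k)) (V (snd k))))"
        by (intro expect_mono *)
      then show ?thesis using 3 one[OF k] by auto
    qed
  qed
  have card: "real (card KK) = real (K1 * K2)" by (simp add: KK_def card_cartesian_product)
  have three: "expect ?PU (\<lambda>U. expect ?PV (\<lambda>V. \<psi> (U (fst k)) (V (snd k)) * S U V)) \<le> c * e0"
    if k: "k \<in> KK" for k
  proof -
    have "expect ?PU (\<lambda>U. expect ?PV (\<lambda>V. \<psi> (U (fst k)) (V (snd k)) * S U V))
      = (\<Sum>k'\<in>KK. expect ?PU (\<lambda>U. expect ?PV (\<lambda>V. \<psi> (U (fst k)) (V (snd k)) * g (U (fst k')) (V (snd k')))))"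
      unfolding S_def sum_distrib_left by (simp add: expect_sum)
    also have "\<dots> \<le> (\<Sum>k'\<in>KK. (if k = k' then G * e0 else 0) + e0)"
      using e00 by (intro sum_mono order.trans[OF two[OF k]]) auto
    also have "\<dots> = c * e0"
      using finK k by (simp add: sum.distrib card c_def algebra_simps)
    finally show ?thesis .
  qed
  \<comment> \<open>Each of the \<open>K1 * K2\<close> summands is
    \<open>2 * e0 / c - e0 / c\<close>.\<close>
  have "e0 * (real (K1 * K2) / c) = (\<Sum>k\<in>KK. e0 * (2 / c) - c * e0 * (1 / c\<^sup>2))"
    using cpos card by (simp add: power2_eq_square field_simps)
  also have "\<dots> \<le> (\<Sum>k\<in>KK. expect ?PU (\<lambda>U. expect ?PV (\<lambda>V. \<psi> (U (fst k)) (V (snd k)) * (2 / c)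
      - \<psi> (U (fst k)) (V (snd k)) * S U V * (1 / c\<^sup>2))))"
  proof (rule sum_mono)
    fix k assume k: "k \<in> KK"
    show "e0 * (2 / c) - c * e0 * (1 / c\<^sup>2) \<le> expect ?PU (\<lambda>U. expect ?PV (\<lambda>V. \<psi> (U (fst k)) (V (snd k)) * (2 / c)
      - \<psi> (U (fst k)) (V (snd k)) * S U V * (1 / c\<^sup>2)))"
      unfolding expect_diff expect_multc one[OF k]
      by (intro diff_left_mono mult_right_mono three k) auto
  qed
  also have "\<dots> \<le> (\<Sum>k\<in>KK. expect ?PU (\<lambda>U. expect ?PV (\<lambda>V.
      g (U (fst k)) (V (snd k)) / S U V * \<Phi> (U (fst k)) (V (snd k)))))"
    by (intro sum_mono expect_mono tangent)
  also have "\<dots> = expect ?PU (\<lambda>U. expect ?PV (\<lambda>V.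
      \<Sum>k\<in>KK. g (U (fst k)) (V (snd k)) / S U V * \<Phi> (U (fst k)) (V (snd k))))"
    by (simp add: expect_sum)
  finally show ?thesis
    unfolding e0_def \<psi>_def c_def S_def .
qed

text \<open>Each index in \<open>I\<close> owns a cloud centre \<open>w\<close>, \<open>B1\<close> bins of \<open>K1\<close> satellites \<open>u\<close> and \<open>B2\<close> bins of \<open>K2\<close>
  satellites \<open>v\<close>; messages are triples (cloud index, \<open>u\<close>-bin, \<open>v\<close>-bin). \<open>D1\<close> and \<open>D2\<close> are the tests of
  the receivers.\<close>

locale marton_code =
  fixes pw :: "'w pmf" and pu :: "'w \<Rightarrow> 'u pmf" and pv :: "'w \<Rightarrow> 'v pmf"
    and g :: "'w \<Rightarrow> 'u \<Rightarrow> 'v \<Rightarrow> real"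
    and \<kappa> :: "'w \<Rightarrow> 'u \<Rightarrow> 'v \<Rightarrow> 'x pmf" and Q :: "'x \<Rightarrow> ('y \<times> 'z) pmf"
    and D1 :: "'w \<Rightarrow> 'u \<Rightarrow> 'y \<Rightarrow> bool" and D2 :: "'w \<Rightarrow> 'v \<Rightarrow> 'z \<Rightarrow> bool"
    and I :: "'i set" and B1 K1 B2 K2 :: nat and G \<epsilon> t1 t1' t2 t2' :: real
  assumes fin_pw: "finite (set_pmf pw)" and fin_pu: "\<And>w. finite (set_pmf (pu w))"
    and fin_pv: "\<And>w. finite (set_pmf (pv w))" and fin_\<kappa>: "\<And>w u v. finite (set_pmf (\<kappa> w u v))"
    and fin_Q: "\<And>x. finite (set_pmf (Q x))" and fin_I: "finite I"
    and g_nonneg: "\<And>w u v. 0 \<le> g w u v"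
    and g_u: "\<And>w v. expect (pu w) (\<lambda>u. g w u v) \<le> 1"
    and g_v: "\<And>w u. expect (pv w) (\<lambda>v. g w u v) \<le> 1"
    and G_nonneg: "0 \<le> G" and K_pos: "0 < K1" "0 < K2" and \<epsilon>_nonneg: "0 \<le> \<epsilon>"
    and typical: "1 - \<epsilon> \<le> expect pw (\<lambda>w. expect (pu w) (\<lambda>u. expect (pv w) (\<lambda>v.
        g w u v * (of_bool (g w u v \<le> G) * expect (\<kappa> w u v) (\<lambda>x. expect (Q x) (\<lambda>o'.
          of_bool (D1 w u (fst o') \<and> D2 w v (snd o'))))))))"
    and other_w_1: "\<And>y. expect pw (\<lambda>w. expect (pu w) (\<lambda>u. of_bool (D1 w u y))) \<le> t1"
    and same_w_1: "\<And>w y. expect (pu w) (\<lambda>u. of_bool (D1 w u y)) \<le> t1'"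
    and other_w_2: "\<And>z. expect pw (\<lambda>w. expect (pv w) (\<lambda>v. of_bool (D2 w v z))) \<le> t2"
    and same_w_2: "\<And>w z. expect (pv w) (\<lambda>v. of_bool (D2 w v z)) \<le> t2'"
begin

section \<open>The selection inside a pair of bins\<close>

definition KK where "KK = {..<K1} \<times> {..<K2}"

definition out where "out w u v F = expect (\<kappa> w u v) (\<lambda>x. expect (Q x) F)"

text \<open>If all weights vanish, division by zero makes every \<open>wt\<close> zero. The
  selection law is thus only a sub-probability, and a message without a selected pair is counted as
  an error.\<close>

definition wt where
  "wt w U V k = g w (U (fst k)) (V (snd k)) / (\<Sum>k'\<in>KK. g w (U (fst k')) (V (snd k')))"

text \<open>Mean over the selected pair and the channel output, of total mass 0 or 1; hence success
  is measured by \<open>avg\<close> and failure by 1 minus it.\<close>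

definition avg where
  "avg w U V F = (\<Sum>k\<in>KK. wt w U V k * out w (U (fst k)) (V (snd k)) (F (U (fst k)) (V (snd k))))"

lemma finite_KK: "finite KK" by (simp add: KK_def)

lemma wt_nonneg: "0 \<le> wt w U V k"
  unfolding wt_def by (intro divide_nonneg_nonneg sum_nonneg g_nonneg)

lemma sum_wt: "(\<Sum>k\<in>KK. wt w U V k) = (if (\<Sum>k'\<in>KK. g w (U (fst k')) (V (snd k'))) = 0 then 0 else 1)"
  unfolding wt_def by (simp add: sum_divide_distrib[symmetric])

lemma out_mono: "(\<And>o'. F o' \<le> F' o') \<Longrightarrow> out w u v F \<le> out w u v F'"
  unfolding out_def by (intro expect_mono)

lemma out_const: "out w u v (\<lambda>_. c) = c"
  unfolding out_def by (simp add: expect_const fin_Q fin_\<kappa>)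

lemma avg_mono: "(\<And>u v o'. F u v o' \<le> F' u v o') \<Longrightarrow> avg w U V F \<le> avg w U V F'"
  unfolding avg_def by (intro sum_mono mult_left_mono wt_nonneg out_mono)

lemma avg_diff: "avg w U V (\<lambda>u v o'. F u v o' - F' u v o') = avg w U V F - avg w U V F'"
  unfolding avg_def out_def by (simp add: expect_diff right_diff_distrib sum_subtractf)

lemma avg_add: "avg w U V (\<lambda>u v o'. F u v o' + F' u v o') = avg w U V F + avg w U V F'"
  unfolding avg_def out_def by (simp add: expect_add distrib_left sum.distrib)

lemma avg_sum: "avg w U V (\<lambda>u v o'. \<Sum>i\<in>J. F i u v o') = (\<Sum>i\<in>J. avg w U V (F i))"
  unfolding avg_def out_def by (subst sum.swap) (simp add: expect_sum sum_distrib_left)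

lemma avg_le_const:
  assumes "\<And>u v o'. F u v o' \<le> c" "0 \<le> c"
  shows "avg w U V F \<le> c"
proof -
  have "avg w U V F \<le> avg w U V (\<lambda>_ _ _. c)" by (intro avg_mono assms)
  also have "\<dots> = (\<Sum>k\<in>KK. wt w U V k) * c"
    unfolding avg_def by (simp add: out_const sum_distrib_right)
  also have "\<dots> \<le> c" using assms by (simp add: sum_wt)
  finally show ?thesis .
qed

lemma expect_avg:
  "expect p (\<lambda>t. avg w U V (F t)) = avg w U V (\<lambda>u v o'. expect p (\<lambda>t. F t u v o'))"
proof -
  have "expect p (\<lambda>t. out w u v (F t u v)) = out w u v (\<lambda>o'. expect p (\<lambda>t. F t u v o'))" for u v
    unfolding out_def by (simp add: expect_swap[of p])
  then show ?thesis unfolding avg_def by (simp add: expect_sum expect_cmult)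
qed

text \<open>Derandomization of the encoder: if a pair is selected, some pair and then some input
  drawn from \<open>\<kappa>\<close> is no worse than average; if all weights vanish, the right side
  is 1 and any input will do.\<close>

lemma exists_input:
  assumes F: "\<And>o'. F o' \<le> 1"
  shows "\<exists>x. expect (Q x) F \<le> 1 - avg w U V (\<lambda>_ _ o'. 1 - F o')"
proof (cases "(\<Sum>k'\<in>KK. g w (U (fst k')) (V (snd k'))) = 0")
  case True
  then have "avg w U V (\<lambda>_ _ o'. 1 - F o') = 0"
    by (simp add: avg_def wt_def)
  then show ?thesis using F fin_Q by (auto intro!: expect_le_const)
next
  case False
  then have W: "(\<Sum>k\<in>KK. wt w U V k) = 1" by (simp add: sum_wt)
  let ?o = "\<lambda>k. out w (U (fst k)) (V (snd k)) F"
  let ?\<rho> = "\<Sum>k\<in>KK. wt w U V k * ?o k"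
  have "avg w U V (\<lambda>_ _ o'. 1 - F o') = avg w U V (\<lambda>_ _ _. 1) - avg w U V (\<lambda>_ _. F)"
    by (rule avg_diff)
  also have "avg w U V (\<lambda>_ _ _. 1) = 1" using W by (simp add: avg_def out_const)
  finally have \<rho>: "1 - avg w U V (\<lambda>_ _ o'. 1 - F o') = ?\<rho>" by (simp add: avg_def)
  have "\<exists>k\<in>KK. ?o k \<le> ?\<rho>"
  proof (rule ccontr)
    assume "\<not> ?thesis"
    then have less: "?\<rho> < ?o k" if "k \<in> KK" for k using that by force
    obtain k where k: "k \<in> KK" "wt w U V k \<noteq> 0"
      using W by (metis sum.neutral zero_neq_one)
    have "(\<Sum>k\<in>KK. wt w U V k * ?\<rho>) < (\<Sum>k\<in>KK. wt w U V k * ?o k)"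
    proof (rule sum_strict_mono_ex1[OF finite_KK])
      show "\<forall>k\<in>KK. wt w U V k * ?\<rho> \<le> wt w U V k * ?o k"
        using less by (intro ballI mult_left_mono wt_nonneg less_imp_le)
      have "0 < wt w U V k" using k wt_nonneg[of w U V k] by linarith
      then show "\<exists>k\<in>KK. wt w U V k * ?\<rho> < wt w U V k * ?o k"
        using k less by (intro bexI[of _ k] mult_strict_left_mono)
    qed
    then show False by (simp add: sum_distrib_right[symmetric] W)
  qed
  then obtain k where "?o k \<le> ?\<rho>" by auto
  then show ?thesis unfolding \<rho> out_def using expect_exists_le[OF fin_\<kappa>] by blast
qed

section \<open>The random codebook and its wrong candidates\<close>

definition PU where "PU w = Pi_pmf {..<B1} undefined (\<lambda>_. Pi_pmf {..<K1} undefined (\<lambda>_. pu w))"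
definition PV where "PV w = Pi_pmf {..<B2} undefined (\<lambda>_. Pi_pmf {..<K2} undefined (\<lambda>_. pv w))"
text \<open>A cluster is stored as \<open>(w, U, V)\<close> with \<open>U b k\<close> the
  \<open>k\<close>-th word of bin \<open>b\<close>. Given \<open>w\<close> all bins are independent,
  on which the wrong-bin bounds rely.\<close>

definition CL where "CL = bind_pmf pw (\<lambda>w. map_pmf (Pair w) (pair_pmf (PU w) (PV w)))"
definition CB where "CB = Pi_pmf I undefined (\<lambda>_. CL)"

lemma fin_PU: "finite (set_pmf (PU w))" and fin_PV: "finite (set_pmf (PV w))"
  unfolding PU_def PV_def by (intro finite_set_Pi_pmf fin_pu fin_pv finite_lessThan)+

lemma fin_CL: "finite (set_pmf CL)"
  unfolding CL_def using fin_pw fin_PU fin_PV by auto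

lemma fin_CB: "finite (set_pmf CB)"
  unfolding CB_def by (intro finite_set_Pi_pmf fin_CL fin_I)

lemma expect_CL:
  "expect CL F = expect pw (\<lambda>w. expect (PU w) (\<lambda>U. expect (PV w) (\<lambda>V. F (w, U, V))))"
  unfolding CL_def using fin_pw fin_PU fin_PV by (subst expect_bind) (auto simp: expect_map expect_pair)

lemma expect_PU_word:
  assumes "b < B1" "k < K1" shows "expect (PU w) (\<lambda>U. F (U b k)) = expect (pu w) F"
  unfolding PU_def using assms
  by (subst expect_Pi_component[where F="\<lambda>U. F (U k)"])
     (auto simp: fin_pu finite_set_Pi_pmf expect_Pi_component[where F=F])

lemma expect_PV_word:
  assumes "b < B2" "k < K2" shows "expect (PV w) (\<lambda>V. F (V b k)) = expect (pv w) F"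
  unfolding PV_def using assms
  by (subst expect_Pi_component[where F="\<lambda>U. F (U k)"])
     (auto simp: fin_pv finite_set_Pi_pmf expect_Pi_component[where F=F])

lemma expect_CB_cluster: "a \<in> I \<Longrightarrow> expect CB (\<lambda>c. F (c a)) = expect CL F"
  unfolding CB_def by (intro expect_Pi_component fin_I fin_CL)

lemma t_nonneg: "0 \<le> t1" "0 \<le> t1'" "0 \<le> t2" "0 \<le> t2'"
  by (rule order.trans[OF _ other_w_1] order.trans[OF _ same_w_1]
      order.trans[OF _ other_w_2] order.trans[OF _ same_w_2], intro expect_nonneg, simp)+

abbreviation cavg where
  "cavg cl b1 b2 F \<equiv> avg (fst cl) (fst (snd cl) b1) (snd (snd cl) b2) F"

text \<open>The output depends on cluster \<open>a\<close> alone, so a word of cluster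
  \<open>a'\<close> is independent of it: for each fixed output it passes with probability at most
  \<open>t1\<close>, and averaging over outputs has total mass at most 1.\<close>

lemma other_cluster_1:
  assumes "a \<in> I" "a' \<in> I" "a \<noteq> a'" "b' < B1" "k' < K1"
  shows "expect CB (\<lambda>c. cavg (c a) b1 b2 (\<lambda>_ _ o'.
    of_bool (D1 (fst (c a')) (fst (snd (c a')) b' k') (fst o')))) \<le> t1"
proof -
  have *: "expect CL (\<lambda>cl'. of_bool (D1 (fst cl') (fst (snd cl') b' k') y)) \<le> t1" for y
  proof -
    have "expect CL (\<lambda>cl'. of_bool (D1 (fst cl') (fst (snd cl') b' k') y))
      = expect pw (\<lambda>w. expect (pu w) (\<lambda>u. of_bool (D1 w u y)))"
      by (simp add: expect_CL expect_const fin_PV expect_PU_word[OF assms(4,5), where F="\<lambda>u. of_bool (D1 _ u y)"])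
    then show ?thesis using other_w_1 by simp
  qed
  have "expect CB (\<lambda>c. cavg (c a) b1 b2 (\<lambda>_ _ o'. of_bool (D1 (fst (c a')) (fst (snd (c a')) b' k') (fst o'))))
    = expect CL (\<lambda>cl. expect CL (\<lambda>cl'. cavg cl b1 b2 (\<lambda>_ _ o'. of_bool (D1 (fst cl') (fst (snd cl') b' k') (fst o')))))"
    unfolding CB_def using assms(1-3) by (intro expect_Pi_pair[where F="\<lambda>cl cl'. cavg cl b1 b2 (\<lambda>_ _ o'. of_bool (D1 (fst cl') (fst (snd cl') b' k') (fst o')))"] fin_I fin_CL)
  also have "\<dots> \<le> t1"
    unfolding expect_avg by (intro expect_le_const fin_CL avg_le_const t_nonneg *)
  finally show ?thesis .
qed

lemma other_cluster_2:
  assumes "a \<in> I" "a' \<in> I" "a \<noteq> a'" "b' < B2" "k' < K2"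
  shows "expect CB (\<lambda>c. cavg (c a) b1 b2 (\<lambda>_ _ o'.
    of_bool (D2 (fst (c a')) (snd (snd (c a')) b' k') (snd o')))) \<le> t2"
proof -
  have *: "expect CL (\<lambda>cl'. of_bool (D2 (fst cl') (snd (snd cl') b' k') z)) \<le> t2" for z
  proof -
    have "expect CL (\<lambda>cl'. of_bool (D2 (fst cl') (snd (snd cl') b' k') z))
      = expect pw (\<lambda>w. expect (pv w) (\<lambda>v. of_bool (D2 w v z)))"
      by (simp add: expect_CL expect_const fin_PU expect_PV_word[OF assms(4,5), where F="\<lambda>u. of_bool (D2 _ u z)"])
    then show ?thesis using other_w_2 by simp
  qed
  have "expect CB (\<lambda>c. cavg (c a) b1 b2 (\<lambda>_ _ o'. of_bool (D2 (fst (c a')) (snd (snd (c a')) b' k') (snd o'))))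
    = expect CL (\<lambda>cl. expect CL (\<lambda>cl'. cavg cl b1 b2 (\<lambda>_ _ o'. of_bool (D2 (fst cl') (snd (snd cl') b' k') (snd o')))))"
    unfolding CB_def using assms(1-3) by (intro expect_Pi_pair[where F="\<lambda>cl cl'. cavg cl b1 b2 (\<lambda>_ _ o'. of_bool (D2 (fst cl') (snd (snd cl') b' k') (snd o')))"] fin_I fin_CL)
  also have "\<dots> \<le> t2"
    unfolding expect_avg by (intro expect_le_const fin_CL avg_le_const t_nonneg *)
  finally show ?thesis .
qed

text \<open>Given \<open>w\<close>, the selection looks only at bin \<open>b1\<close> of the
  \<open>u\<close>-words, so words of bin \<open>b'\<close> are independent of the output. The words
  of bin \<open>b1\<close> are not, having been seen by the selection, but they lead to the correct
  message.\<close>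

lemma same_cluster_1:
  assumes "a \<in> I" "b1 < B1" "b' < B1" "b1 \<noteq> b'" "k' < K1"
  shows "expect CB (\<lambda>c. cavg (c a) b1 b2 (\<lambda>_ _ o'.
    of_bool (D1 (fst (c a)) (fst (snd (c a)) b' k') (fst o')))) \<le> t1'"
proof -
  have *: "expect (PU w) (\<lambda>U. avg w (U b1) V (\<lambda>_ _ o'. of_bool (D1 w (U b' k') (fst o')))) \<le> t1'" for w V
  proof -
    let ?P = "Pi_pmf {..<K1} undefined (\<lambda>_. pu w)"
    have fin: "finite (set_pmf ?P)" by (intro finite_set_Pi_pmf fin_pu) auto
    have word: "expect ?P (\<lambda>X. of_bool (D1 w (X k') t)) \<le> t1'" for t
      using assms same_w_1
      by (subst expect_Pi_component[where F="\<lambda>x. of_bool (D1 w x t)"]) (auto simp: fin_pu)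
    have "expect (PU w) (\<lambda>U. avg w (U b1) V (\<lambda>_ _ o'. of_bool (D1 w (U b' k') (fst o'))))
      = expect ?P (\<lambda>U. expect ?P (\<lambda>U'. avg w U V (\<lambda>_ _ o'. of_bool (D1 w (U' k') (fst o')))))"
      unfolding PU_def using assms fin
      by (intro expect_Pi_pair[where F="\<lambda>U U'. avg w U V (\<lambda>_ _ o'. of_bool (D1 w (U' k') (fst o')))"]) auto
    also have "\<dots> \<le> t1'"
      unfolding expect_avg by (intro expect_le_const fin avg_le_const t_nonneg word)
    finally show ?thesis .
  qed
  have "expect CB (\<lambda>c. cavg (c a) b1 b2 (\<lambda>_ _ o'. of_bool (D1 (fst (c a)) (fst (snd (c a)) b' k') (fst o'))))
    = expect CL (\<lambda>cl. cavg cl b1 b2 (\<lambda>_ _ o'. of_bool (D1 (fst cl) (fst (snd cl) b' k') (fst o'))))"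
    using assms by (intro expect_CB_cluster)
  \<comment> \<open>The \<open>u\<close>-bins are moved innermost, so that \<open>*\<close> applies
    for each fixed \<open>w\<close> and each fixed family of \<open>v\<close>-bins.\<close>
  also have "\<dots> = expect pw (\<lambda>w. expect (PV w) (\<lambda>V. expect (PU w) (\<lambda>U.
      avg w (U b1) (V b2) (\<lambda>_ _ o'. of_bool (D1 w (U b' k') (fst o'))))))"
    unfolding expect_CL by (subst expect_swap) simp
  also have "\<dots> \<le> t1'" by (intro expect_le_const fin_pw fin_PV *)
  finally show ?thesis .
qed

lemma same_cluster_2:
  assumes "a \<in> I" "b2 < B2" "b' < B2" "b2 \<noteq> b'" "k' < K2"
  shows "expect CB (\<lambda>c. cavg (c a) b1 b2 (\<lambda>_ _ o'.
    of_bool (D2 (fst (c a)) (snd (snd (c a)) b' k') (snd o')))) \<le> t2'"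
proof -
  have *: "expect (PV w) (\<lambda>V. avg w U (V b2) (\<lambda>_ _ o'. of_bool (D2 w (V b' k') (snd o')))) \<le> t2'" for w U
  proof -
    let ?P = "Pi_pmf {..<K2} undefined (\<lambda>_. pv w)"
    have fin: "finite (set_pmf ?P)" by (intro finite_set_Pi_pmf fin_pv) auto
    have word: "expect ?P (\<lambda>X. of_bool (D2 w (X k') t)) \<le> t2'" for t
      using assms same_w_2
      by (subst expect_Pi_component[where F="\<lambda>x. of_bool (D2 w x t)"]) (auto simp: fin_pv)
    have "expect (PV w) (\<lambda>V. avg w U (V b2) (\<lambda>_ _ o'. of_bool (D2 w (V b' k') (snd o'))))
      = expect ?P (\<lambda>V. expect ?P (\<lambda>V'. avg w U V (\<lambda>_ _ o'. of_bool (D2 w (V' k') (snd o')))))"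
      unfolding PV_def using assms fin
      by (intro expect_Pi_pair[where F="\<lambda>V V'. avg w U V (\<lambda>_ _ o'. of_bool (D2 w (V' k') (snd o')))"]) auto
    also have "\<dots> \<le> t2'"
      unfolding expect_avg by (intro expect_le_const fin avg_le_const t_nonneg word)
    finally show ?thesis .
  qed
  have "expect CB (\<lambda>c. cavg (c a) b1 b2 (\<lambda>_ _ o'. of_bool (D2 (fst (c a)) (snd (snd (c a)) b' k') (snd o'))))
    = expect CL (\<lambda>cl. cavg cl b1 b2 (\<lambda>_ _ o'. of_bool (D2 (fst cl) (snd (snd cl) b' k') (snd o'))))"
    using assms by (intro expect_CB_cluster)
  also have "\<dots> = expect pw (\<lambda>w. expect (PU w) (\<lambda>U. expect (PV w) (\<lambda>V.
      avg w (U b1) (V b2) (\<lambda>_ _ o'. of_bool (D2 w (V b' k') (snd o'))))))"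
    unfolding expect_CL by simp
  also have "\<dots> \<le> t2'" by (intro expect_le_const fin_pw fin_PU *)
  finally show ?thesis .
qed

text \<open>\<open>typical\<close> bounds the weighted success of one fresh pair;
  \<open>likelihood_encoder\<close> transfers this to the selected pair at the price of the factor
  \<open>K1 * K2 / (G + K1 * K2)\<close>, which is at least
  \<open>1 - G / (K1 * K2)\<close>.\<close>

lemma encoder_success:
  assumes "a \<in> I" "b1 < B1" "b2 < B2"
  shows "1 - \<epsilon> - G / real (K1 * K2) \<le> expect CB (\<lambda>c. cavg (c a) b1 b2 (\<lambda>u v o'.
    of_bool (D1 (fst (c a)) u (fst o') \<and> D2 (fst (c a)) v (snd o'))))"
proof -
  let ?H = "\<lambda>w u v o'. of_bool (D1 w u (fst o') \<and> D2 w v (snd o')) :: real"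
  let ?M = "real (K1 * K2)"
  let ?e = "expect pw (\<lambda>w. expect (pu w) (\<lambda>u. expect (pv w) (\<lambda>v.
        g w u v * (of_bool (g w u v \<le> G) * out w u v (?H w u v)))))"
  let ?QU = "\<lambda>w. Pi_pmf {..<K1} undefined (\<lambda>_. pu w)" and ?QV = "\<lambda>w. Pi_pmf {..<K2} undefined (\<lambda>_. pv w)"
  have finQ: "finite (set_pmf (?QU w))" "finite (set_pmf (?QV w))" for w
    by (intro finite_set_Pi_pmf fin_pu fin_pv finite_lessThan)+
  have out0: "0 \<le> out w u v (?H w u v)" for w u v
    unfolding out_def by (intro expect_nonneg) auto
  have e: "1 - \<epsilon> \<le> ?e" "0 \<le> ?e"
    using typical by (auto simp: out_def intro!: expect_nonneg mult_nonneg_nonneg g_nonneg)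
  have M: "0 < ?M" using K_pos by simp
  have "1 - \<epsilon> - G / ?M \<le> ?e * (?M / (G + ?M))"
  \<comment> \<open>Multiplying by \<open>1 - \<epsilon>\<close> needs a nonnegative factor; for
    \<open>\<epsilon> > 1\<close> the left side is negative and the right side is not.\<close>
  proof (cases "\<epsilon> \<le> 1")
    case True
    have "1 - G / ?M \<le> ?M / (G + ?M)"
    proof -
      have "(1 - G / ?M) * (G + ?M) \<le> ?M"
      proof -
        have "(1 - G / m) * (G + m) = m - G * G / m" if "0 < m" for m
          using that by (simp add: field_simps)
        from this[OF M] show ?thesis using M G_nonneg by simp
      qed
      then show ?thesis using M G_nonneg by (simp add: pos_le_divide_eq add_nonneg_pos)
    qed
    then have "(1 - \<epsilon>) * (1 - G / ?M) \<le> (1 - \<epsilon>) * (?M / (G + ?M))"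
      using True by (intro mult_left_mono) auto
    also have "\<dots> \<le> ?e * (?M / (G + ?M))"
      using e M G_nonneg by (intro mult_right_mono) auto
    finally have "(1 - \<epsilon>) * (1 - G / ?M) \<le> ?e * (?M / (G + ?M))" .
    moreover have "(1 - \<epsilon>) * (1 - G / ?M) = 1 - \<epsilon> - G / ?M + \<epsilon> * (G / ?M)"
      by (simp add: algebra_simps diff_divide_distrib)
    moreover have "0 \<le> \<epsilon> * (G / ?M)" using \<epsilon>_nonneg G_nonneg M by (intro mult_nonneg_nonneg) auto
    ultimately show ?thesis by linarith
  next
    case False
    have "0 \<le> G / ?M" "0 \<le> ?e * (?M / (G + ?M))"
      using e M G_nonneg by (auto intro!: mult_nonneg_nonneg divide_nonneg_nonneg)
    then show ?thesis using False by linarith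
  qed
  also have "\<dots> = expect pw (\<lambda>w. expect (pu w) (\<lambda>u. expect (pv w) (\<lambda>v.
        g w u v * (of_bool (g w u v \<le> G) * out w u v (?H w u v)))) * (?M / (G + ?M)))"
    by (simp only: expect_multc)
  \<comment> \<open>The indicator of \<open>g \<le> G\<close> is made part of \<open>\<Phi>\<close>:
    it supplies the cap that \<open>likelihood_encoder\<close> demands, and the next step drops
    it.\<close>
  also have "\<dots> \<le> expect pw (\<lambda>w. expect (?QU w) (\<lambda>U. expect (?QV w) (\<lambda>V.
      \<Sum>k\<in>KK. g w (U (fst k)) (V (snd k)) / (\<Sum>k'\<in>KK. g w (U (fst k')) (V (snd k')))
         * (of_bool (g w (U (fst k)) (V (snd k)) \<le> G) * out w (U (fst k)) (V (snd k)) (?H w (U (fst k)) (V (snd k)))))))"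
    unfolding KK_def
    by (intro expect_mono likelihood_encoder fin_pu fin_pv g_nonneg g_u g_v G_nonneg K_pos)
       (auto simp: out0 split: if_splits)
  also have "\<dots> \<le> expect pw (\<lambda>w. expect (?QU w) (\<lambda>U. expect (?QV w) (\<lambda>V. avg w U V (?H w))))"
    unfolding avg_def wt_def[symmetric]
    by (intro expect_mono sum_mono mult_left_mono wt_nonneg) (auto simp: out0)
  also have "\<dots> = expect pw (\<lambda>w. expect (PU w) (\<lambda>U. expect (PV w) (\<lambda>V. avg w (U b1) (V b2) (?H w))))"
  proof (rule expect_cong)
    fix w
    have 1: "expect (PV w) (\<lambda>V. avg w U (V b2) (?H w)) = expect (?QV w) (\<lambda>V. avg w U V (?H w))" for U
      unfolding PV_def using assms finQ
      by (intro expect_Pi_component[where F="\<lambda>V. avg w U V (?H w)"]) auto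
    have 2: "expect (PU w) (\<lambda>U. expect (?QV w) (\<lambda>V. avg w (U b1) V (?H w)))
      = expect (?QU w) (\<lambda>U. expect (?QV w) (\<lambda>V. avg w U V (?H w)))"
      unfolding PU_def using assms finQ
      by (intro expect_Pi_component[where F="\<lambda>U. expect (?QV w) (\<lambda>V. avg w U V (?H w))"]) auto
    show "expect (?QU w) (\<lambda>U. expect (?QV w) (\<lambda>V. avg w U V (?H w))) =
      expect (PU w) (\<lambda>U. expect (PV w) (\<lambda>V. avg w (U b1) (V b2) (?H w)))"
      unfolding 1 2 ..
  qed
  also have "\<dots> = expect CL (\<lambda>cl. cavg cl b1 b2 (?H (fst cl)))"
    by (simp add: expect_CL)
  also have "\<dots> = expect CB (\<lambda>c. cavg (c a) b1 b2 (?H (fst (c a))))"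
    using assms by (intro expect_CB_cluster[symmetric])
  finally show ?thesis .
qed

section \<open>Decoders and the union bound\<close>

definition hit1 where "hit1 c y i \<longleftrightarrow> fst i \<in> I \<and> snd i < B1 \<and> (\<exists>k<K1. D1 (fst (c (fst i))) (fst (snd (c (fst i))) (snd i) k) y)"
definition hit2 where "hit2 c z i \<longleftrightarrow> fst i \<in> I \<and> snd i < B2 \<and> (\<exists>k<K2. D2 (fst (c (fst i))) (snd (snd (c (fst i))) (snd i) k) z)"

text \<open>The decoders take any index that passes (\<open>SOME\<close>), so ties may be broken
  badly; correctness is certain only when the true index passes and no other does.\<close>

definition wrong where
  "wrong c a b1 b2 o' \<longleftrightarrow> \<not> ((SOME i. hit1 c (fst o') i) = (a, b1) \<and> (SOME i. hit2 c (snd o') i) = (a, b2))"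

text \<open>The number of passing words with a wrong index. It dominates the indicator that some
  wrong index passes, and as a sum it is ready for the union bound.\<close>

definition conf1 where
  "conf1 c a b1 y =
    (\<Sum>a'\<in>I - {a}. \<Sum>b'<B1. \<Sum>k'<K1. of_bool (D1 (fst (c a')) (fst (snd (c a')) b' k') y)) +
    (\<Sum>b'\<in>{..<B1} - {b1}. \<Sum>k'<K1. of_bool (D1 (fst (c a)) (fst (snd (c a)) b' k') y) :: real)"

definition conf2 where
  "conf2 c a b2 z =
    (\<Sum>a'\<in>I - {a}. \<Sum>b'<B2. \<Sum>k'<K2. of_bool (D2 (fst (c a')) (snd (snd (c a')) b' k') z)) +
    (\<Sum>b'\<in>{..<B2} - {b2}. \<Sum>k'<K2. of_bool (D2 (fst (c a)) (snd (snd (c a)) b' k') z) :: real)"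

lemma conf1_nonneg: "0 \<le> conf1 c a b1 y" and conf2_nonneg: "0 \<le> conf2 c a b2 z"
  unfolding conf1_def conf2_def by (intro add_nonneg_nonneg sum_nonneg; simp)+

lemma conf1_ge_1:
  assumes "hit1 c y i" "i \<noteq> (a, b1)"
  shows "1 \<le> conf1 c a b1 y"
proof -
  obtain a' b' k' where i: "i = (a', b')" "a' \<in> I" "b' < B1" "k' < K1" "D1 (fst (c a')) (fst (snd (c a')) b' k') y"
    using assms unfolding hit1_def by (cases i) auto
  have one: "1 \<le> (\<Sum>k'<K1. of_bool (D1 (fst (c a')) (fst (snd (c a')) b' k') y) :: real)"
    using i member_le_sum[of k' "{..<K1}" "\<lambda>k'. of_bool (D1 (fst (c a')) (fst (snd (c a')) b' k') y) :: real"] by auto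
  show ?thesis
  proof (cases "a' = a")
    case True
    with assms i have "b' \<in> {..<B1} - {b1}" by auto
    from member_le_sum[OF this, of "\<lambda>b'. \<Sum>k'<K1. of_bool (D1 (fst (c a')) (fst (snd (c a')) b' k') y) :: real"] one True
    have "1 \<le> (\<Sum>b'\<in>{..<B1} - {b1}. \<Sum>k'<K1. of_bool (D1 (fst (c a)) (fst (snd (c a)) b' k') y) :: real)"
      by (auto intro!: sum_nonneg)
    moreover have "0 \<le> (\<Sum>a'\<in>I - {a}. \<Sum>b'<B1. \<Sum>k'<K1. of_bool (D1 (fst (c a')) (fst (snd (c a')) b' k') y) :: real)"
      by (intro sum_nonneg) auto
    ultimately show ?thesis unfolding conf1_def by linarith
  next
    case False
    have "1 \<le> (\<Sum>b'<B1. \<Sum>k'<K1. of_bool (D1 (fst (c a')) (fst (snd (c a')) b' k') y) :: real)"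
      using i one member_le_sum[of b' "{..<B1}" "\<lambda>b'. \<Sum>k'<K1. of_bool (D1 (fst (c a')) (fst (snd (c a')) b' k') y) :: real"]
      by (auto intro!: sum_nonneg)
    also have "\<dots> \<le> (\<Sum>a'\<in>I - {a}. \<Sum>b'<B1. \<Sum>k'<K1. of_bool (D1 (fst (c a')) (fst (snd (c a')) b' k') y) :: real)"
      using i False fin_I
      by (intro member_le_sum[of a' "I - {a}" "\<lambda>a'. \<Sum>b'<B1. \<Sum>k'<K1. of_bool (D1 (fst (c a')) (fst (snd (c a')) b' k') y) :: real"])
         (auto intro!: sum_nonneg)
    finally have "1 \<le> (\<Sum>a'\<in>I - {a}. \<Sum>b'<B1. \<Sum>k'<K1. of_bool (D1 (fst (c a')) (fst (snd (c a')) b' k') y) :: real)" .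
    moreover have "0 \<le> (\<Sum>b'\<in>{..<B1} - {b1}. \<Sum>k'<K1. of_bool (D1 (fst (c a)) (fst (snd (c a)) b' k') y) :: real)"
      by (intro sum_nonneg) auto
    ultimately show ?thesis unfolding conf1_def by linarith
  qed
qed

lemma conf2_ge_1:
  assumes "hit2 c z i" "i \<noteq> (a, b2)"
  shows "1 \<le> conf2 c a b2 z"
proof -
  obtain a' b' k' where i: "i = (a', b')" "a' \<in> I" "b' < B2" "k' < K2" "D2 (fst (c a')) (snd (snd (c a')) b' k') z"
    using assms unfolding hit2_def by (cases i) auto
  have one: "1 \<le> (\<Sum>k'<K2. of_bool (D2 (fst (c a')) (snd (snd (c a')) b' k') z) :: real)"
    using i member_le_sum[of k' "{..<K2}" "\<lambda>k'. of_bool (D2 (fst (c a')) (snd (snd (c a')) b' k') z) :: real"] by auto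
  show ?thesis
  proof (cases "a' = a")
    case True
    with assms i have "b' \<in> {..<B2} - {b2}" by auto
    from member_le_sum[OF this, of "\<lambda>b'. \<Sum>k'<K2. of_bool (D2 (fst (c a')) (snd (snd (c a')) b' k') z) :: real"] one True
    have "1 \<le> (\<Sum>b'\<in>{..<B2} - {b2}. \<Sum>k'<K2. of_bool (D2 (fst (c a)) (snd (snd (c a)) b' k') z) :: real)"
      by (auto intro!: sum_nonneg)
    moreover have "0 \<le> (\<Sum>a'\<in>I - {a}. \<Sum>b'<B2. \<Sum>k'<K2. of_bool (D2 (fst (c a')) (snd (snd (c a')) b' k') z) :: real)"
      by (intro sum_nonneg) auto
    ultimately show ?thesis unfolding conf2_def by linarith
  next
    case False
    have "1 \<le> (\<Sum>b'<B2. \<Sum>k'<K2. of_bool (D2 (fst (c a')) (snd (snd (c a')) b' k') z) :: real)"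
      using i one member_le_sum[of b' "{..<B2}" "\<lambda>b'. \<Sum>k'<K2. of_bool (D2 (fst (c a')) (snd (snd (c a')) b' k') z) :: real"]
      by (auto intro!: sum_nonneg)
    also have "\<dots> \<le> (\<Sum>a'\<in>I - {a}. \<Sum>b'<B2. \<Sum>k'<K2. of_bool (D2 (fst (c a')) (snd (snd (c a')) b' k') z) :: real)"
      using i False fin_I
      by (intro member_le_sum[of a' "I - {a}" "\<lambda>a'. \<Sum>b'<B2. \<Sum>k'<K2. of_bool (D2 (fst (c a')) (snd (snd (c a')) b' k') z) :: real"])
         (auto intro!: sum_nonneg)
    finally have "1 \<le> (\<Sum>a'\<in>I - {a}. \<Sum>b'<B2. \<Sum>k'<K2. of_bool (D2 (fst (c a')) (snd (snd (c a')) b' k') z) :: real)" .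
    moreover have "0 \<le> (\<Sum>b'\<in>{..<B2} - {b2}. \<Sum>k'<K2. of_bool (D2 (fst (c a)) (snd (snd (c a)) b' k') z) :: real)"
      by (intro sum_nonneg) auto
    ultimately show ?thesis unfolding conf2_def by linarith
  qed
qed

text \<open>Only \<open>B1 - 1\<close> and \<open>B2 - 1\<close> wrong bins compete in the right
  cluster. With a single bin the term vanishes, which allows a private message to sit in the cloud
  centre without any constraint from \<open>t1'\<close> or \<open>t2'\<close>.\<close>

definition \<delta> where
  "\<delta> = \<epsilon> + G / real (K1 * K2)
    + (real (card I) * B1 * K1 * t1 + real (B1 - 1) * K1 * t1')
    + (real (card I) * B2 * K2 * t2 + real (B2 - 1) * K2 * t2')"

lemma avg_card_bound:
  fixes B K :: nat and X :: "'i \<Rightarrow> nat \<Rightarrow> nat \<Rightarrow> real"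
  assumes a: "a \<in> I" "b < B" and t: "0 \<le> t" "0 \<le> t'"
    and X: "\<And>a' b' k'. a' \<in> I - {a} \<Longrightarrow> b' < B \<Longrightarrow> k' < K \<Longrightarrow> X a' b' k' \<le> t"
    and Y: "\<And>b' k'. b' < B \<Longrightarrow> b' \<noteq> b \<Longrightarrow> k' < K \<Longrightarrow> Y b' k' \<le> t'"
  shows "(\<Sum>a'\<in>I - {a}. \<Sum>b'<B. \<Sum>k'<K. X a' b' k') + (\<Sum>b'\<in>{..<B} - {b}. \<Sum>k'<K. Y b' k')
    \<le> real (card I) * B * K * t + real (B - 1) * K * t'"
proof -
  have "(\<Sum>a'\<in>I - {a}. \<Sum>b'<B. \<Sum>k'<K. X a' b' k') \<le> (\<Sum>a'\<in>I - {a}. \<Sum>b'<B. \<Sum>k'<K. t)"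
    using X by (intro sum_mono) auto
  also have "\<dots> \<le> (\<Sum>a'\<in>I. \<Sum>b'<B. \<Sum>k'<K. t)"
    using t fin_I by (intro sum_mono2) (auto intro!: sum_nonneg)
  finally have 1: "(\<Sum>a'\<in>I - {a}. \<Sum>b'<B. \<Sum>k'<K. X a' b' k') \<le> real (card I) * B * K * t" by simp
  have "(\<Sum>b'\<in>{..<B} - {b}. \<Sum>k'<K. Y b' k') \<le> (\<Sum>b'\<in>{..<B} - {b}. \<Sum>k'<K. t')"
    using Y by (intro sum_mono) auto
  also have "\<dots> = real (B - 1) * K * t'" using a by simp
  finally show ?thesis using 1 by simp
qed

lemma expect_wrong:
  assumes a: "a \<in> I" "b1 < B1" "b2 < B2"
  shows "expect CB (\<lambda>c. 1 - cavg (c a) b1 b2 (\<lambda>_ _ o'. 1 - of_bool (wrong c a b1 b2 o'))) \<le> \<delta>"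
proof -
  let ?H = "\<lambda>c u v o'. of_bool (D1 (fst (c a)) u (fst o') \<and> D2 (fst (c a)) v (snd o')) :: real"
  let ?F = "\<lambda>c u v o'. ?H c u v o' - (conf1 c a b1 (fst o') + conf2 c a b2 (snd o'))"
  \<comment> \<open>If the true words pass and decoding is still wrong, some other index passes, so
    a confusion count is at least 1 and the left side is at most 0.\<close>
  have key: "of_bool (D1 (fst (c a)) (fst (snd (c a)) b1 k1) (fst o') \<and> D2 (fst (c a)) (snd (snd (c a)) b2 k2) (snd o'))
       - (conf1 c a b1 (fst o') + conf2 c a b2 (snd o')) \<le> 1 - of_bool (wrong c a b1 b2 o')"
    if "k1 < K1" "k2 < K2" for c o' k1 k2
  proof (cases "wrong c a b1 b2 o' \<and> D1 (fst (c a)) (fst (snd (c a)) b1 k1) (fst o') \<and> D2 (fst (c a)) (snd (snd (c a)) b2 k2) (snd o')")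
    case True
    then have h: "hit1 c (fst o') (a, b1)" "hit2 c (snd o') (a, b2)"
      using a that by (auto simp: hit1_def hit2_def)
    have "hit1 c (fst o') (SOME i. hit1 c (fst o') i)" "hit2 c (snd o') (SOME i. hit2 c (snd o') i)"
      using h by (auto intro: someI)
    then have "1 \<le> conf1 c a b1 (fst o') \<or> 1 \<le> conf2 c a b2 (snd o')"
      using True conf1_ge_1 conf2_ge_1 unfolding wrong_def by metis
    then show ?thesis using conf1_nonneg[of c a b1 "fst o'"] conf2_nonneg[of c a b2 "snd o'"] True by auto
  next
    case False
    then show ?thesis using conf1_nonneg[of c a b1 "fst o'"] conf2_nonneg[of c a b2 "snd o'"] by auto
  qed
  have "cavg (c a) b1 b2 (?F c) \<le> cavg (c a) b1 b2 (\<lambda>_ _ o'. 1 - of_bool (wrong c a b1 b2 o'))" for c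
    unfolding avg_def by (intro sum_mono mult_left_mono wt_nonneg out_mono key) (auto simp: KK_def)
  then have "expect CB (\<lambda>c. 1 - cavg (c a) b1 b2 (\<lambda>_ _ o'. 1 - of_bool (wrong c a b1 b2 o')))
    \<le> expect CB (\<lambda>c. 1 - cavg (c a) b1 b2 (?F c))"
    by (intro expect_mono diff_left_mono)
  also have "\<dots> = 1 - expect CB (\<lambda>c. cavg (c a) b1 b2 (?H c))
    + expect CB (\<lambda>c. cavg (c a) b1 b2 (\<lambda>_ _ o'. conf1 c a b1 (fst o')))
    + expect CB (\<lambda>c. cavg (c a) b1 b2 (\<lambda>_ _ o'. conf2 c a b2 (snd o')))"
    by (simp add: expect_diff expect_add avg_diff avg_add expect_const fin_CB)
  also have "\<dots> \<le> \<delta>"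
  proof -
    have "expect CB (\<lambda>c. cavg (c a) b1 b2 (\<lambda>_ _ o'. conf1 c a b1 (fst o')))
      \<le> real (card I) * B1 * K1 * t1 + real (B1 - 1) * K1 * t1'"
      unfolding conf1_def avg_add avg_sum expect_add expect_sum using a
      by (intro avg_card_bound t_nonneg other_cluster_1 same_cluster_1) auto
    moreover have "expect CB (\<lambda>c. cavg (c a) b1 b2 (\<lambda>_ _ o'. conf2 c a b2 (snd o')))
      \<le> real (card I) * B2 * K2 * t2 + real (B2 - 1) * K2 * t2'"
      unfolding conf2_def avg_add avg_sum expect_add expect_sum using a
      by (intro avg_card_bound t_nonneg other_cluster_2 same_cluster_2) auto
    ultimately show ?thesis using encoder_success[OF a] unfolding \<delta>_def by linarith
  qed
  finally show ?thesis .
qed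

text \<open>One codebook must serve all messages, so the sum over messages is averaged over
  codebooks before a codebook is fixed; inputs are then fixed message by message.\<close>

theorem exists_code:
  "\<exists>enc dec1 dec2. (\<Sum>a\<in>I. \<Sum>b1<B1. \<Sum>b2<B2. expect (Q (enc a b1 b2)) (\<lambda>o'.
      of_bool (\<not> (dec1 (fst o') = (a, b1) \<and> dec2 (snd o') = (a, b2)))))
    \<le> real (card I) * B1 * B2 * \<delta>"
proof -
  let ?J = "\<lambda>c a b1 b2. 1 - cavg (c a) b1 b2 (\<lambda>_ _ o'. 1 - of_bool (wrong c a b1 b2 o'))"
  have "expect CB (\<lambda>c. \<Sum>a\<in>I. \<Sum>b1<B1. \<Sum>b2<B2. ?J c a b1 b2)
    = (\<Sum>a\<in>I. \<Sum>b1<B1. \<Sum>b2<B2. expect CB (\<lambda>c. ?J c a b1 b2))"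
    by (simp only: expect_sum)
  also have "\<dots> \<le> (\<Sum>a\<in>I. \<Sum>b1<B1. \<Sum>b2<B2. \<delta>)"
    by (intro sum_mono expect_wrong) auto
  also have "\<dots> = real (card I) * B1 * B2 * \<delta>" by simp
  finally obtain c where c: "(\<Sum>a\<in>I. \<Sum>b1<B1. \<Sum>b2<B2. ?J c a b1 b2) \<le> real (card I) * B1 * B2 * \<delta>"
    using expect_exists_le[OF fin_CB] by blast
  have "\<forall>a b1 b2. \<exists>x. expect (Q x) (\<lambda>o'. of_bool (wrong c a b1 b2 o')) \<le> ?J c a b1 b2"
    using exists_input[of "\<lambda>o'. of_bool (wrong c _ _ _ o')"] by simp
  then obtain enc where enc: "\<And>a b1 b2. expect (Q (enc a b1 b2)) (\<lambda>o'. of_bool (wrong c a b1 b2 o')) \<le> ?J c a b1 b2"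
    by metis
  have "(\<Sum>a\<in>I. \<Sum>b1<B1. \<Sum>b2<B2. expect (Q (enc a b1 b2)) (\<lambda>o'. of_bool (wrong c a b1 b2 o')))
    \<le> real (card I) * B1 * B2 * \<delta>"
    by (rule order.trans[OF _ c]) (intro sum_mono enc)
  then show ?thesis unfolding wrong_def
    by (intro exI[of _ enc] exI[of _ "\<lambda>y. SOME i. hit1 c y i"] exI[of _ "\<lambda>z. SOME i. hit2 c z i"])
qed

end

subsection \<open>A weak law for windowed sums\<close>

text \<open>Windows of length three that do not overlap are independent, so only the five diagonals
  closest to the main one contribute to the variance.\<close>

lemma weak_law_windows:
  fixes p :: "'a pmf" and h :: "'a \<Rightarrow> 'a \<Rightarrow> 'a \<Rightarrow> real" and N :: nat
  assumes fin: "finite (set_pmf p)" and bound: "\<And>a b c. \<bar>h a b c\<bar> \<le> C"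
    and N: "0 < N" and \<delta>: "0 < \<delta>"
  defines "\<mu> \<equiv> expect p (\<lambda>a. expect p (\<lambda>b. expect p (\<lambda>c. h a b c)))"
  shows "expect (Pi_pmf {..<Suc (Suc N)} d (\<lambda>_. p)) (\<lambda>f. of_bool (\<delta> * real N \<le>
      \<bar>(\<Sum>i<N. h (f i) (f (Suc i)) (f (Suc (Suc i)))) - real N * \<mu>\<bar>)) \<le> 20 * C\<^sup>2 / (\<delta>\<^sup>2 * real N)"
proof -
  let ?P = "Pi_pmf {..<Suc (Suc N)} d (\<lambda>_. p)"
  define X where "X i f = h (f i) (f (Suc i)) (f (Suc (Suc i))) - \<mu>" for i :: nat and f
  have finP: "finite (set_pmf (Pi_pmf J d (\<lambda>_. p)))" if "finite J" for J
    using that fin by (intro finite_set_Pi_pmf)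
  have "\<bar>\<mu>\<bar> \<le> C"
  proof -
    have "- C \<le> h a b c" "h a b c \<le> C" for a b c using bound[of a b c] by auto
    then have "\<mu> \<le> C" "- C \<le> \<mu>" unfolding \<mu>_def
      by (intro expect_le_const expect_ge_const fin; simp)+
    then show ?thesis by auto
  qed
  then have XC: "\<bar>X i f\<bar> \<le> 2 * C" for i f
    using bound[of "f i" "f (Suc i)" "f (Suc (Suc i))"] unfolding X_def by linarith
  have EX: "expect (Pi_pmf J d (\<lambda>_. p)) (X i) = 0" if "finite J" "{i, Suc i, Suc (Suc i)} \<subseteq> J" for i J
  proof -
    have "expect (Pi_pmf J d (\<lambda>_. p)) (\<lambda>f. h (f i) (f (Suc i)) (f (Suc (Suc i)))) = \<mu>"
      unfolding \<mu>_def using that fin by (intro expect_Pi_triple) auto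
    then show ?thesis unfolding X_def expect_diff expect_const[OF finP[OF that(1)]] by simp
  qed
  \<comment> \<open>After splitting the coordinates at \<open>i + 3\<close>, \<open>X i\<close> is
    constant for the inner mean and the centred \<open>X j\<close> integrates to 0.\<close>
  have far: "expect ?P (\<lambda>f. X i f * X j f) = 0" if "i + 3 \<le> j" "j < N" for i j
  proof -
    let ?J = "{..<i + 3}"
    have "expect ?P (\<lambda>f. X i f * X j f) = expect (Pi_pmf ?J d (\<lambda>_. p)) (\<lambda>f.
      expect (Pi_pmf ({..<Suc (Suc N)} - ?J) d (\<lambda>_. p)) (\<lambda>g. X i f * X j g))"
      using that fin by (subst expect_Pi_split[where J="?J"]) (auto simp: X_def)
    also have "\<dots> = 0"
      using that by (simp add: expect_cmult EX expect_const finP)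
    finally show ?thesis .
  qed
  have near: "expect ?P (\<lambda>f. X i f * X j f) \<le> 4 * C\<^sup>2" for i j
  proof (rule expect_le_const[OF finP])
    fix f
    have "X i f * X j f \<le> \<bar>X i f\<bar> * \<bar>X j f\<bar>" by (simp add: abs_mult[symmetric])
    also have "\<dots> \<le> (2 * C) * (2 * C)" using XC[of i f] XC[of j f] by (intro mult_mono) auto
    finally show "X i f * X j f \<le> 4 * C\<^sup>2" by (simp add: power2_eq_square)
  qed auto
  have "expect ?P (\<lambda>f. (\<Sum>i<N. X i f)\<^sup>2) = (\<Sum>i<N. \<Sum>j<N. expect ?P (\<lambda>f. X i f * X j f))"
    by (simp add: power2_eq_square sum_product expect_sum)
  \<comment> \<open>At most five indices \<open>j\<close> for each \<open>i\<close>, each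
    contributing at most \<open>4 * C\<^sup>2\<close>: the origin of the constant 20. Truncated
    subtraction takes care of the left border.\<close>
  also have "\<dots> \<le> (\<Sum>i<N. \<Sum>j<N. if j \<in> {i-2..i+2} then 4 * C\<^sup>2 else 0)"
  proof (intro sum_mono)
    fix i j assume ij: "i \<in> {..<N}" "j \<in> {..<N}"
    consider "j \<in> {i-2..i+2}" | "i + 3 \<le> j" | "j + 3 \<le> i" by force
    then show "expect ?P (\<lambda>f. X i f * X j f) \<le> (if j \<in> {i-2..i+2} then 4 * C\<^sup>2 else 0)"
    proof cases
      case 3
      then have "expect ?P (\<lambda>f. X j f * X i f) = 0" using ij by (intro far) auto
      then show ?thesis by (simp add: mult.commute)
    qed (use ij near far in auto)
  qed
  also have "\<dots> = (\<Sum>i<N. real (card ({..<N} \<inter> {i-2..i+2})) * (4 * C\<^sup>2))"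
    by (simp only: sum.inter_restrict[symmetric, OF finite_lessThan] sum_constant)
  also have "\<dots> \<le> (\<Sum>i<N. 5 * (4 * C\<^sup>2))"
  proof (intro sum_mono mult_right_mono)
    fix i
    have "card ({..<N} \<inter> {i-2..i+2}) \<le> card {i-2..i+2}" by (intro card_mono) auto
    then show "real (card ({..<N} \<inter> {i-2..i+2})) \<le> 5" by auto
  qed auto
  finally have var: "expect ?P (\<lambda>f. (\<Sum>i<N. X i f)\<^sup>2) \<le> 20 * C\<^sup>2 * real N" by (simp add: mult_ac)
  have "expect ?P (\<lambda>f. of_bool (\<delta> * real N \<le> \<bar>(\<Sum>i<N. h (f i) (f (Suc i)) (f (Suc (Suc i)))) - real N * \<mu>\<bar>))
    = expect ?P (\<lambda>f. of_bool ((\<delta> * real N)\<^sup>2 \<le> (\<Sum>i<N. X i f)\<^sup>2))"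
  proof (rule expect_cong)
    fix f
    have "(\<Sum>i<N. X i f) = (\<Sum>i<N. h (f i) (f (Suc i)) (f (Suc (Suc i)))) - real N * \<mu>"
      by (simp add: X_def sum_subtractf)
    moreover have "(\<delta> * real N)\<^sup>2 \<le> (\<Sum>i<N. X i f)\<^sup>2 \<longleftrightarrow> \<delta> * real N \<le> \<bar>\<Sum>i<N. X i f\<bar>"
      using \<delta> abs_le_square_iff[of "\<delta> * real N" "\<Sum>i<N. X i f"] by (simp add: abs_mult)
    ultimately show "of_bool (\<delta> * real N \<le> \<bar>(\<Sum>i<N. h (f i) (f (Suc i)) (f (Suc (Suc i)))) - real N * \<mu>\<bar>)
      = (of_bool ((\<delta> * real N)\<^sup>2 \<le> (\<Sum>i<N. X i f)\<^sup>2) :: real)" by simp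
  qed
  also have "\<dots> \<le> expect ?P (\<lambda>f. (\<Sum>i<N. X i f)\<^sup>2) / (\<delta> * real N)\<^sup>2"
    using \<delta> N by (intro expect_markov) auto
  also have "\<dots> \<le> 20 * C\<^sup>2 * real N / (\<delta> * real N)\<^sup>2"
    using var by (intro divide_right_mono) auto
  also have "\<dots> = 20 * C\<^sup>2 / (\<delta>\<^sup>2 * real N)"
    using N by (simp add: power2_eq_square)
  finally show ?thesis .
qed

subsection \<open>Information densities\<close>

text \<open>The ratio p(a, b | c) / (p(a | c) p(b | c)), equal to 0 where the denominator vanishes.
  The trivial variable \<open>\<lambda>_. ()\<close> as \<open>C\<close> gives the unconditional
  density.\<close>

definition info_density ::
  "'o pmf \<Rightarrow> ('o \<Rightarrow> 'a) \<Rightarrow> ('o \<Rightarrow> 'b) \<Rightarrow> ('o \<Rightarrow> 'c) \<Rightarrow> 'a \<Rightarrow> 'b \<Rightarrow> 'c \<Rightarrow> real" where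
  "info_density M A B C a b c =
    pmf (map_pmf (\<lambda>\<omega>. (A \<omega>, B \<omega>, C \<omega>)) M) (a, b, c) * pmf (map_pmf C M) c /
    (pmf (map_pmf (\<lambda>\<omega>. (A \<omega>, C \<omega>)) M) (a, c) * pmf (map_pmf (\<lambda>\<omega>. (B \<omega>, C \<omega>)) M) (b, c))"

lemma info_density_nonneg: "0 \<le> info_density M A B C a b c"
  unfolding info_density_def by (intro divide_nonneg_nonneg mult_nonneg_nonneg) auto

lemma pmf_map_pos: "\<omega> \<in> set_pmf M \<Longrightarrow> 0 < pmf (map_pmf X M) (X \<omega>)"
  by (rule pmf_positive) auto

lemma info_density_pos:
  assumes "\<omega> \<in> set_pmf M"
  shows "0 < info_density M A B C (A \<omega>) (B \<omega>) (C \<omega>)"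
  unfolding info_density_def
  using pmf_map_pos[OF assms, of "\<lambda>\<omega>. (A \<omega>, B \<omega>, C \<omega>)"] pmf_map_pos[OF assms, of C]
    pmf_map_pos[OF assms, of "\<lambda>\<omega>. (A \<omega>, C \<omega>)"] pmf_map_pos[OF assms, of "\<lambda>\<omega>. (B \<omega>, C \<omega>)"]
  by (intro divide_pos_pos mult_pos_pos) auto

lemma info_density_commute: "info_density M A B C a b c = info_density M B A C b a c"
proof -
  have "map_pmf (\<lambda>\<omega>. (B \<omega>, A \<omega>, C \<omega>)) M
    = map_pmf (\<lambda>(a, b, c). (b, a, c)) (map_pmf (\<lambda>\<omega>. (A \<omega>, B \<omega>, C \<omega>)) M)"
    by (simp add: map_pmf_comp)
  then have "pmf (map_pmf (\<lambda>\<omega>. (B \<omega>, A \<omega>, C \<omega>)) M) (b, a, c)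
    = pmf (map_pmf (\<lambda>\<omega>. (A \<omega>, B \<omega>, C \<omega>)) M) (a, b, c)"
    using pmf_map_inj'[of "\<lambda>(a, b, c). (b, a, c)" "map_pmf (\<lambda>\<omega>. (A \<omega>, B \<omega>, C \<omega>)) M" "(a, b, c)"]
    by (simp add: inj_def)
  then show ?thesis unfolding info_density_def by (simp add: mult.commute)
qed

lemma dist_eq_pmf: "Defs.dist (pmf M) X a = pmf (map_pmf X M) a" for M :: "'o::finite pmf"
  by (simp add: Defs.dist_def pmf_map measure_measure_pmf_finite vimage_def)

lemma sum_pmf_map_le:
  assumes "finite S"
  shows "(\<Sum>a\<in>S. pmf (map_pmf (\<lambda>\<omega>. (A \<omega>, B \<omega>)) M) (a, b)) \<le> pmf (map_pmf B M) b"
proof -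
  have "(\<Sum>a\<in>S. pmf (map_pmf (\<lambda>\<omega>. (A \<omega>, B \<omega>)) M) (a, b))
    = measure (map_pmf (\<lambda>\<omega>. (A \<omega>, B \<omega>)) M) ((\<lambda>a. (a, b)) ` S)"
    using assms by (subst measure_measure_pmf_finite) (auto simp: sum.reindex inj_on_def)
  also have "\<dots> \<le> measure (map_pmf (\<lambda>\<omega>. (A \<omega>, B \<omega>)) M) (snd -` {b})"
    by (intro measure_pmf.finite_measure_mono) auto
  also have "\<dots> = pmf (map_pmf snd (map_pmf (\<lambda>\<omega>. (A \<omega>, B \<omega>)) M)) b"
    by (simp only: pmf_map)
  also have "\<dots> = pmf (map_pmf B M) b" by (simp add: map_pmf_comp)
  finally show ?thesis .
qed

lemma cond_mutual_info_eq_expect: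
  fixes M :: "'o::finite pmf"
  shows "cond_mutual_info (pmf M) A B C =
    expect M (\<lambda>\<omega>. log 2 (info_density M A B C (A \<omega>) (B \<omega>) (C \<omega>)))"
proof -
  let ?T = "\<lambda>\<omega>. (A \<omega>, B \<omega>, C \<omega>)"
  let ?F = "\<lambda>(a, b, c). log 2 (info_density M A B C a b c)"
  have "expect M (\<lambda>\<omega>. log 2 (info_density M A B C (A \<omega>) (B \<omega>) (C \<omega>))) = expect (map_pmf ?T M) ?F"
    by (subst expect_map) auto
  also have "\<dots> = (\<Sum>t\<in>range ?T. pmf (map_pmf ?T M) t * ?F t)"
    by (intro expect_superset) auto
  also have "\<dots> = cond_mutual_info (pmf M) A B C"
    unfolding cond_mutual_info_def dist_eq_pmf info_density_def Let_def
    by (intro sum.cong) auto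
  finally show ?thesis ..
qed

text \<open>Weighting by p(a | c) cancels one denominator and leaves a sum of p(a | b, c) over
  \<open>a\<close>. The bound holds for each individual \<open>b\<close> and \<open>c\<close>, even
  of probability 0, so densities may be evaluated at the letters of a wrong candidate.\<close>

lemma expect_info_density_le_1:
  assumes fin: "finite (set_pmf k)"
    and k: "\<And>a. pmf k a * pmf (map_pmf C M) c = pmf (map_pmf (\<lambda>\<omega>. (A \<omega>, C \<omega>)) M) (a, c)"
  shows "expect k (\<lambda>a. info_density M A B C a b c) \<le> 1"
proof -
  let ?pbc = "pmf (map_pmf (\<lambda>\<omega>. (B \<omega>, C \<omega>)) M) (b, c)"
  let ?pabc = "\<lambda>a. pmf (map_pmf (\<lambda>\<omega>. (A \<omega>, B \<omega>, C \<omega>)) M) (a, b, c)"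
  have "pmf k a * info_density M A B C a b c \<le> ?pabc a / ?pbc" for a
  proof -
    have "pmf k a * info_density M A B C a b c
      = pmf (map_pmf (\<lambda>\<omega>. (A \<omega>, C \<omega>)) M) (a, c) * ?pabc a / (pmf (map_pmf (\<lambda>\<omega>. (A \<omega>, C \<omega>)) M) (a, c) * ?pbc)"
      unfolding info_density_def k[symmetric] by (simp add: mult_ac)
    then show ?thesis by (cases "pmf (map_pmf (\<lambda>\<omega>. (A \<omega>, C \<omega>)) M) (a, c) = 0") auto
  qed
  then have "expect k (\<lambda>a. info_density M A B C a b c) \<le> (\<Sum>a\<in>set_pmf k. ?pabc a / ?pbc)"
    unfolding expect_def by (intro sum_mono)
  also have "\<dots> = (\<Sum>a\<in>set_pmf k. ?pabc a) / ?pbc" by (simp add: sum_divide_distrib)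
  also have "\<dots> \<le> 1"
    using sum_pmf_map_le[OF fin, of A "\<lambda>\<omega>. (B \<omega>, C \<omega>)" M "(b, c)"]
    by (cases "?pbc = 0") (auto simp: pos_divide_le_eq pmf_pos)
  finally show ?thesis .
qed

text \<open>The product form covers values \<open>c\<close> of probability 0, where \<open>k\<close>
  may be any distribution.\<close>

lemma ex_conditional_pmf:
  fixes M :: "'o::finite pmf"
  shows "\<exists>k. \<forall>a. pmf k a * pmf (map_pmf C M) c = pmf (map_pmf (\<lambda>\<omega>. (A \<omega>, C \<omega>)) M) (a, c)"
proof (cases "pmf (map_pmf C M) c = 0")
  case True
  have "pmf (map_pmf (\<lambda>\<omega>. (A \<omega>, C \<omega>)) M) (a, c) = 0" for a
    using sum_pmf_map_le[of "{a}" A C M c] True pmf_nonneg[of _ "(a, c)"] by (simp add: order_antisym)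
  then show ?thesis using True by simp
next
  case False
  let ?S = "C -` {c}"
  have pc: "pmf (map_pmf C M) c = measure M ?S" by (rule pmf_map)
  then have ne: "set_pmf M \<inter> ?S \<noteq> {}" using False by (simp add: measure_pmf_zero_iff)
  have "pmf (map_pmf A (cond_pmf M ?S)) a * pmf (map_pmf C M) c = pmf (map_pmf (\<lambda>\<omega>. (A \<omega>, C \<omega>)) M) (a, c)" for a
  proof -
    have "pmf (map_pmf A (cond_pmf M ?S)) a * pmf (map_pmf C M) c
      = (\<Sum>\<omega>\<in>A -` {a}. pmf (cond_pmf M ?S) \<omega>) * measure M ?S"
      by (simp add: pc pmf_map measure_measure_pmf_finite)
    also have "\<dots> = (\<Sum>\<omega>\<in>A -` {a}. if \<omega> \<in> ?S then pmf M \<omega> else 0)"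
      unfolding sum_distrib_right using False pc by (intro sum.cong) (auto simp: pmf_cond[OF ne])
    also have "\<dots> = (\<Sum>\<omega>\<in>A -` {a} \<inter> ?S. pmf M \<omega>)" by (simp add: sum.inter_restrict)
    also have "\<dots> = pmf (map_pmf (\<lambda>\<omega>. (A \<omega>, C \<omega>)) M) (a, c)"
      by (simp add: pmf_map measure_measure_pmf_finite) (intro sum.cong, auto)
    finally show ?thesis .
  qed
  then show ?thesis by blast
qed

text \<open>Gibbs' inequality: the inverse density has mean at most 1, and ln x \<le> x - 1 is
  applied to it. Rate splitting needs the conditional informations to be nonnegative.\<close>

lemma cond_mutual_info_nonneg:
  fixes M :: "'o::finite pmf"
  shows "0 \<le> cond_mutual_info (pmf M) A B C"
proof -
  let ?T = "\<lambda>\<omega>. (A \<omega>, B \<omega>, C \<omega>)"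
  let ?\<iota> = "\<lambda>\<omega>. info_density M A B C (A \<omega>) (B \<omega>) (C \<omega>)"
  let ?pac = "\<lambda>a c. pmf (map_pmf (\<lambda>\<omega>. (A \<omega>, C \<omega>)) M) (a, c)"
  let ?pbc = "\<lambda>b c. pmf (map_pmf (\<lambda>\<omega>. (B \<omega>, C \<omega>)) M) (b, c)"
  let ?pc = "\<lambda>c. pmf (map_pmf C M) c"
  have "expect M (\<lambda>\<omega>. inverse (?\<iota> \<omega>)) = expect (map_pmf ?T M) (\<lambda>(a, b, c). inverse (info_density M A B C a b c))"
    by (subst expect_map) auto
  also have "\<dots> = (\<Sum>t\<in>range A \<times> range B \<times> range C. pmf (map_pmf ?T M) t * (case t of (a, b, c) \<Rightarrow> inverse (info_density M A B C a b c)))"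
    by (intro expect_superset) auto
  \<comment> \<open>Only an inequality: triples of probability 0 may contribute on the
    right.\<close>
  also have "\<dots> \<le> (\<Sum>t\<in>range A \<times> range B \<times> range C. case t of (a, b, c) \<Rightarrow> ?pac a c * ?pbc b c / ?pc c)"
  proof (intro sum_mono, clarify)
    fix a b c
    show "pmf (map_pmf ?T M) (A a, B b, C c) * inverse (info_density M A B C (A a) (B b) (C c))
      \<le> ?pac (A a) (C c) * ?pbc (B b) (C c) / ?pc (C c)"
      by (cases "pmf (map_pmf ?T M) (A a, B b, C c) = 0") (auto simp: info_density_def)
  qed
  also have "\<dots> = (\<Sum>a\<in>range A. \<Sum>b\<in>range B. \<Sum>c\<in>range C. ?pac a c * ?pbc b c / ?pc c)"
    by (simp add: sum.cartesian_product)
  also have "\<dots> = (\<Sum>c\<in>range C. \<Sum>a\<in>range A. \<Sum>b\<in>range B. ?pac a c * ?pbc b c / ?pc c)"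
    by (subst sum.swap[of _ "range C"], subst sum.swap[of _ "range C"]) (rule refl)
  also have "\<dots> = (\<Sum>c\<in>range C. (\<Sum>a\<in>range A. ?pac a c) * (\<Sum>b\<in>range B. ?pbc b c) / ?pc c)"
    by (simp add: sum_product sum_divide_distrib)
  also have "\<dots> \<le> (\<Sum>c\<in>range C. ?pc c * ?pc c / ?pc c)"
    by (intro sum_mono divide_right_mono mult_mono sum_pmf_map_le sum_nonneg) auto
  also have "\<dots> = (\<Sum>c\<in>range C. ?pc c)" by simp
  also have "\<dots> = 1" by (intro sum_pmf_eq_1) auto
  finally have inv: "expect M (\<lambda>\<omega>. inverse (?\<iota> \<omega>)) \<le> 1" .
  have "0 \<le> (1 - expect M (\<lambda>\<omega>. inverse (?\<iota> \<omega>))) * (1 / ln 2)" using inv by simp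
  also have "\<dots> = expect M (\<lambda>\<omega>. (1 - inverse (?\<iota> \<omega>)) * (1 / ln 2))"
    by (simp only: expect_multc expect_diff) (simp add: expect_const)
  also have "\<dots> \<le> expect M (\<lambda>\<omega>. log 2 (?\<iota> \<omega>))"
  proof (rule expect_mono)
    fix \<omega> assume "\<omega> \<in> set_pmf M"
    then have pos: "0 < ?\<iota> \<omega>" by (rule info_density_pos)
    then have "ln (inverse (?\<iota> \<omega>)) \<le> inverse (?\<iota> \<omega>) - 1" by (intro ln_le_minus_one) auto
    then have "1 - inverse (?\<iota> \<omega>) \<le> ln (?\<iota> \<omega>)" using pos by (simp add: ln_inverse)
    then show "(1 - inverse (?\<iota> \<omega>)) * (1 / ln 2) \<le> log 2 (?\<iota> \<omega>)"
      by (simp add: log_def divide_right_mono)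
  qed
  finally show ?thesis by (simp add: cond_mutual_info_eq_expect)
qed

lemma pmf_eq_expect: "finite (set_pmf p) \<Longrightarrow> pmf p x = expect p (\<lambda>y. of_bool (y = x))"
proof -
  assume "finite (set_pmf p)"
  moreover have "expect p (\<lambda>y. of_bool (y = x)) = (\<Sum>y\<in>set_pmf p. if y = x then pmf p x else 0)"
    unfolding expect_def by (intro sum.cong) auto
  ultimately show ?thesis by (simp add: set_pmf_iff)
qed

lemma pmf_eqI_expect:
  assumes "finite (set_pmf p)" "finite (set_pmf p')" "\<And>F. expect p F = expect p' F"
  shows "p = p'"
  using assms by (intro pmf_eqI) (simp add: pmf_eq_expect)

lemma ex_pmf:
  fixes f :: "'a::finite \<Rightarrow> real"
  assumes "\<And>x. 0 \<le> f x" "(\<Sum>x\<in>UNIV. f x) = 1"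
  shows "\<exists>p. \<forall>x. pmf p x = f x"
proof -
  have "(\<integral>\<^sup>+x. ennreal (f x) \<partial>count_space UNIV) = 1"
    using assms by (simp add: nn_integral_count_space_finite sum_ennreal)
  then show ?thesis using assms pmf_embed_pmf[of f] by blast
qed

lemma prod_bounds_of_log_sum:
  fixes x :: "nat \<Rightarrow> real"
  assumes pos: "\<And>i. i < N \<Longrightarrow> 0 < x i"
    and dev: "\<bar>(\<Sum>i<N. log 2 (x i)) - real N * \<mu>\<bar> < \<delta> * real N"
  shows "2 powr (real N * (\<mu> - \<delta>)) \<le> (\<Prod>i<N. x i)" "(\<Prod>i<N. x i) \<le> 2 powr (real N * (\<mu> + \<delta>))"
proof -
  have "(\<Prod>i<N. x i) = 2 powr (\<Sum>i<N. log 2 (x i))"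
    using pos by (simp add: powr_sum)
  moreover have "real N * (\<mu> - \<delta>) \<le> (\<Sum>i<N. log 2 (x i))" "(\<Sum>i<N. log 2 (x i)) \<le> real N * (\<mu> + \<delta>)"
    using dev by (auto simp: algebra_simps abs_less_iff)
  ultimately show "2 powr (real N * (\<mu> - \<delta>)) \<le> (\<Prod>i<N. x i)" "(\<Prod>i<N. x i) \<le> 2 powr (real N * (\<mu> + \<delta>))"
    by auto
qed

lemma ex_bound_finite: "\<exists>C. \<forall>x. \<bar>f x\<bar> \<le> C" for f :: "'a::finite \<Rightarrow> real"
  by (intro exI[of _ "Max (range (\<lambda>x. \<bar>f x\<bar>))"]) (auto intro!: Max_ge)

definition joint_pmf :: "'a pmf \<Rightarrow> ('a \<Rightarrow> 'b pmf) \<Rightarrow> ('a \<times> 'b) pmf" where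
  "joint_pmf p k = bind_pmf p (\<lambda>a. map_pmf (Pair a) (k a))"

lemma expect_joint:
  assumes "finite (set_pmf p)" "\<And>a. finite (set_pmf (k a))"
  shows "expect (joint_pmf p k) F = expect p (\<lambda>a. expect (k a) (\<lambda>b. F (a, b)))"
  unfolding joint_pmf_def using assms by (simp add: expect_bind expect_map)

lemma pmf_joint:
  fixes p :: "'a::finite pmf" and k :: "'a \<Rightarrow> 'b::finite pmf"
  shows "pmf (joint_pmf p k) (a, b) = pmf p a * pmf (k a) b"
proof -
  have "pmf (joint_pmf p k) (a, b) = expect p (\<lambda>a'. expect (k a') (\<lambda>b'. of_bool ((a', b') = (a, b))))"
    by (subst pmf_eq_expect) (auto simp: expect_joint)
  also have "\<dots> = expect p (\<lambda>a'. of_bool (a' = a) * expect (k a) (\<lambda>b'. of_bool (b' = b)))"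
    by (intro expect_cong) (auto simp: expect_const)
  also have "\<dots> = pmf p a * pmf (k a) b"
    by (simp only: expect_multc) (simp add: pmf_eq_expect[symmetric])
  finally show ?thesis .
qed

subsection \<open>The sliding-window scheme\<close>

text \<open>The noise of the kernel is represented as a random
  function of the pair of triples, drawn independently of them; this makes the whole process a
  windowed function of an iid sequence.\<close>

locale sliding_window =
  fixes rp :: "('u::finite \<times> 'v::finite \<times> 'w::finite) pmf"
    and rcp :: "'u \<times> 'v \<times> 'w \<Rightarrow> 'u \<times> 'v \<times> 'w \<Rightarrow> 'x::finite pmf"
    and qp :: "'x \<Rightarrow> ('y::finite \<times> 'z::finite) pmf"
begin

definition ker where "ker s s' = joint_pmf (rcp s s') qp"

definition noise :: "(('u \<times> 'v \<times> 'w) \<times> ('u \<times> 'v \<times> 'w) \<Rightarrow> 'x \<times> 'y \<times> 'z) pmf" where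
  "noise = Pi_pmf UNIV undefined (\<lambda>(s, s'). ker s s')"

definition site where "site = pair_pmf rp noise"

definition arrange where
  "arrange j = (case j of (s1, s2, (x1, y1, z1), (x2, y2, z2)) \<Rightarrow> (s1, s2, x1, x2, y1, y2, z1, z2))"

text \<open>For consecutive sites \<open>i\<close>, \<open>i + 1\<close>, \<open>i + 2\<close>, the
  first output group stems from the channel use fed by letters \<open>i\<close> and
  \<open>i + 1\<close>, the second from the use fed by \<open>i + 1\<close> and
  \<open>i + 2\<close>. The letter of \<open>a\<close> enters only through the first group, whence
  the averaged kernel of the theorem.\<close>

definition window where
  "window a b c = arrange (fst b, fst c, snd a (fst a, fst b), snd b (fst b, fst c))"

definition M where "M = bind_pmf site (\<lambda>a. bind_pmf site (\<lambda>b. map_pmf (window a b) site))"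

lemma expect_M: "expect M F = expect site (\<lambda>a. expect site (\<lambda>b. expect site (\<lambda>c. F (window a b c))))"
  unfolding M_def by (simp add: expect_bind expect_map)

lemma window_in_M: "a \<in> set_pmf site \<Longrightarrow> b \<in> set_pmf site \<Longrightarrow> c \<in> set_pmf site \<Longrightarrow> window a b c \<in> set_pmf M"
  unfolding M_def by auto

lemma expect_noise: "expect noise (\<lambda>\<xi>. F (\<xi> (s, s'))) = expect (ker s s') F"
  unfolding noise_def by (subst expect_Pi_component) auto

lemma ker_eq_noise: "ker s s' = map_pmf (\<lambda>\<xi>. \<xi> (s, s')) noise"
  unfolding noise_def by (subst Pi_pmf_component) auto

lemma expect_site: "expect site F = expect rp (\<lambda>s. expect noise (\<lambda>\<xi>. F (s, \<xi>)))"
  unfolding site_def by (rule expect_pair) auto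

text \<open>The law of a window with the letter \<open>s0\<close> averaged out, arranged as a chain
  of kernels so that probabilities can be read off as products.\<close>

definition J where "J = joint_pmf rp (\<lambda>s1. joint_pmf rp (\<lambda>s2.
  joint_pmf (bind_pmf rp (\<lambda>s0. ker s0 s1)) (\<lambda>_. ker s1 s2)))"

text \<open>Each noise function is evaluated at one argument only, so its mean is a draw from
  \<open>ker\<close>; exchanging the independent draws then allows \<open>s0\<close> to be averaged
  out.\<close>

lemma expect_M_J: "expect M F = expect J (\<lambda>j. F (arrange j))"
proof -
  have "expect M F = expect rp (\<lambda>s0. expect noise (\<lambda>\<xi>0. expect rp (\<lambda>s1. expect noise (\<lambda>\<xi>1. expect rp (\<lambda>s2.
      F (arrange (s1, s2, \<xi>0 (s0, s1), \<xi>1 (s1, s2))))))))"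
    by (simp add: expect_M expect_site window_def expect_const)
  also have "\<dots> = expect rp (\<lambda>s0. expect noise (\<lambda>\<xi>0. expect rp (\<lambda>s1. expect rp (\<lambda>s2. expect noise (\<lambda>\<xi>1. 
      F (arrange (s1, s2, \<xi>0 (s0, s1), \<xi>1 (s1, s2))))))))"
    by (subst expect_swap[of noise rp]) (rule refl)
  also have "\<dots> = expect rp (\<lambda>s0. expect noise (\<lambda>\<xi>0. expect rp (\<lambda>s1. expect rp (\<lambda>s2. expect (ker s1 s2) (\<lambda>o2. 
      F (arrange (s1, s2, \<xi>0 (s0, s1), o2)))))))"
    by (intro expect_cong expect_noise)
  also have "\<dots> = expect rp (\<lambda>s0. expect rp (\<lambda>s1. expect noise (\<lambda>\<xi>0. expect rp (\<lambda>s2. expect (ker s1 s2) (\<lambda>o2. 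
      F (arrange (s1, s2, \<xi>0 (s0, s1), o2)))))))"
    by (intro expect_cong expect_swap)
  also have "\<dots> = expect rp (\<lambda>s0. expect rp (\<lambda>s1. expect (ker s0 s1) (\<lambda>o1. expect rp (\<lambda>s2. expect (ker s1 s2) (\<lambda>o2. 
      F (arrange (s1, s2, o1, o2)))))))"
    by (intro expect_cong expect_noise)
  also have "\<dots> = expect rp (\<lambda>s1. expect (bind_pmf rp (\<lambda>s0. ker s0 s1)) (\<lambda>o1. expect rp (\<lambda>s2. expect (ker s1 s2) (\<lambda>o2. 
      F (arrange (s1, s2, o1, o2))))))"
    by (subst expect_swap) (simp add: expect_bind)
  also have "\<dots> = expect J (\<lambda>j. F (arrange j))"
    unfolding J_def by (simp add: expect_joint) (intro expect_cong expect_swap)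
  finally show ?thesis .
qed

lemma pmf_ker: "pmf (ker s s') (x, y, z) = pmf (rcp s s') x * pmf (qp x) (y, z)"
  unfolding ker_def by (rule pmf_joint)

text \<open>This identifies \<open>M\<close> with the pmf \<open>P\<close> of the theorem: the sum
  over \<open>s0\<close> is the averaged kernel.\<close>

lemma pmf_M:
  "pmf M (s1, s2, x1, x2, y1, y2, z1, z2) =
    pmf rp s1 * pmf rp s2 * pmf (rcp s1 s2) x2 * pmf (qp x2) (y2, z2)
    * (\<Sum>s0\<in>UNIV. pmf (rcp s0 s1) x1 * pmf rp s0) * pmf (qp x1) (y1, z1)"
proof -
  have M: "M = map_pmf arrange J"
    by (rule pmf_eqI_expect) (auto simp: expect_M_J expect_map)
  have inj: "inj arrange" by (auto simp: inj_def arrange_def split: prod.splits)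
  have "pmf (bind_pmf rp (\<lambda>s0. ker s0 s1)) (x1, y1, z1) = (\<Sum>s0\<in>UNIV. pmf (rcp s0 s1) x1 * pmf rp s0) * pmf (qp x1) (y1, z1)"
    by (simp add: pmf_bind expect_eq_expectation[symmetric] expect_UNIV pmf_ker sum_distrib_left sum_distrib_right mult_ac)
  moreover have "pmf M (arrange (s1, s2, (x1, y1, z1), (x2, y2, z2))) = pmf J (s1, s2, (x1, y1, z1), (x2, y2, z2))"
    unfolding M by (intro pmf_map_inj' inj)
  ultimately show ?thesis
    by (simp add: arrange_def J_def pmf_joint pmf_ker mult_ac)
qed

definition U1 where "U1 = (\<lambda>(s1, s2, x1, x2, y1, y2, z1, z2). fst s1)"
definition V1 where "V1 = (\<lambda>(s1, s2, x1, x2, y1, y2, z1, z2). fst (snd s1))"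
definition W1 where "W1 = (\<lambda>(s1, s2, x1, x2, y1, y2, z1, z2). snd (snd s1))"
definition U2 where "U2 = (\<lambda>(s1, s2, x1, x2, y1, y2, z1, z2). fst s2)"
definition V2 where "V2 = (\<lambda>(s1, s2, x1, x2, y1, y2, z1, z2). fst (snd s2))"
definition W2 where "W2 = (\<lambda>(s1, s2, x1, x2, y1, y2, z1, z2). snd (snd s2))"
definition Y1 where "Y1 = (\<lambda>(s1, s2, x1, x2, y1, y2, z1, z2). y1)"
definition Y2 where "Y2 = (\<lambda>(s1, s2, x1, x2, y1, y2, z1, z2). y2)"
definition Z1 where "Z1 = (\<lambda>(s1, s2, x1, x2, y1, y2, z1, z2). z1)"
definition Z2 where "Z2 = (\<lambda>(s1, s2, x1, x2, y1, y2, z1, z2). z2)"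

end

text \<open>\<open>cU\<close> and \<open>cV\<close> are versions of p(u | w) and p(v | w), the laws
  from which satellites are drawn; at letters \<open>w\<close> of probability 0 they are
  arbitrary.\<close>

locale sliding_code = sliding_window rp rcp qp
  for rp :: "('u::finite \<times> 'v::finite \<times> 'w::finite) pmf"
    and rcp :: "'u \<times> 'v \<times> 'w \<Rightarrow> 'u \<times> 'v \<times> 'w \<Rightarrow> 'x::finite pmf"
    and qp :: "'x \<Rightarrow> ('y::finite \<times> 'z::finite) pmf" +
  fixes cU :: "'w \<Rightarrow> 'u pmf" and cV :: "'w \<Rightarrow> 'v pmf"
  assumes cU: "\<And>u w. pmf (cU w) u * pmf (map_pmf W2 M) w = pmf (map_pmf (\<lambda>\<omega>. (U2 \<omega>, W2 \<omega>)) M) (u, w)"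
    and cV: "\<And>v w. pmf (cV w) v * pmf (map_pmf W2 M) w = pmf (map_pmf (\<lambda>\<omega>. (V2 \<omega>, W2 \<omega>)) M) (v, w)"
begin

definition pW where "pW = map_pmf W2 M"

text \<open>\<open>iUW\<close> and \<open>iVW\<close> serve to reject wrong cloud centres,
  \<open>iU\<close> and \<open>iV\<close> to reject wrong bins under the right centre;
  \<open>iUV\<close> is the encoder's weight.\<close>

definition iUW where "iUW = info_density M (\<lambda>\<omega>. (U2 \<omega>, W2 \<omega>)) (\<lambda>\<omega>. (Y1 \<omega>, Y2 \<omega>, U1 \<omega>, W1 \<omega>)) (\<lambda>_. ())"
definition iVW where "iVW = info_density M (\<lambda>\<omega>. (V2 \<omega>, W2 \<omega>)) (\<lambda>\<omega>. (Z1 \<omega>, Z2 \<omega>, V1 \<omega>, W1 \<omega>)) (\<lambda>_. ())"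
definition iU where "iU = info_density M U2 (\<lambda>\<omega>. (Y1 \<omega>, Y2 \<omega>, U1 \<omega>, W1 \<omega>)) W2"
definition iV where "iV = info_density M V2 (\<lambda>\<omega>. (Z1 \<omega>, Z2 \<omega>, V1 \<omega>, W1 \<omega>)) W2"
definition iUV where "iUV = info_density M U2 V2 W2"

lemmas i_defs = iUW_def iVW_def iU_def iV_def iUV_def

lemma i_nonneg: "0 \<le> iUW a b c" "0 \<le> iVW a' b' c" "0 \<le> iU u b w" "0 \<le> iV v b' w" "0 \<le> iUV u v w"
  unfolding i_defs by (intro info_density_nonneg)+

lemma expect_iU: "expect (cU w) (\<lambda>u. iU u b w) \<le> 1"
  and expect_iUV_u: "expect (cU w) (\<lambda>u. iUV u v w) \<le> 1"
  unfolding i_defs by (intro expect_info_density_le_1 cU finite)+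

lemma expect_iV: "expect (cV w) (\<lambda>v. iV v b w) \<le> 1"
  unfolding i_defs by (intro expect_info_density_le_1 cV finite)

lemma expect_iUV_v: "expect (cV w) (\<lambda>v. iUV u v w) \<le> 1"
  unfolding i_defs by (subst info_density_commute) (intro expect_info_density_le_1 cV finite)

text \<open>Drawing \<open>w\<close> from \<open>pW\<close> and then \<open>u\<close> from
  \<open>cU w\<close> reproduces the law of (U2, W2), so this is the density bound with trivial
  conditioning.\<close>

lemma expect_iUW: "expect pW (\<lambda>w. expect (cU w) (\<lambda>u. iUW (u, w) b ())) \<le> 1"
proof -
  have "map_pmf (\<lambda>\<omega>. (U2 \<omega>, W2 \<omega>)) M = map_pmf prod.swap (joint_pmf pW cU)"
  proof (rule pmf_eqI)
    fix uw :: "'u \<times> 'w"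
    obtain u w where uw: "uw = (u, w)" by (cases uw)
    have "pmf (map_pmf prod.swap (joint_pmf pW cU)) (prod.swap (w, u)) = pmf (joint_pmf pW cU) (w, u)"
      by (intro pmf_map_inj') auto
    then show "pmf (map_pmf (\<lambda>\<omega>. (U2 \<omega>, W2 \<omega>)) M) uw = pmf (map_pmf prod.swap (joint_pmf pW cU)) uw"
      by (simp add: uw pmf_joint cU[symmetric] pW_def mult.commute)
  qed
  then have "expect pW (\<lambda>w. expect (cU w) (\<lambda>u. iUW (u, w) b ()))
    = expect (map_pmf (\<lambda>\<omega>. (U2 \<omega>, W2 \<omega>)) M) (\<lambda>a. iUW a b ())"
    by (simp add: expect_map expect_joint)
  also have "\<dots> \<le> 1" unfolding iUW_def
  proof (rule expect_info_density_le_1)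
    fix a
    have "map_pmf (\<lambda>\<omega>. ((U2 \<omega>, W2 \<omega>), ())) M = map_pmf (\<lambda>a. (a, ())) (map_pmf (\<lambda>\<omega>. (U2 \<omega>, W2 \<omega>)) M)"
      by (simp add: map_pmf_comp)
    moreover have "pmf (map_pmf (\<lambda>a. (a, ())) (map_pmf (\<lambda>\<omega>. (U2 \<omega>, W2 \<omega>)) M)) (a, ()) = pmf (map_pmf (\<lambda>\<omega>. (U2 \<omega>, W2 \<omega>)) M) a"
      by (rule pmf_map_inj') (auto simp: inj_def)
    ultimately show "pmf (map_pmf (\<lambda>\<omega>. (U2 \<omega>, W2 \<omega>)) M) a * pmf (map_pmf (\<lambda>_. ()) M) () = pmf (map_pmf (\<lambda>\<omega>. ((U2 \<omega>, W2 \<omega>), ())) M) (a, ())"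
      by (simp add: map_pmf_const)
  qed (rule finite)
  finally show ?thesis .
qed

lemma expect_iVW: "expect pW (\<lambda>w. expect (cV w) (\<lambda>v. iVW (v, w) b ())) \<le> 1"
proof -
  have "map_pmf (\<lambda>\<omega>. (V2 \<omega>, W2 \<omega>)) M = map_pmf prod.swap (joint_pmf pW cV)"
  proof (rule pmf_eqI)
    fix vw :: "'v \<times> 'w"
    obtain v w where vw: "vw = (v, w)" by (cases vw)
    have "pmf (map_pmf prod.swap (joint_pmf pW cV)) (prod.swap (w, v)) = pmf (joint_pmf pW cV) (w, v)"
      by (intro pmf_map_inj') auto
    then show "pmf (map_pmf (\<lambda>\<omega>. (V2 \<omega>, W2 \<omega>)) M) vw = pmf (map_pmf prod.swap (joint_pmf pW cV)) vw"
      by (simp add: vw pmf_joint cV[symmetric] pW_def mult.commute)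
  qed
  then have "expect pW (\<lambda>w. expect (cV w) (\<lambda>v. iVW (v, w) b ()))
    = expect (map_pmf (\<lambda>\<omega>. (V2 \<omega>, W2 \<omega>)) M) (\<lambda>a. iVW a b ())"
    by (simp add: expect_map expect_joint)
  also have "\<dots> \<le> 1" unfolding iVW_def
  proof (rule expect_info_density_le_1)
    fix a
    have "map_pmf (\<lambda>\<omega>. ((V2 \<omega>, W2 \<omega>), ())) M = map_pmf (\<lambda>a. (a, ())) (map_pmf (\<lambda>\<omega>. (V2 \<omega>, W2 \<omega>)) M)"
      by (simp add: map_pmf_comp)
    moreover have "pmf (map_pmf (\<lambda>a. (a, ())) (map_pmf (\<lambda>\<omega>. (V2 \<omega>, W2 \<omega>)) M)) (a, ()) = pmf (map_pmf (\<lambda>\<omega>. (V2 \<omega>, W2 \<omega>)) M) a"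
      by (rule pmf_map_inj') (auto simp: inj_def)
    ultimately show "pmf (map_pmf (\<lambda>\<omega>. (V2 \<omega>, W2 \<omega>)) M) a * pmf (map_pmf (\<lambda>_. ()) M) () = pmf (map_pmf (\<lambda>\<omega>. ((V2 \<omega>, W2 \<omega>), ())) M) (a, ())"
      by (simp add: map_pmf_const)
  qed (rule finite)
  finally show ?thesis .
qed

lemma window_simps:
  "U1 (window a b c) = fst (fst b)" "V1 (window a b c) = fst (snd (fst b))" "W1 (window a b c) = snd (snd (fst b))"
  "U2 (window a b c) = fst (fst c)" "V2 (window a b c) = fst (snd (fst c))" "W2 (window a b c) = snd (snd (fst c))"
  "Y1 (window a b c) = fst (snd (snd a (fst a, fst b)))" "Z1 (window a b c) = snd (snd (snd a (fst a, fst b)))"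
  "Y2 (window a b c) = fst (snd (snd b (fst b, fst c)))" "Z2 (window a b c) = snd (snd (snd b (fst b, fst c)))"
  by (simp_all add: window_def arrange_def U1_def V1_def W1_def U2_def V2_def W2_def Y1_def Y2_def Z1_def Z2_def
      case_prod_unfold)

lemma law_s2: "map_pmf (\<lambda>\<omega>. (U2 \<omega>, V2 \<omega>, W2 \<omega>)) M = rp"
proof (rule pmf_eqI_expect)
  fix F
  show "expect (map_pmf (\<lambda>\<omega>. (U2 \<omega>, V2 \<omega>, W2 \<omega>)) M) F = expect rp F"
    by (simp add: expect_map expect_M expect_const window_simps) (simp add: expect_site expect_const)
qed auto

definition indep where
  "indep = bind_pmf pW (\<lambda>w. bind_pmf (cU w) (\<lambda>u. map_pmf (\<lambda>v. (u, v, w)) (cV w)))"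

lemma pmf_indep: "pmf indep (u, v, w) = pmf pW w * pmf (cU w) u * pmf (cV w) v"
proof -
  let ?J = "joint_pmf pW (\<lambda>w. joint_pmf (cU w) (\<lambda>_. cV w))"
  have "indep = map_pmf (\<lambda>(w, u, v). (u, v, w)) ?J"
    unfolding indep_def
    by (rule pmf_eqI_expect) (auto simp: expect_map expect_joint expect_bind)
  moreover have "pmf (map_pmf (\<lambda>(w, u, v). (u, v, w)) ?J) ((\<lambda>(w, u, v). (u, v, w)) (w, u, v)) = pmf ?J (w, u, v)"
    by (rule pmf_map_inj') (auto simp: inj_def)
  ultimately show ?thesis by (simp add: pmf_joint)
qed

text \<open>\<open>indep\<close> makes \<open>u\<close> and \<open>v\<close> independent given
  \<open>w\<close>, as the codebook does; \<open>iUV\<close> is the density of the true law with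
  respect to it.\<close>

lemma pmf_rp_eq: "pmf rp s = pmf indep s * (case s of (u, v, w) \<Rightarrow> iUV u v w)"
proof -
  obtain u v w where s: "s = (u, v, w)" by (cases s)
  let ?pu = "pmf (map_pmf (\<lambda>\<omega>. (U2 \<omega>, W2 \<omega>)) M) (u, w)" and ?pv = "pmf (map_pmf (\<lambda>\<omega>. (V2 \<omega>, W2 \<omega>)) M) (v, w)"
  have i: "iUV u v w = pmf rp (u, v, w) * pmf pW w / (?pu * ?pv)"
    by (simp add: iUV_def info_density_def law_s2 pW_def)
  show ?thesis
  proof (cases "pmf rp s = 0")
    case True
    then show ?thesis by (simp add: i s)
  next
    case False
    then have "(u, v, w) \<in> set_pmf (map_pmf (\<lambda>\<omega>. (U2 \<omega>, V2 \<omega>, W2 \<omega>)) M)"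
      by (simp only: law_s2 s set_pmf_iff) simp
    then obtain \<omega> where \<omega>: "\<omega> \<in> set_pmf M" "u = U2 \<omega>" "v = V2 \<omega>" "w = W2 \<omega>" by auto
    then have pos: "0 < ?pu" "0 < ?pv" "0 < pmf pW w"
      unfolding pW_def using pmf_map_pos[OF \<omega>(1), of "\<lambda>\<omega>. (U2 \<omega>, W2 \<omega>)"]
        pmf_map_pos[OF \<omega>(1), of "\<lambda>\<omega>. (V2 \<omega>, W2 \<omega>)"] pmf_map_pos[OF \<omega>(1), of W2] by auto
    have "pmf (cU w) u = ?pu / pmf pW w" "pmf (cV w) v = ?pv / pmf pW w"
      using cU[of w u] cV[of w v] pos by (auto simp: pW_def field_simps)
    then show ?thesis using pos by (simp add: s pmf_indep i)
  qed
qed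

section \<open>Laws of words, inputs and outputs\<close>

definition nW where "nW N = Pi_pmf {..<Suc (Suc N)} undefined (\<lambda>_. pW)"
definition nU where "nU N w = Pi_pmf {..<Suc (Suc N)} undefined (\<lambda>i. cU (w i))"
definition nV where "nV N w = Pi_pmf {..<Suc (Suc N)} undefined (\<lambda>i. cV (w i))"
definition nG where "nG N w u v = (\<Prod>i<Suc (Suc N). iUV (u i) (v i) (w i))"
text \<open>\<open>N\<close> windows need \<open>N + 2\<close> letters but only \<open>N + 1\<close>
  channel uses, one per adjacent pair of letters; the block length is therefore
  \<open>Suc N\<close>.\<close>

definition nK where "nK N w u v = Pi_pmf {..<Suc N} undefined (\<lambda>i.
  rcp (u i, v i, w i) (u (Suc i), v (Suc i), w (Suc i)))"
definition nQ where "nQ N x = map_pmf (\<lambda>o'. (\<lambda>i. fst (o' i), \<lambda>i. snd (o' i)))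
  (Pi_pmf {..<Suc N} undefined (\<lambda>i. qp (x i)))"

lemma fin_n: "finite (set_pmf (nW N))" "finite (set_pmf (nU N w))" "finite (set_pmf (nV N w))"
  "finite (set_pmf (nK N w u v))" "finite (set_pmf (nQ N x))"
  unfolding nW_def nU_def nV_def nK_def nQ_def set_map_pmf
  by (auto intro!: finite_imageI finite_set_Pi_pmf)

text \<open>Change of measure with density \<open>nG\<close>: independent satellites with weight
  \<open>nG\<close> act like iid letters of \<open>rp\<close>.\<close>

lemma expect_nletter_change:
  "expect (nW N) (\<lambda>w. expect (nU N w) (\<lambda>u. expect (nV N w) (\<lambda>v. nG N w u v * \<Phi> w u v)))
    = expect (Pi_pmf {..<Suc (Suc N)} (undefined, undefined, undefined) (\<lambda>_. rp))
        (\<lambda>s. \<Phi> (\<lambda>i. snd (snd (s i))) (\<lambda>i. fst (s i)) (\<lambda>i. fst (snd (s i))))"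
proof -
  let ?I = "{..<Suc (Suc N)}" and ?d = "(undefined, undefined, undefined)"
  let ?\<Phi> = "\<lambda>s. \<Phi> (\<lambda>i. snd (snd (s i))) (\<lambda>i. fst (s i)) (\<lambda>i. fst (snd (s i)))"
  let ?\<gamma> = "\<lambda>s. case s of (u, v, w) \<Rightarrow> iUV u v w"
  define F where "F s = (\<Prod>i\<in>?I. ?\<gamma> (s i)) * ?\<Phi> s" for s
  have "expect (Pi_pmf ?I ?d (\<lambda>_. rp)) ?\<Phi> = expect (Pi_pmf ?I ?d (\<lambda>_. indep)) F"
    unfolding F_def by (rule expect_Pi_change_of_measure[symmetric]) (simp_all add: pmf_rp_eq)
  also have "\<dots> = expect (nW N) (\<lambda>w. expect (Pi_pmf ?I ?d (\<lambda>i.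
      bind_pmf (cU (w i)) (\<lambda>u. map_pmf (\<lambda>v. (u, v, w i)) (cV (w i))))) F)"
    unfolding indep_def nW_def
    by (rule expect_Pi_bind[where p="\<lambda>_. pW"
        and k="\<lambda>_ w. bind_pmf (cU w) (\<lambda>u. map_pmf (\<lambda>v. (u, v, w)) (cV w))"]) auto
  also have "\<dots> = expect (nW N) (\<lambda>w. expect (nU N w) (\<lambda>u. expect (Pi_pmf ?I ?d (\<lambda>i.
      map_pmf (\<lambda>v. (u i, v, w i)) (cV (w i)))) F))"
    unfolding nU_def
    by (intro expect_cong expect_Pi_bind[where p="\<lambda>i. cU (_ i)"
        and k="\<lambda>i u. map_pmf (\<lambda>v. (u, v, _ i)) (cV (_ i))"]) auto
  also have "\<dots> = expect (nW N) (\<lambda>w. expect (nU N w) (\<lambda>u. expect (nV N w) (\<lambda>v.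
      F (\<lambda>i. if i \<in> ?I then (u i, v i, w i) else ?d))))"
    unfolding nV_def
    by (intro expect_cong expect_Pi_map[where p="\<lambda>i. cV (_ i)" and h="\<lambda>i v. (_ i, v, _ i)"]) auto
  also have "\<dots> = expect (nW N) (\<lambda>w. expect (nU N w) (\<lambda>u. expect (nV N w) (\<lambda>v. nG N w u v * \<Phi> w u v)))"
  proof (intro expect_cong)
    fix w u v assume m: "w \<in> set_pmf (nW N)" "u \<in> set_pmf (nU N w)" "v \<in> set_pmf (nV N w)"
    \<comment> \<open>Beyond the index set every word takes its default value; the default triple
      \<open>?d\<close> is chosen to match componentwise, so the functions agree on all
      naturals.\<close>
    have "(if i \<in> ?I then (u i, v i, w i) else ?d) = (u i, v i, w i)" for i
    proof (cases "i \<in> ?I")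
      case False
      then show ?thesis
        using Pi_pmf_default[OF finite_lessThan m(1)[unfolded nW_def] False]
          Pi_pmf_default[OF finite_lessThan m(2)[unfolded nU_def] False]
          Pi_pmf_default[OF finite_lessThan m(3)[unfolded nV_def] False] by simp
    qed simp
    then show "F (\<lambda>i. if i \<in> ?I then (u i, v i, w i) else ?d) = nG N w u v * \<Phi> w u v"
      by (simp only:) (simp add: F_def nG_def)
  qed
  finally show ?thesis ..
qed

lemma expect_nletter_output:
  "expect (nK N w u v) (\<lambda>x. expect (nQ N x) (\<lambda>o'. H (fst o') (snd o'))) =
   expect (Pi_pmf {..<Suc N} (undefined, undefined) (\<lambda>i. ker (u i, v i, w i) (u (Suc i), v (Suc i), w (Suc i))))
     (\<lambda>o'. H (\<lambda>i. fst (snd (o' i))) (\<lambda>i. snd (snd (o' i))))"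
proof -
  let ?I = "{..<Suc N}" and ?d = "(undefined, undefined)"
  define HH where "HH o' = H (\<lambda>i. fst (snd (o' i))) (\<lambda>i. snd (snd (o' i)))" for o' :: "nat \<Rightarrow> 'x \<times> 'y \<times> 'z"
  have "expect (Pi_pmf ?I ?d (\<lambda>i. ker (u i, v i, w i) (u (Suc i), v (Suc i), w (Suc i)))) HH
    = expect (nK N w u v) (\<lambda>x. expect (Pi_pmf ?I ?d (\<lambda>i. map_pmf (Pair (x i)) (qp (x i)))) HH)"
    unfolding ker_def joint_pmf_def nK_def
    by (rule expect_Pi_bind[where k="\<lambda>_ x. map_pmf (Pair x) (qp x)"]) auto
  also have "\<dots> = expect (nK N w u v) (\<lambda>x. expect (Pi_pmf ?I undefined (\<lambda>i. qp (x i))) (\<lambda>f.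
        HH (\<lambda>i. if i \<in> ?I then (x i, f i) else ?d)))"
    by (intro expect_cong expect_Pi_map[where h="\<lambda>i. Pair (_ i)"]) auto
  also have "\<dots> = expect (nK N w u v) (\<lambda>x. expect (Pi_pmf ?I undefined (\<lambda>i. qp (x i))) (\<lambda>f.
        H (\<lambda>i. fst (f i)) (\<lambda>i. snd (f i))))"
  proof (intro expect_cong)
    fix x f assume m: "x \<in> set_pmf (nK N w u v)" "f \<in> set_pmf (Pi_pmf ?I undefined (\<lambda>i. qp (x i)))"
    have "(if i \<in> ?I then (x i, f i) else ?d) = (x i, f i)" for i
    proof (cases "i \<in> ?I")
      case False
      then show ?thesis
        using Pi_pmf_default[OF finite_lessThan m(1)[unfolded nK_def] False]
          Pi_pmf_default[OF finite_lessThan m(2) False] by simp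
    qed simp
    then show "HH (\<lambda>i. if i \<in> ?I then (x i, f i) else ?d) = H (\<lambda>i. fst (f i)) (\<lambda>i. snd (f i))"
      by (simp only:) (simp add: HH_def)
  qed
  also have "\<dots> = expect (nK N w u v) (\<lambda>x. expect (nQ N x) (\<lambda>o'. H (fst o') (snd o')))"
    unfolding nQ_def by (subst expect_map) (auto intro!: finite_set_Pi_pmf)
  finally show ?thesis unfolding HH_def ..
qed

text \<open>Draws from \<open>ker\<close> become noise functions applied to neighbouring letters, so
  that the weak law for windows of iid sites applies.\<close>

lemma expect_site_law:
  "expect (Pi_pmf {..<Suc (Suc N)} d (\<lambda>_. rp)) (\<lambda>s. expect (Pi_pmf {..<Suc N} d' (\<lambda>i. ker (s i) (s (Suc i)))) (F s))
    = expect (Pi_pmf {..<Suc (Suc N)} (d, undefined) (\<lambda>_. site)) (\<lambda>\<zeta>. F (\<lambda>i. fst (\<zeta> i))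
        (\<lambda>i. if i < Suc N then snd (\<zeta> i) (fst (\<zeta> i), fst (\<zeta> (Suc i))) else d'))"
proof -
  let ?I = "{..<Suc (Suc N)}"
  have I: "?I = insert (Suc N) {..<Suc N}" by auto
  define FF where "FF \<zeta> = F (\<lambda>i. fst (\<zeta> i)) (\<lambda>i. if i < Suc N then snd (\<zeta> i) (fst (\<zeta> i), fst (\<zeta> (Suc i))) else d')" for \<zeta>
  have site: "site = bind_pmf rp (\<lambda>s. map_pmf (Pair s) noise)"
    by (simp add: site_def pair_pmf_def map_pmf_def)
  have "expect (Pi_pmf ?I (d, undefined) (\<lambda>_. site)) FF
    = expect (Pi_pmf ?I d (\<lambda>_. rp)) (\<lambda>s. expect (Pi_pmf ?I (d, undefined) (\<lambda>i. map_pmf (Pair (s i)) noise)) FF)"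
    unfolding site by (rule expect_Pi_bind[where p="\<lambda>_. rp" and k="\<lambda>_ s. map_pmf (Pair s) noise"]) auto
  also have "\<dots> = expect (Pi_pmf ?I d (\<lambda>_. rp)) (\<lambda>s. expect (Pi_pmf ?I undefined (\<lambda>_. noise)) (\<lambda>\<xi>.
        FF (\<lambda>i. if i \<in> ?I then (s i, \<xi> i) else (d, undefined))))"
    by (intro expect_cong expect_Pi_map[where h="\<lambda>i. Pair (_ i)" and p="\<lambda>_. noise"]) auto
  also have "\<dots> = expect (Pi_pmf ?I d (\<lambda>_. rp)) (\<lambda>s. expect (Pi_pmf ?I undefined (\<lambda>_. noise)) (\<lambda>\<xi>.
        F s (\<lambda>i. if i \<in> {..<Suc N} then \<xi> i (s i, s (Suc i)) else d')))"
  proof (intro expect_cong)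
    fix s \<xi> assume m: "s \<in> set_pmf (Pi_pmf ?I d (\<lambda>_. rp))" "\<xi> \<in> set_pmf (Pi_pmf ?I undefined (\<lambda>_. noise))"
    have "(if i \<in> ?I then (s i, \<xi> i) else (d, undefined)) = (s i, \<xi> i)" for i
    proof (cases "i \<in> ?I")
      case False
      then show ?thesis
        using Pi_pmf_default[OF finite_lessThan m(1) False] Pi_pmf_default[OF finite_lessThan m(2) False] by simp
    qed simp
    then show "FF (\<lambda>i. if i \<in> ?I then (s i, \<xi> i) else (d, undefined)) = F s (\<lambda>i. if i \<in> {..<Suc N} then \<xi> i (s i, s (Suc i)) else d')"
      by (simp only:) (simp add: FF_def cong: if_cong)
  qed
  \<comment> \<open>There are \<open>N + 2\<close> sites for \<open>N + 1\<close> channel uses; the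
    noise function of the last site is integrated out.\<close>
  also have "\<dots> = expect (Pi_pmf ?I d (\<lambda>_. rp)) (\<lambda>s. expect (Pi_pmf {..<Suc N} undefined (\<lambda>_. noise)) (\<lambda>\<xi>.
        F s (\<lambda>i. if i \<in> {..<Suc N} then \<xi> i (s i, s (Suc i)) else d')))"
  proof (rule expect_cong)
    fix s
    have "expect (Pi_pmf ?I undefined (\<lambda>_. noise)) (\<lambda>\<xi>. F s (\<lambda>i. if i \<in> {..<Suc N} then \<xi> i (s i, s (Suc i)) else d'))
      = expect (Pi_pmf {..<Suc N} undefined (\<lambda>_. noise)) (\<lambda>\<xi>. expect noise (\<lambda>\<eta>.
        F s (\<lambda>i. if i \<in> {..<Suc N} then (\<xi>(Suc N := \<eta>)) i (s i, s (Suc i)) else d')))"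
      unfolding I by (rule expect_Pi_insert) auto
    also have "\<dots> = expect (Pi_pmf {..<Suc N} undefined (\<lambda>_. noise)) (\<lambda>\<xi>.
        F s (\<lambda>i. if i \<in> {..<Suc N} then \<xi> i (s i, s (Suc i)) else d'))"
    proof (rule expect_cong)
      fix \<xi>
      have "(\<lambda>i. if i \<in> {..<Suc N} then (\<xi>(Suc N := \<eta>)) i (s i, s (Suc i)) else d')
        = (\<lambda>i. if i \<in> {..<Suc N} then \<xi> i (s i, s (Suc i)) else d')" for \<eta>
        by (rule ext) simp
      then show "expect noise (\<lambda>\<eta>. F s (\<lambda>i. if i \<in> {..<Suc N} then (\<xi>(Suc N := \<eta>)) i (s i, s (Suc i)) else d'))
        = F s (\<lambda>i. if i \<in> {..<Suc N} then \<xi> i (s i, s (Suc i)) else d')"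
        by (simp only: expect_const[OF finite])
    qed
    finally show "expect (Pi_pmf ?I undefined (\<lambda>_. noise)) (\<lambda>\<xi>. F s (\<lambda>i. if i \<in> {..<Suc N} then \<xi> i (s i, s (Suc i)) else d'))
      = expect (Pi_pmf {..<Suc N} undefined (\<lambda>_. noise)) (\<lambda>\<xi>. F s (\<lambda>i. if i \<in> {..<Suc N} then \<xi> i (s i, s (Suc i)) else d'))" .
  qed
  also have "\<dots> = expect (Pi_pmf ?I d (\<lambda>_. rp)) (\<lambda>s. expect (Pi_pmf {..<Suc N} d' (\<lambda>i. ker (s i) (s (Suc i)))) (F s))"
    unfolding ker_eq_noise
    by (intro expect_cong expect_Pi_map[where p="\<lambda>_. noise" and h="\<lambda>i \<xi>. \<xi> (_ i, _ (Suc i))", symmetric]) auto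
  finally show ?thesis unfolding FF_def ..
qed

end

section \<open>Acceptance tests and false acceptance\<close>

context sliding_code
begin

text \<open>Window \<open>i\<close> takes (U2, W2) from letter \<open>i + 2\<close>, (U1, W1) from
  letter \<open>i + 1\<close> and the outputs of uses \<open>i\<close> and \<open>i + 1\<close>. It
  starts there because letter \<open>i + 1\<close> must have a predecessor that feeds the first
  output.\<close>

definition nD1 where
  "nD1 N \<theta> \<theta>' w u y \<longleftrightarrow>
    \<theta> \<le> (\<Prod>i<N. iUW (u (Suc (Suc i)), w (Suc (Suc i))) (y i, y (Suc i), u (Suc i), w (Suc i)) ()) \<and>
    \<theta>' \<le> (\<Prod>i<N. iU (u (Suc (Suc i))) (y i, y (Suc i), u (Suc i), w (Suc i)) (w (Suc (Suc i))))"

definition nD2 where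
  "nD2 N \<theta> \<theta>' w v z \<longleftrightarrow>
    \<theta> \<le> (\<Prod>i<N. iVW (v (Suc (Suc i)), w (Suc (Suc i))) (z i, z (Suc i), v (Suc i), w (Suc i)) ()) \<and>
    \<theta>' \<le> (\<Prod>i<N. iV (v (Suc (Suc i))) (z i, z (Suc i), v (Suc i), w (Suc i)) (w (Suc (Suc i))))"

text \<open>The pairs \<open>(w i, u i)\<close> are iid under the nested law, so the telescoping
  chain bound applies to them.\<close>

lemma expect_nletter_pair:
  assumes c: "\<And>w. finite (set_pmf (c w))"
    and m0: "\<And>i a b. 0 \<le> m i a b"
    and m1: "\<And>i a. i < N \<Longrightarrow> expect pW (\<lambda>w. expect (c w) (\<lambda>u. m i a (w, u))) \<le> 1"
  shows "expect (nW N) (\<lambda>w. expect (Pi_pmf {..<Suc (Suc N)} undefined (\<lambda>i. c (w i))) (\<lambda>u.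
    \<Prod>i<N. m i (w (Suc i), u (Suc i)) (w (Suc (Suc i)), u (Suc (Suc i))))) \<le> 1"
proof -
  let ?I = "{..<Suc (Suc N)}" and ?d = "(undefined, undefined)"
  let ?F = "\<lambda>f. \<Prod>i<N. m i (f (Suc i)) (f (Suc (Suc i)))"
  have "expect (Pi_pmf ?I ?d (\<lambda>_. joint_pmf pW c)) ?F
    = expect (nW N) (\<lambda>w. expect (Pi_pmf ?I ?d (\<lambda>i. map_pmf (Pair (w i)) (c (w i)))) ?F)"
    unfolding joint_pmf_def nW_def
    using c by (intro expect_Pi_bind[where p="\<lambda>_. pW" and k="\<lambda>_ w. map_pmf (Pair w) (c w)"]) auto
  also have "\<dots> = expect (nW N) (\<lambda>w. expect (Pi_pmf ?I undefined (\<lambda>i. c (w i))) (\<lambda>u.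
      ?F (\<lambda>i. if i \<in> ?I then (w i, u i) else ?d)))"
    using c by (intro expect_cong expect_Pi_map[where h="\<lambda>i. Pair (_ i)"]) auto
  also have "\<dots> = expect (nW N) (\<lambda>w. expect (Pi_pmf ?I undefined (\<lambda>i. c (w i))) (\<lambda>u.
    \<Prod>i<N. m i (w (Suc i), u (Suc i)) (w (Suc (Suc i)), u (Suc (Suc i)))))"
    by (intro expect_cong prod.cong) auto
  finally have "expect (nW N) (\<lambda>w. expect (Pi_pmf ?I undefined (\<lambda>i. c (w i))) (\<lambda>u.
    \<Prod>i<N. m i (w (Suc i), u (Suc i)) (w (Suc (Suc i)), u (Suc (Suc i)))))
    = expect (Pi_pmf ?I ?d (\<lambda>_. joint_pmf pW c)) ?F" ..
  also have "\<dots> \<le> 1"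
  proof (rule expect_Pi_chain_le_1)
    show "finite (set_pmf (joint_pmf pW c))" using c by (simp add: joint_pmf_def)
  qed (use c m0 m1 in \<open>auto simp: expect_joint\<close>)
  finally show ?thesis .
qed

lemma nletter_other_1:
  assumes "0 < \<theta>"
  shows "expect (nW N) (\<lambda>w. expect (nU N w) (\<lambda>u. of_bool (nD1 N \<theta> \<theta>' w u y))) \<le> 1 / \<theta>"
proof -
  let ?f = "\<lambda>w u. \<Prod>i<N. iUW (u (Suc (Suc i)), w (Suc (Suc i))) (y i, y (Suc i), u (Suc i), w (Suc i)) ()"
  have "expect (nW N) (\<lambda>w. expect (nU N w) (\<lambda>u. of_bool (nD1 N \<theta> \<theta>' w u y)))
    \<le> expect (nW N) (\<lambda>w. expect (nU N w) (\<lambda>u. of_bool (\<theta> \<le> ?f w u)))"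
    by (intro expect_mono) (auto simp: nD1_def)
  also have "\<dots> \<le> 1 / \<theta>"
  proof (rule expect_nested_markov)
    show "expect (nW N) (\<lambda>w. expect (nU N w) (?f w)) \<le> 1"
      unfolding nU_def
      using expect_nletter_pair[of cU "\<lambda>i a b. iUW (snd b, fst b) (y i, y (Suc i), snd a, fst a) ()" N]
      by (simp add: i_nonneg expect_iUW)
  qed (auto intro!: prod_nonneg i_nonneg assms)
  finally show ?thesis .
qed

lemma nletter_other_2:
  assumes "0 < \<theta>"
  shows "expect (nW N) (\<lambda>w. expect (nV N w) (\<lambda>v. of_bool (nD2 N \<theta> \<theta>' w v z))) \<le> 1 / \<theta>"
proof -
  let ?f = "\<lambda>w v. \<Prod>i<N. iVW (v (Suc (Suc i)), w (Suc (Suc i))) (z i, z (Suc i), v (Suc i), w (Suc i)) ()"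
  have "expect (nW N) (\<lambda>w. expect (nV N w) (\<lambda>v. of_bool (nD2 N \<theta> \<theta>' w v z)))
    \<le> expect (nW N) (\<lambda>w. expect (nV N w) (\<lambda>v. of_bool (\<theta> \<le> ?f w v)))"
    by (intro expect_mono) (auto simp: nD2_def)
  also have "\<dots> \<le> 1 / \<theta>"
  proof (rule expect_nested_markov)
    show "expect (nW N) (\<lambda>w. expect (nV N w) (?f w)) \<le> 1"
      unfolding nV_def
      using expect_nletter_pair[of cV "\<lambda>i a b. iVW (snd b, fst b) (z i, z (Suc i), snd a, fst a) ()" N]
      by (simp add: i_nonneg expect_iVW)
  qed (auto intro!: prod_nonneg i_nonneg assms)
  finally show ?thesis .
qed

text \<open>With \<open>w\<close> fixed the letters of \<open>u\<close> are independent but not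
  identically distributed, which is why the chain bound lets laws and densities vary with the
  position.\<close>

lemma nletter_same_1:
  assumes "0 < \<theta>'"
  shows "expect (nU N w) (\<lambda>u. of_bool (nD1 N \<theta> \<theta>' w u y)) \<le> 1 / \<theta>'"
proof -
  let ?f = "\<lambda>u. \<Prod>i<N. iU (u (Suc (Suc i))) (y i, y (Suc i), u (Suc i), w (Suc i)) (w (Suc (Suc i)))"
  have f: "expect (nU N w) ?f \<le> 1"
    unfolding nU_def
    by (rule expect_Pi_chain_le_1[where m="\<lambda>i a b. iU b (y i, y (Suc i), a, w (Suc i)) (w (Suc (Suc i)))"])
       (auto simp: i_nonneg expect_iU)
  have "expect (nU N w) (\<lambda>u. of_bool (nD1 N \<theta> \<theta>' w u y)) \<le> expect (nU N w) (\<lambda>u. of_bool (\<theta>' \<le> ?f u))"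
    by (intro expect_mono) (auto simp: nD1_def)
  also have "\<dots> \<le> expect (nU N w) ?f / \<theta>'"
    using assms by (intro expect_markov prod_nonneg) (auto simp: i_nonneg)
  also have "\<dots> \<le> 1 / \<theta>'" using f assms by (intro divide_right_mono) auto
  finally show ?thesis .
qed

lemma nletter_same_2:
  assumes "0 < \<theta>'"
  shows "expect (nV N w) (\<lambda>v. of_bool (nD2 N \<theta> \<theta>' w v z)) \<le> 1 / \<theta>'"
proof -
  let ?f = "\<lambda>v. \<Prod>i<N. iV (v (Suc (Suc i))) (z i, z (Suc i), v (Suc i), w (Suc i)) (w (Suc (Suc i)))"
  have f: "expect (nV N w) ?f \<le> 1"
    unfolding nV_def
    by (rule expect_Pi_chain_le_1[where m="\<lambda>i a b. iV b (z i, z (Suc i), a, w (Suc i)) (w (Suc (Suc i)))"])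
       (auto simp: i_nonneg expect_iV)
  have "expect (nV N w) (\<lambda>v. of_bool (nD2 N \<theta> \<theta>' w v z)) \<le> expect (nV N w) (\<lambda>v. of_bool (\<theta>' \<le> ?f v))"
    by (intro expect_mono) (auto simp: nD2_def)
  also have "\<dots> \<le> expect (nV N w) ?f / \<theta>'"
    using assms by (intro expect_markov prod_nonneg) (auto simp: i_nonneg)
  also have "\<dots> \<le> 1 / \<theta>'" using f assms by (intro divide_right_mono) auto
  finally show ?thesis .
qed

lemma nG_u: "expect (nU N w) (\<lambda>u. nG N w u v) \<le> 1"
  unfolding nU_def nG_def
  by (rule expect_Pi_prod_le_1[where f="\<lambda>i u. iUV u (v i) (w i)"]) (auto simp: i_nonneg expect_iUV_u)

lemma nG_v: "expect (nV N w) (\<lambda>v. nG N w u v) \<le> 1"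
  unfolding nV_def nG_def
  by (rule expect_Pi_prod_le_1[where f="\<lambda>i v. iUV (u i) v (w i)"]) (auto simp: i_nonneg expect_iUV_v)

section \<open>Typical behaviour of the true codeword\<close>

definition bad where
  "bad h N \<delta> \<zeta> \<longleftrightarrow> \<delta> * real N \<le>
    \<bar>(\<Sum>i<N. h (window (\<zeta> i) (\<zeta> (Suc i)) (\<zeta> (Suc (Suc i))))) - real N * expect M h\<bar>"

lemma bad_bound:
  "\<exists>C. \<forall>N>0. \<forall>\<delta>>0. \<forall>d. expect (Pi_pmf {..<Suc (Suc N)} d (\<lambda>_. site)) (\<lambda>\<zeta>. of_bool (bad h N \<delta> \<zeta>)) \<le> C / (\<delta>\<^sup>2 * real N)"
proof -
  obtain C where C: "\<bar>h \<omega>\<bar> \<le> C" for \<omega> using ex_bound_finite[of h] by auto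
  show ?thesis unfolding bad_def expect_M
    by (intro exI[of _ "20 * C\<^sup>2"] allI impI weak_law_windows[where h="\<lambda>a b c. h (window a b c)"] C) auto
qed

definition hUW where "hUW \<omega> = log 2 (iUW (U2 \<omega>, W2 \<omega>) (Y1 \<omega>, Y2 \<omega>, U1 \<omega>, W1 \<omega>) ())"
definition hVW where "hVW \<omega> = log 2 (iVW (V2 \<omega>, W2 \<omega>) (Z1 \<omega>, Z2 \<omega>, V1 \<omega>, W1 \<omega>) ())"
definition hU where "hU \<omega> = log 2 (iU (U2 \<omega>) (Y1 \<omega>, Y2 \<omega>, U1 \<omega>, W1 \<omega>) (W2 \<omega>))"
definition hV where "hV \<omega> = log 2 (iV (V2 \<omega>) (Z1 \<omega>, Z2 \<omega>, V1 \<omega>, W1 \<omega>) (W2 \<omega>))"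
definition hUV where "hUV \<omega> = log 2 (iUV (U2 \<omega>) (V2 \<omega>) (W2 \<omega>))"

lemmas h_defs = hUW_def hVW_def hU_def hV_def hUV_def

lemma i_pos:
  assumes "\<omega> \<in> set_pmf M"
  shows "0 < iUW (U2 \<omega>, W2 \<omega>) (Y1 \<omega>, Y2 \<omega>, U1 \<omega>, W1 \<omega>) ()"
    "0 < iVW (V2 \<omega>, W2 \<omega>) (Z1 \<omega>, Z2 \<omega>, V1 \<omega>, W1 \<omega>) ()"
    "0 < iU (U2 \<omega>) (Y1 \<omega>, Y2 \<omega>, U1 \<omega>, W1 \<omega>) (W2 \<omega>)"
    "0 < iV (V2 \<omega>) (Z1 \<omega>, Z2 \<omega>, V1 \<omega>, W1 \<omega>) (W2 \<omega>)"
    "0 < iUV (U2 \<omega>) (V2 \<omega>) (W2 \<omega>)"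
  unfolding i_defs using info_density_pos[OF assms, of "\<lambda>\<omega>. (U2 \<omega>, W2 \<omega>)" "\<lambda>\<omega>. (Y1 \<omega>, Y2 \<omega>, U1 \<omega>, W1 \<omega>)" "\<lambda>_. ()"]
    info_density_pos[OF assms, of "\<lambda>\<omega>. (V2 \<omega>, W2 \<omega>)" "\<lambda>\<omega>. (Z1 \<omega>, Z2 \<omega>, V1 \<omega>, W1 \<omega>)" "\<lambda>_. ()"]
  by (auto intro!: info_density_pos[OF assms] info_density_pos[OF assms, of U2 "\<lambda>\<omega>. (Y1 \<omega>, Y2 \<omega>, U1 \<omega>, W1 \<omega>)" W2]
    info_density_pos[OF assms, of V2 "\<lambda>\<omega>. (Z1 \<omega>, Z2 \<omega>, V1 \<omega>, W1 \<omega>)" W2])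

text \<open>For a log density \<open>h\<close>, \<open>expect M h\<close> is the corresponding
  mutual information; the threshold stays \<open>\<delta>\<close> per window below it.\<close>

definition thr where "thr N \<delta> h = 2 powr (real N * (expect M h - \<delta>))"

lemma good_event:
  fixes d' :: "'x \<times> 'y \<times> 'z"
  assumes \<zeta>: "\<zeta> \<in> set_pmf (Pi_pmf {..<Suc (Suc N)} d (\<lambda>_. site))"
    and \<Gamma>: "\<And>u v w. iUV u v w \<le> \<Gamma>"
    and good: "\<not> bad hUW N \<delta> \<zeta>" "\<not> bad hVW N \<delta> \<zeta>" "\<not> bad hU N \<delta> \<zeta>" "\<not> bad hV N \<delta> \<zeta>" "\<not> bad hUV N \<delta> \<zeta>"
  defines "w \<equiv> \<lambda>i. snd (snd (fst (\<zeta> i)))" and "u \<equiv> \<lambda>i. fst (fst (\<zeta> i))" and "v \<equiv> \<lambda>i. fst (snd (fst (\<zeta> i)))"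
    and "o' \<equiv> \<lambda>i. if i < Suc N then snd (\<zeta> i) (fst (\<zeta> i), fst (\<zeta> (Suc i))) else d'"
  shows "nG N w u v \<le> \<Gamma>\<^sup>2 * 2 powr (real N * (expect M hUV + \<delta>))"
    and "nD1 N (thr N \<delta> hUW) (thr N \<delta> hU) w u (\<lambda>i. fst (snd (o' i)))"
    and "nD2 N (thr N \<delta> hVW) (thr N \<delta> hV) w v (\<lambda>i. snd (snd (o' i)))"
proof -
  let ?\<omega> = "\<lambda>i. window (\<zeta> i) (\<zeta> (Suc i)) (\<zeta> (Suc (Suc i)))"
  have \<omega>: "?\<omega> i \<in> set_pmf M" if "i < N" for i
    using that Pi_pmf_member[OF finite_lessThan \<zeta>] by (intro window_in_M) auto
  have dev: "\<not> bad h N \<delta> \<zeta> \<Longrightarrow> \<bar>(\<Sum>i<N. h (?\<omega> i)) - real N * expect M h\<bar> < \<delta> * real N" for h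
    by (simp add: bad_def)
  have o: "o' i = snd (\<zeta> i) (fst (\<zeta> i), fst (\<zeta> (Suc i)))" "o' (Suc i) = snd (\<zeta> (Suc i)) (fst (\<zeta> (Suc i)), fst (\<zeta> (Suc (Suc i))))"
    if "i < N" for i using that by (auto simp: o'_def)
  have "thr N \<delta> hUW \<le> (\<Prod>i<N. iUW (U2 (?\<omega> i), W2 (?\<omega> i)) (Y1 (?\<omega> i), Y2 (?\<omega> i), U1 (?\<omega> i), W1 (?\<omega> i)) ())"
    unfolding thr_def using dev[OF good(1)] unfolding hUW_def[abs_def]
    by (intro prod_bounds_of_log_sum) (auto intro: i_pos \<omega>)
  moreover have "thr N \<delta> hU \<le> (\<Prod>i<N. iU (U2 (?\<omega> i)) (Y1 (?\<omega> i), Y2 (?\<omega> i), U1 (?\<omega> i), W1 (?\<omega> i)) (W2 (?\<omega> i)))"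
    unfolding thr_def using dev[OF good(3)] unfolding hU_def[abs_def]
    by (intro prod_bounds_of_log_sum) (auto intro: i_pos \<omega>)
  ultimately show "nD1 N (thr N \<delta> hUW) (thr N \<delta> hU) w u (\<lambda>i. fst (snd (o' i)))"
    unfolding nD1_def w_def u_def by (simp add: window_simps o)
  have "thr N \<delta> hVW \<le> (\<Prod>i<N. iVW (V2 (?\<omega> i), W2 (?\<omega> i)) (Z1 (?\<omega> i), Z2 (?\<omega> i), V1 (?\<omega> i), W1 (?\<omega> i)) ())"
    unfolding thr_def using dev[OF good(2)] unfolding hVW_def[abs_def]
    by (intro prod_bounds_of_log_sum) (auto intro: i_pos \<omega>)
  moreover have "thr N \<delta> hV \<le> (\<Prod>i<N. iV (V2 (?\<omega> i)) (Z1 (?\<omega> i), Z2 (?\<omega> i), V1 (?\<omega> i), W1 (?\<omega> i)) (W2 (?\<omega> i)))"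
    unfolding thr_def using dev[OF good(4)] unfolding hV_def[abs_def]
    by (intro prod_bounds_of_log_sum) (auto intro: i_pos \<omega>)
  ultimately show "nD2 N (thr N \<delta> hVW) (thr N \<delta> hV) w v (\<lambda>i. snd (snd (o' i)))"
    unfolding nD2_def w_def v_def by (simp add: window_simps o)
  have "(\<Prod>i<N. iUV (U2 (?\<omega> i)) (V2 (?\<omega> i)) (W2 (?\<omega> i))) \<le> 2 powr (real N * (expect M hUV + \<delta>))"
    using dev[OF good(5)] unfolding hUV_def[abs_def]
    by (intro prod_bounds_of_log_sum) (auto intro: i_pos \<omega>)
  then have P: "(\<Prod>i<N. iUV (u (Suc (Suc i))) (v (Suc (Suc i))) (w (Suc (Suc i)))) \<le> 2 powr (real N * (expect M hUV + \<delta>))"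
    by (simp add: window_simps w_def u_def v_def)
  have \<Gamma>0: "0 \<le> \<Gamma>" using order.trans[OF i_nonneg(5) \<Gamma>] .
  \<comment> \<open>\<open>nG\<close> has \<open>N + 2\<close> factors, of which the windows control
    the last \<open>N\<close>; letters 0 and 1 are bounded by \<open>\<Gamma>\<close> each, hence
    \<open>\<Gamma>\<^sup>2\<close>.\<close>
  have "nG N w u v = (iUV (u 0) (v 0) (w 0) * iUV (u (Suc 0)) (v (Suc 0)) (w (Suc 0)))
    * (\<Prod>i<N. iUV (u (Suc (Suc i))) (v (Suc (Suc i))) (w (Suc (Suc i))))"
    unfolding nG_def by (simp only: prod.lessThan_Suc_shift mult.assoc)
  also have "\<dots> \<le> (\<Gamma> * \<Gamma>) * 2 powr (real N * (expect M hUV + \<delta>))"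
    using \<Gamma> \<Gamma>0 i_nonneg by (intro mult_mono P) (auto intro!: prod_nonneg)
  finally show "nG N w u v \<le> \<Gamma>\<^sup>2 * 2 powr (real N * (expect M hUV + \<delta>))" by (simp add: power2_eq_square)
qed

text \<open>Change of measure, merging of inputs with outputs, and passage to noise functions turn
  the nested mean into a probability on iid sites, where five Chebyshev bounds are added up. The
  witness for \<open>\<Gamma>\<close> is the square of the single-letter bound.\<close>

lemma typical_bound:
  "\<exists>C \<Gamma>. 0 \<le> C \<and> 0 \<le> \<Gamma> \<and> (\<forall>N>0. \<forall>\<delta>>0. 1 - C / (\<delta>\<^sup>2 * real N) \<le>
    expect (nW N) (\<lambda>w. expect (nU N w) (\<lambda>u. expect (nV N w) (\<lambda>v.
        nG N w u v * (of_bool (nG N w u v \<le> \<Gamma> * 2 powr (real N * (expect M hUV + \<delta>)))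
          * expect (nK N w u v) (\<lambda>x. expect (nQ N x) (\<lambda>o'.
          of_bool (nD1 N (thr N \<delta> hUW) (thr N \<delta> hU) w u (fst o')
             \<and> nD2 N (thr N \<delta> hVW) (thr N \<delta> hV) w v (snd o')))))))))"
proof -
  obtain \<Gamma> where \<Gamma>': "\<forall>s. \<bar>case s of (u, v, w) \<Rightarrow> iUV u v w\<bar> \<le> \<Gamma>"
    using ex_bound_finite[of "\<lambda>s. case s of (u, v, w) \<Rightarrow> iUV u v w"] by blast
  have \<Gamma>: "iUV u v w \<le> \<Gamma>" for u v w using \<Gamma>'[rule_format, of "(u, v, w)"] by simp
  obtain C1 C2 C3 C4 C5 where C: "\<forall>N>0. \<forall>\<delta>>0. \<forall>d.
      expect (Pi_pmf {..<Suc (Suc N)} d (\<lambda>_. site)) (\<lambda>\<zeta>. of_bool (bad hUW N \<delta> \<zeta>)) \<le> C1 / (\<delta>\<^sup>2 * real N)"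
    "\<forall>N>0. \<forall>\<delta>>0. \<forall>d.
      expect (Pi_pmf {..<Suc (Suc N)} d (\<lambda>_. site)) (\<lambda>\<zeta>. of_bool (bad hVW N \<delta> \<zeta>)) \<le> C2 / (\<delta>\<^sup>2 * real N)"
    "\<forall>N>0. \<forall>\<delta>>0. \<forall>d.
      expect (Pi_pmf {..<Suc (Suc N)} d (\<lambda>_. site)) (\<lambda>\<zeta>. of_bool (bad hU N \<delta> \<zeta>)) \<le> C3 / (\<delta>\<^sup>2 * real N)"
    "\<forall>N>0. \<forall>\<delta>>0. \<forall>d.
      expect (Pi_pmf {..<Suc (Suc N)} d (\<lambda>_. site)) (\<lambda>\<zeta>. of_bool (bad hV N \<delta> \<zeta>)) \<le> C4 / (\<delta>\<^sup>2 * real N)"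
    "\<forall>N>0. \<forall>\<delta>>0. \<forall>d.
      expect (Pi_pmf {..<Suc (Suc N)} d (\<lambda>_. site)) (\<lambda>\<zeta>. of_bool (bad hUV N \<delta> \<zeta>)) \<le> C5 / (\<delta>\<^sup>2 * real N)"
    using bad_bound[of hUW] bad_bound[of hVW] bad_bound[of hU] bad_bound[of hV] bad_bound[of hUV] by (elim exE) (rule that)
  have main: "1 - (C1 + C2 + C3 + C4 + C5) / (\<delta>\<^sup>2 * real N) \<le>
    expect (nW N) (\<lambda>w. expect (nU N w) (\<lambda>u. expect (nV N w) (\<lambda>v.
        nG N w u v * (of_bool (nG N w u v \<le> \<Gamma>\<^sup>2 * 2 powr (real N * (expect M hUV + \<delta>)))
          * expect (nK N w u v) (\<lambda>x. expect (nQ N x) (\<lambda>o'.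
          of_bool (nD1 N (thr N \<delta> hUW) (thr N \<delta> hU) w u (fst o')
             \<and> nD2 N (thr N \<delta> hVW) (thr N \<delta> hV) w v (snd o'))))))))" (is "_ \<le> ?E")
    if "0 < N" "0 < \<delta>" for N \<delta>
  proof -
    let ?d = "(undefined, undefined, undefined) :: 'u \<times> 'v \<times> 'w" and ?d' = "(undefined, undefined) :: 'x \<times> 'y \<times> 'z"
    let ?I = "{..<Suc (Suc N)}"
    let ?P = "Pi_pmf ?I (?d, undefined) (\<lambda>_. site)"
    let ?G = "\<lambda>w u v. of_bool (nG N w u v \<le> \<Gamma>\<^sup>2 * 2 powr (real N * (expect M hUV + \<delta>))) :: real"
    let ?D = "\<lambda>w u v y z. of_bool (nD1 N (thr N \<delta> hUW) (thr N \<delta> hU) w u y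
             \<and> nD2 N (thr N \<delta> hVW) (thr N \<delta> hV) w v z) :: real"
    let ?F = "\<lambda>s o'. ?G (\<lambda>i. snd (snd (s i))) (\<lambda>i. fst (s i)) (\<lambda>i. fst (snd (s i)))
      * ?D (\<lambda>i. snd (snd (s i))) (\<lambda>i. fst (s i)) (\<lambda>i. fst (snd (s i))) (\<lambda>i. fst (snd (o' i))) (\<lambda>i. snd (snd (o' i)))"
    have finP: "finite (set_pmf ?P)" by (intro finite_set_Pi_pmf) auto
    have "?E = expect (Pi_pmf ?I ?d (\<lambda>_. rp)) (\<lambda>s.
        ?G (\<lambda>i. snd (snd (s i))) (\<lambda>i. fst (s i)) (\<lambda>i. fst (snd (s i)))
        * expect (nK N (\<lambda>i. snd (snd (s i))) (\<lambda>i. fst (s i)) (\<lambda>i. fst (snd (s i)))) (\<lambda>x. expect (nQ N x) (\<lambda>o'.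
          ?D (\<lambda>i. snd (snd (s i))) (\<lambda>i. fst (s i)) (\<lambda>i. fst (snd (s i))) (fst o') (snd o'))))"
      by (rule expect_nletter_change)
    also have "\<dots> = expect (Pi_pmf ?I ?d (\<lambda>_. rp)) (\<lambda>s.
        expect (Pi_pmf {..<Suc N} ?d' (\<lambda>i. ker (s i) (s (Suc i)))) (?F s))"
    proof (rule expect_cong)
      fix s :: "nat \<Rightarrow> 'u \<times> 'v \<times> 'w"
      show "?G (\<lambda>i. snd (snd (s i))) (\<lambda>i. fst (s i)) (\<lambda>i. fst (snd (s i)))
        * expect (nK N (\<lambda>i. snd (snd (s i))) (\<lambda>i. fst (s i)) (\<lambda>i. fst (snd (s i)))) (\<lambda>x. expect (nQ N x) (\<lambda>o'.
          ?D (\<lambda>i. snd (snd (s i))) (\<lambda>i. fst (s i)) (\<lambda>i. fst (snd (s i))) (fst o') (snd o')))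
        = expect (Pi_pmf {..<Suc N} ?d' (\<lambda>i. ker (s i) (s (Suc i)))) (?F s)"
        unfolding expect_cmult
          expect_nletter_output[where H="?D (\<lambda>i. snd (snd (s i))) (\<lambda>i. fst (s i)) (\<lambda>i. fst (snd (s i)))"]
          prod.collapse ..
    qed
    also have "\<dots> = expect ?P (\<lambda>\<zeta>. ?F (\<lambda>i. fst (\<zeta> i))
        (\<lambda>i. if i < Suc N then snd (\<zeta> i) (fst (\<zeta> i), fst (\<zeta> (Suc i))) else ?d'))"
      by (rule expect_site_law)
    finally have E: "?E = \<dots>" .
    have "1 - (C1 + C2 + C3 + C4 + C5) / (\<delta>\<^sup>2 * real N) \<le> expect ?P (\<lambda>\<zeta>. 1 - (of_bool (bad hUW N \<delta> \<zeta>) + of_bool (bad hVW N \<delta> \<zeta>)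
      + of_bool (bad hU N \<delta> \<zeta>) + of_bool (bad hV N \<delta> \<zeta>) + of_bool (bad hUV N \<delta> \<zeta>)))"
      unfolding expect_diff expect_add expect_const[OF finP] add_divide_distrib
      by (intro diff_left_mono add_mono C(1)[rule_format, OF that] C(2)[rule_format, OF that]
          C(3)[rule_format, OF that] C(4)[rule_format, OF that] C(5)[rule_format, OF that])
    also have "\<dots> \<le> ?E" unfolding E
    proof (rule expect_mono)
      fix \<zeta> assume \<zeta>: "\<zeta> \<in> set_pmf ?P"
      show "1 - (of_bool (bad hUW N \<delta> \<zeta>) + of_bool (bad hVW N \<delta> \<zeta>)
        + of_bool (bad hU N \<delta> \<zeta>) + of_bool (bad hV N \<delta> \<zeta>) + of_bool (bad hUV N \<delta> \<zeta>))
        \<le> ?F (\<lambda>i. fst (\<zeta> i)) (\<lambda>i. if i < Suc N then snd (\<zeta> i) (fst (\<zeta> i), fst (\<zeta> (Suc i))) else ?d')"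
      proof (cases "bad hUW N \<delta> \<zeta> \<or> bad hVW N \<delta> \<zeta> \<or> bad hU N \<delta> \<zeta> \<or> bad hV N \<delta> \<zeta> \<or> bad hUV N \<delta> \<zeta>")
        case True
        have nn: "0 \<le> of_bool a * (of_bool b :: real)" for a b by simp
        from True show ?thesis by (intro order.trans[OF _ nn]) auto
      next
        case False
        then show ?thesis
          using good_event(1)[where \<delta>=\<delta>, OF \<zeta> \<Gamma>] good_event(2,3)[where d'="?d'" and \<delta>=\<delta>, OF \<zeta> \<Gamma>]
          by (simp only: de_Morgan_disj) simp
      qed
    qed
    finally show ?thesis .
  qed
  \<comment> \<open>Taken at \<open>N = 1\<close> and \<open>\<delta> = 1\<close>, each bound
    dominates a probability, so its constant is nonnegative.\<close>
  have nn: "0 \<le> D" if "\<forall>N>0. \<forall>\<delta>>0. \<forall>d. expect (Pi_pmf {..<Suc (Suc N)} d (\<lambda>_. site))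
      (\<lambda>\<zeta>. of_bool (bad h N \<delta> \<zeta>)) \<le> D / (\<delta>\<^sup>2 * real N)" for h and D :: real
  proof -
    have "0 \<le> expect (Pi_pmf {..<Suc (Suc 1)} undefined (\<lambda>_. site)) (\<lambda>\<zeta>. of_bool (bad h 1 1 \<zeta>))"
      by (intro expect_nonneg) simp
    also have "\<dots> \<le> D / (1\<^sup>2 * real 1)" by (rule that[rule_format]) auto
    finally show ?thesis by simp
  qed
  have "0 \<le> C1 + C2 + C3 + C4 + C5"
    using nn[OF C(1)] nn[OF C(2)] nn[OF C(3)] nn[OF C(4)] nn[OF C(5)] by simp
  then show ?thesis using main by (intro exI[of _ "C1 + C2 + C3 + C4 + C5"] exI[of _ "\<Gamma>\<^sup>2"]) auto
qed

end

subsection \<open>Rate splitting\<close>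

text \<open>Here \<open>p = R1\<close> is forced: with \<open>J1 = 0\<close> the satellites of
  receiver Y can carry no rate, with \<open>R1 = 0\<close> there is none to carry. Only an interval
  for \<open>s\<close> remains.\<close>

lemma rate_split_forced:
  fixes R0 R1 R2 I1 I2 J1 J2 K :: real
  assumes R: "0 \<le> R0" "0 \<le> R1" "0 \<le> R2" and nn: "0 \<le> J1" "0 \<le> J2" "0 \<le> K"
    and c: "R0 + R1 < I1" "R0 + R2 < I2" "R0 + R1 + R2 < J2 + I1 - K" "R0 + R1 + R2 < J1 + I2 - K"
      "2 * R0 + R1 + R2 < I1 + I2 - K"
    and K: "K < J1 + J2" and forced: "J1 = 0 \<or> R1 = 0"
  shows "\<exists>s. 0 \<le> s \<and> s \<le> R2 \<and> s < I1 - R0 - R1 \<and> R1 < I2 - R0 - R2 \<and>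
    (s = R2 \<or> R2 - J2 < s) \<and> R1 + s < I1 + I2 - K - 2 * R0 - R1 - R2"
proof (cases "J2 = 0 \<or> R2 = 0")
  case True
  then show ?thesis using assms by (intro exI[of _ R2]) auto
next
  case False
  define l where "l = max 0 (R2 - J2)"
  define h where "h = min R2 (min (I1 - R0 - R1) (I1 + I2 - K - 2 * R0 - R1 - R2 - R1))"
  have "l < h" using False assms unfolding l_def h_def by auto
  then obtain s where s: "l < s" "s < h" using dense by blast
  have "0 \<le> l" "R2 - J2 \<le> l" by (auto simp: l_def)
  moreover have "h \<le> R2" "h \<le> I1 - R0 - R1" "h \<le> I1 + I2 - K - 2 * R0 - R1 - R2 - R1" by (auto simp: h_def)
  moreover have "R1 < I2 - R0 - R2" using assms by auto
  ultimately show ?thesis using s by (intro exI[of _ s]) linarith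
qed

text \<open>Open intervals for \<open>p\<close> and \<open>s\<close> are intersected with a strip
  for \<open>p + s\<close>. The lower edge of the strip says that the room left for redundancy,
  \<open>J1 - (R1 - p)\<close> and \<open>J2 - (R2 - s)\<close>, adds up to more than
  \<open>K\<close>.\<close>

lemma rate_split_free:
  fixes R0 R1 R2 I1 I2 J1 J2 K :: real
  assumes R: "0 \<le> R0" "0 < R1" "0 < R2" and nn: "0 < J1" "0 < J2" "0 \<le> K"
    and c: "R0 + R1 < I1" "R0 + R2 < I2" "R0 + R1 + R2 < J2 + I1 - K" "R0 + R1 + R2 < J1 + I2 - K"
      "2 * R0 + R1 + R2 < I1 + I2 - K"
    and K: "K < J1 + J2"
  shows "\<exists>p s. 0 \<le> p \<and> p \<le> R1 \<and> 0 \<le> s \<and> s \<le> R2 \<and> s < I1 - R0 - R1 \<and> p < I2 - R0 - R2 \<and>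
    R1 - J1 < p \<and> R2 - J2 < s \<and> p + s < I1 + I2 - K - 2 * R0 - R1 - R2 \<and>
    K + R1 + R2 - J1 - J2 < p + s"
proof -
  define l1 where "l1 = max 0 (R1 - J1)"
  define h1 where "h1 = min R1 (I2 - R0 - R2)"
  define l2 where "l2 = max 0 (R2 - J2)"
  define h2 where "h2 = min R2 (I1 - R0 - R1)"
  define D where "D = I1 + I2 - K - 2 * R0 - R1 - R2"
  define E where "E = K + R1 + R2 - J1 - J2"
  have l: "0 \<le> l1" "R1 - J1 \<le> l1" "0 \<le> l2" "R2 - J2 \<le> l2" by (auto simp: l1_def l2_def)
  have h: "h1 \<le> R1" "h1 \<le> I2 - R0 - R2" "h2 \<le> R2" "h2 \<le> I1 - R0 - R1" by (auto simp: h1_def h2_def)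
  have lh: "l1 < h1" "l2 < h2" using assms by (auto simp: l1_def l2_def h1_def h2_def)
  have "l1 + l2 < D" using assms by (auto simp: l1_def l2_def D_def max_def)
  moreover have "E < h1 + h2" using assms by (auto simp: h1_def h2_def E_def min_def)
  moreover have "E < D" using assms by (auto simp: E_def D_def)
  moreover have "l1 + l2 < h1 + h2" using lh by simp
  ultimately have "max E (l1 + l2) < min D (h1 + h2)" by auto
  then obtain t where t: "max E (l1 + l2) < t" "t < min D (h1 + h2)" using dense by blast
  \<comment> \<open>The point \<open>(p, s)\<close> is taken on the diagonal from
    \<open>(l1, l2)\<close> to \<open>(h1, h2)\<close>; \<open>\<rho>\<close> gives it coordinate
    sum \<open>t\<close>.\<close>
  define \<rho> where "\<rho> = (t - (l1 + l2)) / (h1 + h2 - (l1 + l2))"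
  have \<rho>: "0 < \<rho>" "\<rho> < 1" using t lh by (auto simp: \<rho>_def field_simps)
  define p where "p = l1 + \<rho> * (h1 - l1)"
  define s where "s = l2 + \<rho> * (h2 - l2)"
  have "0 < \<rho> * (h1 - l1)" "0 < \<rho> * (h2 - l2)" "\<rho> * (h1 - l1) < 1 * (h1 - l1)" "\<rho> * (h2 - l2) < 1 * (h2 - l2)"
    using \<rho> lh by (auto intro!: mult_strict_right_mono mult_pos_pos)
  then have ps: "l1 < p" "p < h1" "l2 < s" "s < h2" by (auto simp: p_def s_def)
  have "p + s = l1 + l2 + \<rho> * (h1 + h2 - (l1 + l2))" by (simp add: p_def s_def algebra_simps)
  also have "\<dots> = t" using lh by (simp add: \<rho>_def)
  finally have "p + s = t" .
  then show ?thesis using ps t l h unfolding D_def E_def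
    by (intro exI[of _ p] exI[of _ s]) auto
qed

text \<open>Fourier--Motzkin elimination for the rates \<open>p\<close>, \<open>s\<close> of the parts of the private messages
  carried by the cloud centres and the rates \<open>a\<close>, \<open>b\<close> of the redundancy spent on covering. When a
  private message is carried entirely by the cloud centre there is no competing satellite, which is
  why the bounds by \<open>J1\<close> and \<open>J2\<close> may then be dropped.\<close>

lemma rate_split:
  fixes R0 R1 R2 I1 I2 J1 J2 K :: real
  assumes R: "0 \<le> R0" "0 \<le> R1" "0 \<le> R2" and nn: "0 \<le> J1" "0 \<le> J2" "0 \<le> K"
    and c: "R0 + R1 < I1" "R0 + R2 < I2" "R0 + R1 + R2 < J2 + I1 - K" "R0 + R1 + R2 < J1 + I2 - K"
      "2 * R0 + R1 + R2 < I1 + I2 - K"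
  obtains p s a b \<delta> where "0 \<le> p" "p \<le> R1" "0 \<le> s" "s \<le> R2" "0 \<le> a" "0 \<le> b" "0 < \<delta>"
    "K + 2 * \<delta> \<le> a + b" "R0 + R1 + s + a + 2 * \<delta> \<le> I1" "R0 + R2 + p + b + 2 * \<delta> \<le> I2"
    "p = R1 \<or> R1 - p + a + 2 * \<delta> \<le> J1" "s = R2 \<or> R2 - s + b + 2 * \<delta> \<le> J2"
proof -
  \<comment> \<open>What remains after eliminating \<open>a\<close> and \<open>b\<close>: their
    upper limits must be positive and add up to more than \<open>K\<close>. When one limit comes
    from \<open>I1\<close> and the other from \<open>J2\<close>, \<open>s\<close> cancels; this is
    the hypothesis with \<open>J2 + I1 - K\<close>, and symmetrically for
    \<open>J1 + I2 - K\<close>.\<close>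
  have "\<exists>p s. 0 \<le> p \<and> p \<le> R1 \<and> 0 \<le> s \<and> s \<le> R2 \<and> s < I1 - R0 - R1 \<and> p < I2 - R0 - R2 \<and>
    (p = R1 \<or> R1 - J1 < p) \<and> (s = R2 \<or> R2 - J2 < s) \<and> p + s < I1 + I2 - K - 2 * R0 - R1 - R2 \<and>
    (p = R1 \<or> s = R2 \<or> K + R1 + R2 - J1 - J2 < p + s)"
  proof -
    consider "J1 + J2 \<le> K" | "K < J1 + J2" "J1 = 0 \<or> R1 = 0" | "K < J1 + J2" "J2 = 0 \<or> R2 = 0"
      | "K < J1 + J2" "0 < J1" "0 < J2" "0 < R1" "0 < R2" using R nn by linarith
    then show ?thesis
    proof cases
      \<comment> \<open>Everything goes into the cloud centre: adding the two bounds on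
        \<open>R0 + R1 + R2\<close> gives \<open>2 * (R0 + R1 + R2) < I1 + I2 - K\<close>, because
        \<open>J1 + J2 \<le> K\<close>.\<close>
      case 1
      then show ?thesis using assms by (intro exI[of _ R1] exI[of _ R2]) auto
    next
      case 2
      then obtain s where "0 \<le> s" "s \<le> R2" "s < I1 - R0 - R1" "R1 < I2 - R0 - R2"
        "s = R2 \<or> R2 - J2 < s" "R1 + s < I1 + I2 - K - 2 * R0 - R1 - R2"
        using rate_split_forced[of R0 R1 R2 J1 J2 K I1 I2] assms by auto
      then show ?thesis using R by (intro exI[of _ R1] exI[of _ s]) auto
    next
      case 3
      then obtain p where "0 \<le> p" "p \<le> R1" "p < I2 - R0 - R2" "R2 < I1 - R0 - R1"
        "p = R1 \<or> R1 - J1 < p" "R2 + p < I2 + I1 - K - 2 * R0 - R2 - R1"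
        using rate_split_forced[of R0 R2 R1 J2 J1 K I2 I1] assms by (auto simp: add_ac)
      then show ?thesis using R by (intro exI[of _ p] exI[of _ R2]) auto
    next
      case 4
      then show ?thesis
        using rate_split_free[of R0 R1 R2 J1 J2 K I1 I2] assms by blast
    qed
  qed
  then obtain p s where ps: "0 \<le> p" "p \<le> R1" "0 \<le> s" "s \<le> R2" "s < I1 - R0 - R1" "p < I2 - R0 - R2"
    "p = R1 \<or> R1 - J1 < p" "s = R2 \<or> R2 - J2 < s" "p + s < I1 + I2 - K - 2 * R0 - R1 - R2"
    "p = R1 \<or> s = R2 \<or> K + R1 + R2 - J1 - J2 < p + s" by blast
  define \<alpha> where "\<alpha> = (if p = R1 then I1 - R0 - R1 - s else min (I1 - R0 - R1 - s) (J1 - R1 + p))"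
  define \<beta> where "\<beta> = (if s = R2 then I2 - R0 - R2 - p else min (I2 - R0 - R2 - p) (J2 - R2 + s))"
  have pos: "0 < \<alpha>" "0 < \<beta>" "0 < \<alpha> + \<beta> - K"
    using ps c by (auto simp: \<alpha>_def \<beta>_def min_def)
  have le: "\<alpha> \<le> I1 - R0 - R1 - s" "\<beta> \<le> I2 - R0 - R2 - p" "p = R1 \<or> \<alpha> \<le> J1 - R1 + p" "s = R2 \<or> \<beta> \<le> J2 - R2 + s"
    by (auto simp: \<alpha>_def \<beta>_def)
  \<comment> \<open>\<open>a\<close> and \<open>b\<close> stay \<open>\<eta>\<close> below their
    limits and \<open>2 * \<delta> = \<eta>\<close>, so the covering condition consumes
    \<open>\<eta>\<close> three times.\<close>
  define \<eta> where "\<eta> = min (min \<alpha> \<beta>) ((\<alpha> + \<beta> - K) / 3)"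
  have \<eta>: "0 < \<eta>" "\<eta> \<le> \<alpha>" "\<eta> \<le> \<beta>" using pos by (auto simp: \<eta>_def)
  have "\<eta> \<le> (\<alpha> + \<beta> - K) / 3" unfolding \<eta>_def by (rule min.cobounded2)
  then have \<eta>3: "3 * \<eta> \<le> \<alpha> + \<beta> - K" by simp
  show ?thesis
    by (rule that[of p s "\<alpha> - \<eta>" "\<beta> - \<eta>" "\<eta> / 2"]) (use ps \<eta> \<eta>3 le in auto)
qed

subsection \<open>Block codes and their rates\<close>

context sliding_code
begin

definition block_error where
  "block_error C \<Gamma> N \<delta> A B1 K1 B2 K2 = C / (\<delta>\<^sup>2 * real N)
    + \<Gamma> * 2 powr (real N * (expect M hUV + \<delta>)) / real (K1 * K2)
    + (real A * real B1 * real K1 * (1 / thr N \<delta> hUW) + real (B1 - 1) * real K1 * (1 / thr N \<delta> hU))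
    + (real A * real B2 * real K2 * (1 / thr N \<delta> hVW) + real (B2 - 1) * real K2 * (1 / thr N \<delta> hV))"

text \<open>The constants are inherited from \<open>typical_bound\<close> and are uniform in
  \<open>N\<close>, \<open>\<delta>\<close> and all sizes, which can therefore be chosen
  afterwards.\<close>

lemma exists_block_code:
  "\<exists>C \<Gamma>. 0 \<le> C \<and> 0 \<le> \<Gamma> \<and> (\<forall>N>0. \<forall>\<delta>>0. \<forall>(I :: 'i set) B1 K1 B2 K2. finite I \<longrightarrow> 0 < K1 \<longrightarrow> 0 < K2 \<longrightarrow>
    (\<exists>enc dec1 dec2. (\<Sum>a\<in>I. \<Sum>b1<B1. \<Sum>b2<B2. expect (nQ N (enc a b1 b2)) (\<lambda>o'.
        of_bool (\<not> (dec1 (fst o') = (a, b1) \<and> dec2 (snd o') = (a, b2)))))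
      \<le> real (card I) * B1 * B2 * block_error C \<Gamma> N \<delta> (card I) B1 K1 B2 K2))"
proof -
  obtain C \<Gamma> where C: "0 \<le> C" "0 \<le> \<Gamma>" and ty: "\<forall>N>0. \<forall>\<delta>>0. 1 - C / (\<delta>\<^sup>2 * real N) \<le>
    expect (nW N) (\<lambda>w. expect (nU N w) (\<lambda>u. expect (nV N w) (\<lambda>v.
        nG N w u v * (of_bool (nG N w u v \<le> \<Gamma> * 2 powr (real N * (expect M hUV + \<delta>)))
          * expect (nK N w u v) (\<lambda>x. expect (nQ N x) (\<lambda>o'.
          of_bool (nD1 N (thr N \<delta> hUW) (thr N \<delta> hU) w u (fst o')
             \<and> nD2 N (thr N \<delta> hVW) (thr N \<delta> hV) w v (snd o'))))))))"
    using typical_bound by (elim exE conjE) (rule that)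
  have thr: "0 < thr N \<delta> h" for N \<delta> h by (simp add: thr_def)
  have "\<exists>enc dec1 dec2. (\<Sum>a\<in>I. \<Sum>b1<B1. \<Sum>b2<B2. expect (nQ N (enc a b1 b2)) (\<lambda>o'.
        of_bool (\<not> (dec1 (fst o') = (a, b1) \<and> dec2 (snd o') = (a, b2)))))
      \<le> real (card I) * B1 * B2 * block_error C \<Gamma> N \<delta> (card I) B1 K1 B2 K2"
    if "0 < N" "0 < \<delta>" "finite I" "0 < K1" "0 < K2" for N \<delta> and I :: "'i set" and B1 K1 B2 K2
  proof -
    interpret m: marton_code "nW N" "nU N" "nV N" "nG N" "nK N" "nQ N"
      "nD1 N (thr N \<delta> hUW) (thr N \<delta> hU)" "nD2 N (thr N \<delta> hVW) (thr N \<delta> hV)" I B1 K1 B2 K2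
      "\<Gamma> * 2 powr (real N * (expect M hUV + \<delta>))" "C / (\<delta>\<^sup>2 * real N)"
      "1 / thr N \<delta> hUW" "1 / thr N \<delta> hU" "1 / thr N \<delta> hVW" "1 / thr N \<delta> hV"
    proof
      show "0 \<le> nG N w u v" for w u v unfolding nG_def by (intro prod_nonneg) (auto simp: i_nonneg)
      show "0 \<le> C / (\<delta>\<^sup>2 * real N)" "0 \<le> \<Gamma> * 2 powr (real N * (expect M hUV + \<delta>))" using C by auto
    qed (rule fin_n that nG_u nG_v nletter_other_1[OF thr] nletter_same_1[OF thr] nletter_other_2[OF thr]
        nletter_same_2[OF thr] ty[rule_format, OF that(1,2)])+
    show ?thesis using m.exists_code unfolding m.\<delta>_def block_error_def .
  qed
  then show ?thesis using C by (intro exI[of _ C] exI[of _ \<Gamma>] conjI allI impI)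
qed

end

text \<open>Passage from lists to functions on the naturals. Outside \<open>{..<n}\<close> a random
  output pair is \<open>undefined\<close>, so lists are extended by the components of that same pair
  and the arguments of \<open>F\<close> agree exactly.\<close>

lemma sum_channel_prob:
  fixes qp :: "'x \<Rightarrow> ('y::finite \<times> 'z::finite) pmf" and x :: "nat \<Rightarrow> 'x"
  shows "(\<Sum>ys\<in>{ys. length ys = n}. \<Sum>zs\<in>{zs. length zs = n}.
      channel_prob (\<lambda>x y z. pmf (qp x) (y, z)) n (map x [0..<n]) ys zs *
      F (\<lambda>i. if i < n then ys ! i else fst (undefined :: 'y \<times> 'z)) (\<lambda>i. if i < n then zs ! i else snd (undefined :: 'y \<times> 'z)))
    = expect (Pi_pmf {..<n} undefined (\<lambda>i. qp (x i))) (\<lambda>o'. F (\<lambda>i. fst (o' i)) (\<lambda>i. snd (o' i)))"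
proof -
  let ?A = "PiE_dflt {..<n} undefined (\<lambda>_. UNIV) :: (nat \<Rightarrow> 'y \<times> 'z) set"
  let ?L = "{ys :: 'y list. length ys = n} \<times> {zs :: 'z list. length zs = n}"
  let ?P = "Pi_pmf {..<n} undefined (\<lambda>i. qp (x i))"
  have A: "o' \<in> ?A \<longleftrightarrow> (\<forall>i\<ge>n. o' i = undefined)" for o'
    by (auto simp: PiE_dflt_def)
  have "expect ?P (\<lambda>o'. F (\<lambda>i. fst (o' i)) (\<lambda>i. snd (o' i)))
    = (\<Sum>o'\<in>?A. pmf ?P o' * F (\<lambda>i. fst (o' i)) (\<lambda>i. snd (o' i)))"
  proof (rule expect_superset)
    show "finite ?A" by (intro finite_PiE_dflt) auto
    show "set_pmf ?P \<subseteq> ?A" by (auto simp: set_Pi_pmf PiE_dflt_def)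
  qed
  also have "\<dots> = (\<Sum>l\<in>?L. channel_prob (\<lambda>x y z. pmf (qp x) (y, z)) n (map x [0..<n]) (fst l) (snd l) *
      F (\<lambda>i. if i < n then fst l ! i else fst (undefined :: 'y \<times> 'z)) (\<lambda>i. if i < n then snd l ! i else snd (undefined :: 'y \<times> 'z)))"
  proof (rule sum.reindex_bij_witness[where
        j="\<lambda>o'. (map (\<lambda>i. fst (o' i)) [0..<n], map (\<lambda>i. snd (o' i)) [0..<n])" and
        i="\<lambda>l i. if i < n then (fst l ! i, snd l ! i) else undefined"])
    fix o' assume o': "o' \<in> ?A"
    then have f: "(\<lambda>i. if i < n then map (\<lambda>i. fst (o' i)) [0..<n] ! i else fst (undefined :: 'y \<times> 'z)) = (\<lambda>i. fst (o' i))"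
      "(\<lambda>i. if i < n then map (\<lambda>i. snd (o' i)) [0..<n] ! i else snd (undefined :: 'y \<times> 'z)) = (\<lambda>i. snd (o' i))"
      by (intro ext; simp add: A)+
    have "pmf ?P o' = (\<Prod>i<n. pmf (qp (x i)) (o' i))"
      using o' by (intro pmf_Pi') (auto simp: A)
    then have "pmf ?P o' = channel_prob (\<lambda>x y z. pmf (qp x) (y, z)) n (map x [0..<n])
      (map (\<lambda>i. fst (o' i)) [0..<n]) (map (\<lambda>i. snd (o' i)) [0..<n])"
      by (simp add: channel_prob_def)
    then show "channel_prob (\<lambda>x y z. pmf (qp x) (y, z)) n (map x [0..<n])
      (fst (map (\<lambda>i. fst (o' i)) [0..<n], map (\<lambda>i. snd (o' i)) [0..<n])) (snd (map (\<lambda>i. fst (o' i)) [0..<n], map (\<lambda>i. snd (o' i)) [0..<n])) *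
      F (\<lambda>i. if i < n then fst (map (\<lambda>i. fst (o' i)) [0..<n], map (\<lambda>i. snd (o' i)) [0..<n]) ! i else fst (undefined :: 'y \<times> 'z))
        (\<lambda>i. if i < n then snd (map (\<lambda>i. fst (o' i)) [0..<n], map (\<lambda>i. snd (o' i)) [0..<n]) ! i else snd (undefined :: 'y \<times> 'z))
      = pmf ?P o' * F (\<lambda>i. fst (o' i)) (\<lambda>i. snd (o' i))"
      unfolding fst_conv snd_conv f by simp
  next
    fix o' assume "o' \<in> ?A"
    then show "(\<lambda>i. if i < n then (fst (map (\<lambda>i. fst (o' i)) [0..<n], map (\<lambda>i. snd (o' i)) [0..<n]) ! i,
        snd (map (\<lambda>i. fst (o' i)) [0..<n], map (\<lambda>i. snd (o' i)) [0..<n]) ! i) else undefined) = o'"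
      by (intro ext) (simp add: A)
  next
    fix l assume "l \<in> ?L"
    then show "(map (\<lambda>i. fst (if i < n then (fst l ! i, snd l ! i) else undefined)) [0..<n],
        map (\<lambda>i. snd (if i < n then (fst l ! i, snd l ! i) else undefined)) [0..<n]) = l"
      by (cases l) (auto intro!: nth_equalityI)
  qed (auto simp: A)
  also have "\<dots> = (\<Sum>ys\<in>{ys. length ys = n}. \<Sum>zs\<in>{zs. length zs = n}.
      channel_prob (\<lambda>x y z. pmf (qp x) (y, z)) n (map x [0..<n]) ys zs *
      F (\<lambda>i. if i < n then ys ! i else fst (undefined :: 'y \<times> 'z)) (\<lambda>i. if i < n then zs ! i else snd (undefined :: 'y \<times> 'z)))"
    by (simp add: sum.cartesian_product split_def)
  finally show ?thesis ..
qed

text \<open>For splitting a private message into its cloud part and its bin number.\<close>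

lemma sum_div_mod:
  fixes g :: "nat \<Rightarrow> nat \<Rightarrow> real"
  assumes "0 < B"
  shows "(\<Sum>m<A * B. g (m div B) (m mod B)) = (\<Sum>a<A. \<Sum>b<B. g a b)"
proof -
  have "a * B + b < A * B" if "a < A" "b < B" for a b
    using mult_le_mono1[of "Suc a" A B] that by simp
  then have "(\<Sum>m<A * B. g (m div B) (m mod B)) = (\<Sum>(a, b)\<in>{..<A} \<times> {..<B}. g a b)"
    using assms
    by (intro sum.reindex_bij_witness[where i="\<lambda>(a, b). a * B + b" and j="\<lambda>m. (m div B, m mod B)"])
       (auto simp: less_mult_imp_div_less)
  then show ?thesis by (simp add: sum.cartesian_product)
qed

section \<open>Sizes of message sets and exponents\<close>

definition msg_size :: "real \<Rightarrow> nat \<Rightarrow> nat" where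
  "msg_size R n = nat \<lceil>2 powr (real n * R)\<rceil>"

lemma msg_size_ge: "2 powr (real n * R) \<le> real (msg_size R n)"
  unfolding msg_size_def by linarith

lemma msg_size_pos: "0 < msg_size R n"
  using msg_size_ge[of n R] powr_gt_zero[of 2 "real n * R"] by (cases "msg_size R n") auto

text \<open>Rate 0 means a single bin, so that the number of wrong bins is 0.\<close>

lemma msg_size_0: "msg_size 0 n = 1"
  by (simp add: msg_size_def)

text \<open>Rounding up at most doubles a number that is at least 1, and passing from
  \<open>Suc N\<close> to \<open>N\<close> costs \<open>2 powr R\<close>.\<close>

lemma msg_size_Suc_le:
  assumes "0 \<le> R" shows "real (msg_size R (Suc N)) \<le> 2 powr (1 + R) * 2 powr (real N * R)"
proof -
  have "1 \<le> 2 powr (real (Suc N) * R)" using assms by (intro ge_one_powr_ge_zero) auto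
  moreover have "real (msg_size R (Suc N)) \<le> 2 powr (real (Suc N) * R) + 1"
    unfolding msg_size_def by (simp add: of_nat_nat)
  ultimately have "real (msg_size R (Suc N)) \<le> 2 * 2 powr (real (Suc N) * R)" by linarith
  also have "\<dots> = 2 powr (1 + R) * 2 powr (real N * R)"
    by (simp add: powr_add[symmetric] powr_mult_base algebra_simps)
  finally show ?thesis .
qed


lemma powr_bound_mult:
  fixes X Y :: real
  assumes "X \<le> c * 2 powr (real N * r)" "Y \<le> d * 2 powr (real N * s)" "0 \<le> X" "0 \<le> Y"
  shows "X * Y \<le> (c * d) * 2 powr (real N * (r + s))"
proof -
  have "X * Y \<le> (c * 2 powr (real N * r)) * (d * 2 powr (real N * s))"
    using assms by (intro mult_mono) auto
  also have "\<dots> = (c * d) * 2 powr (real N * (r + s))"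
    by (simp add: powr_add distrib_left mult_ac)
  finally show ?thesis .
qed

text \<open>The rate lies \<open>2 * \<delta>\<close> below the information and the threshold gives
  up one \<open>\<delta>\<close>; the other is the surviving exponent.\<close>

lemma powr_bound_divide:
  fixes X :: real
  assumes "X \<le> c * 2 powr (real N * r)" "0 \<le> c" "r + 2 * \<delta> \<le> i"
  shows "X * (1 / 2 powr (real N * (i - \<delta>))) \<le> c * 2 powr (- (real N * \<delta>))"
proof -
  have "X * (1 / 2 powr (real N * (i - \<delta>))) \<le> (c * 2 powr (real N * r)) * (1 / 2 powr (real N * (i - \<delta>)))"
    using assms by (intro mult_right_mono) auto
  also have "\<dots> = c * 2 powr (real N * r - real N * (i - \<delta>))" by (simp add: powr_diff)
  also have "real N * r - real N * (i - \<delta>) = real N * (r - i + \<delta>)" by (simp add: algebra_simps)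
  also have "c * 2 powr (real N * (r - i + \<delta>)) \<le> c * 2 powr (- (real N * \<delta>))"
  proof (intro mult_left_mono powr_mono)
    have "real N * (r - i + \<delta>) \<le> real N * (- \<delta>)" using assms by (intro mult_left_mono) auto
    then show "real N * (r - i + \<delta>) \<le> - (real N * \<delta>)" by simp
  qed (use assms in auto)
  finally show ?thesis .
qed

lemma error_exponent_tendsto_0:
  assumes "0 < \<delta>"
  shows "(\<lambda>N. C / (\<delta>\<^sup>2 * real N) + c * 2 powr (- (real N * \<delta>))) \<longlonglongrightarrow> 0"
proof -
  have "(\<lambda>N. C / \<delta>\<^sup>2 * inverse (real N)) \<longlonglongrightarrow> C / \<delta>\<^sup>2 * 0"
    by (intro tendsto_intros lim_inverse_n)
  moreover have "(\<lambda>N. c * (2 powr (- \<delta>)) ^ N) \<longlonglongrightarrow> c * 0"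
    using assms by (intro tendsto_intros LIMSEQ_realpow_zero) (auto simp: powr_less_one)
  ultimately have "(\<lambda>N. C / \<delta>\<^sup>2 * inverse (real N) + c * (2 powr (- \<delta>)) ^ N) \<longlonglongrightarrow> 0 + 0"
    by (intro tendsto_add) simp_all
  moreover have "(2 powr (- \<delta>)) ^ N = 2 powr (- (real N * \<delta>))" for N
    by (simp add: powr_realpow[symmetric] powr_powr mult.commute)
  ultimately show ?thesis by (simp add: field_simps)
qed

context sliding_code
begin

text \<open>A cloud index \<open>(m0, a1, a2)\<close> consists of the common message and the cloud
  parts of both private messages; \<open>m1\<close> and \<open>m2\<close> are recombined from cloud
  part and bin number.\<close>

lemma avg_error_block_code:
  fixes enc :: "nat \<times> nat \<times> nat \<Rightarrow> nat \<Rightarrow> nat \<Rightarrow> nat \<Rightarrow> 'x"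
  assumes pos: "0 < M0" "0 < A1" "0 < A2" "0 < B1" "0 < B2"
  defines "I \<equiv> {..<M0} \<times> {..<A1} \<times> {..<A2}"
  assumes code: "(\<Sum>a\<in>I. \<Sum>b1<B1. \<Sum>b2<B2. expect (nQ N (enc a b1 b2)) (\<lambda>o'.
        of_bool (\<not> (dec1 (fst o') = (a, b1) \<and> dec2 (snd o') = (a, b2)))))
      \<le> real (card I) * B1 * B2 * \<Delta>"
  shows "\<exists>enc' dec1' dec2'. (\<forall>m0<M0. \<forall>m1<A1 * B1. \<forall>m2<A2 * B2. length (enc' m0 m1 m2) = Suc N) \<and>
    avg_error (\<lambda>x y z. pmf (qp x) (y, z)) (Suc N) M0 (A1 * B1) (A2 * B2) enc' dec1' dec2' \<le> \<Delta>"
proof -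
  let ?n = "Suc N" and ?q = "\<lambda>x y z. pmf (qp x) (y, z)"
  let ?y = "\<lambda>ys i. if i < ?n then ys ! i else fst (undefined :: 'y \<times> 'z)"
  let ?z = "\<lambda>zs i. if i < ?n then zs ! i else snd (undefined :: 'y \<times> 'z)"
  define f where "f a b1 b2 = expect (nQ N (enc a b1 b2)) (\<lambda>o'.
        of_bool (\<not> (dec1 (fst o') = (a, b1) \<and> dec2 (snd o') = (a, b2))))" for a b1 b2
  define enc' where "enc' m0 m1 m2 = map (enc (m0, m1 div B1, m2 div B2) (m1 mod B1) (m2 mod B2)) [0..<?n]" for m0 m1 m2
  define dec1' where "dec1' ys = (case dec1 (?y ys) of ((m0, a1, a2), b1) \<Rightarrow> (m0, a1 * B1 + b1))" for ys :: "'y list"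
  define dec2' where "dec2' zs = (case dec2 (?z zs) of ((m0, a1, a2), b2) \<Rightarrow> (m0, a2 * B2 + b2))" for zs :: "'z list"
  have one: "(\<Sum>ys\<in>{ys. length ys = ?n}. \<Sum>zs\<in>{zs. length zs = ?n}. channel_prob ?q ?n (enc' m0 m1 m2) ys zs *
          (if dec1' ys = (m0, m1) \<and> dec2' zs = (m0, m2) then 0 else 1))
      \<le> f (m0, m1 div B1, m2 div B2) (m1 mod B1) (m2 mod B2)" for m0 m1 m2
  proof -
    let ?a = "(m0, m1 div B1, m2 div B2)" and ?b1 = "m1 mod B1" and ?b2 = "m2 mod B2"
    let ?F = "\<lambda>y z. of_bool (\<not> (dec1 y = (?a, ?b1) \<and> dec2 z = (?a, ?b2))) :: real"
    have "(\<Sum>ys\<in>{ys. length ys = ?n}. \<Sum>zs\<in>{zs. length zs = ?n}. channel_prob ?q ?n (enc' m0 m1 m2) ys zs *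
          (if dec1' ys = (m0, m1) \<and> dec2' zs = (m0, m2) then 0 else 1))
      \<le> (\<Sum>ys\<in>{ys. length ys = ?n}. \<Sum>zs\<in>{zs. length zs = ?n}. channel_prob ?q ?n (enc' m0 m1 m2) ys zs *
          ?F (?y ys) (?z zs))"
    \<comment> \<open>A block decoder recovers the whole cloud index, including the part of the
      other receiver. An error of the broadcast code therefore implies a block error, but not
      conversely.\<close>
    proof (intro sum_mono mult_left_mono)
      fix ys zs
      have "dec1' ys = (m0, m1)" if "dec1 (?y ys) = (?a, ?b1)"
        unfolding dec1'_def that by simp
      moreover have "dec2' zs = (m0, m2)" if "dec2 (?z zs) = (?a, ?b2)"
        unfolding dec2'_def that by simp
      ultimately show "(if dec1' ys = (m0, m1) \<and> dec2' zs = (m0, m2) then 0 else 1) \<le> ?F (?y ys) (?z zs)"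
        by auto
      show "0 \<le> channel_prob ?q ?n (enc' m0 m1 m2) ys zs"
        unfolding channel_prob_def by (intro prod_nonneg) auto
    qed
    also have "\<dots> = expect (Pi_pmf {..<?n} undefined (\<lambda>i. qp (enc ?a ?b1 ?b2 i))) (\<lambda>o'. ?F (\<lambda>i. fst (o' i)) (\<lambda>i. snd (o' i)))"
      unfolding enc'_def by (rule sum_channel_prob)
    also have "\<dots> = f ?a ?b1 ?b2"
      unfolding f_def nQ_def by (subst expect_map) (auto intro!: finite_set_Pi_pmf)
    finally show ?thesis .
  qed
  have "(\<Sum>m0<M0. \<Sum>m1<A1 * B1. \<Sum>m2<A2 * B2. f (m0, m1 div B1, m2 div B2) (m1 mod B1) (m2 mod B2))
    = (\<Sum>m0<M0. \<Sum>m1<A1 * B1. \<Sum>a2<A2. \<Sum>b2<B2. f (m0, m1 div B1, a2) (m1 mod B1) b2)"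
    using sum_div_mod[OF pos(5), where g="\<lambda>a2 b2. f (_, _ div B1, a2) (_ mod B1) b2"] by simp
  also have "\<dots> = (\<Sum>m0<M0. \<Sum>a1<A1. \<Sum>b1<B1. \<Sum>a2<A2. \<Sum>b2<B2. f (m0, a1, a2) b1 b2)"
    using sum_div_mod[OF pos(4), where g="\<lambda>a1 b1. \<Sum>a2<A2. \<Sum>b2<B2. f (_, a1, a2) b1 b2"] by simp
  also have "\<dots> = (\<Sum>m0<M0. \<Sum>a1<A1. \<Sum>a2<A2. \<Sum>b1<B1. \<Sum>b2<B2. f (m0, a1, a2) b1 b2)"
    by (intro sum.cong refl sum.swap)
  also have "\<dots> = (\<Sum>a\<in>I. \<Sum>b1<B1. \<Sum>b2<B2. f a b1 b2)"
  proof -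
    have "(\<Sum>m0<M0. \<Sum>a1<A1. \<Sum>a2<A2. h (m0, a1, a2)) = (\<Sum>a\<in>I. h a)" for h :: "_ \<Rightarrow> real"
      unfolding I_def by (simp add: sum.cartesian_product)
    then show ?thesis .
  qed
  also have "\<dots> \<le> real (card I) * B1 * B2 * \<Delta>" using code unfolding f_def .
  finally have total: "(\<Sum>m0<M0. \<Sum>m1<A1 * B1. \<Sum>m2<A2 * B2. f (m0, m1 div B1, m2 div B2) (m1 mod B1) (m2 mod B2))
    \<le> real (card I) * B1 * B2 * \<Delta>" .
  have card: "real M0 * real (A1 * B1) * real (A2 * B2) = real (card I) * B1 * B2"
    by (simp add: I_def card_cartesian_product)
  have cpos: "0 < real (card I) * B1 * B2" using pos by (simp add: I_def card_cartesian_product)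
  have "avg_error ?q ?n M0 (A1 * B1) (A2 * B2) enc' dec1' dec2'
    \<le> (1 / (real (card I) * B1 * B2)) * (\<Sum>m0<M0. \<Sum>m1<A1 * B1. \<Sum>m2<A2 * B2.
      f (m0, m1 div B1, m2 div B2) (m1 mod B1) (m2 mod B2))"
    unfolding avg_error_def card using cpos by (intro mult_left_mono sum_mono one) auto
  also have "\<dots> \<le> (1 / (real (card I) * B1 * B2)) * (real (card I) * B1 * B2 * \<Delta>)"
    using cpos by (intro mult_left_mono total) auto
  also have "\<dots> = \<Delta>"
  proof -
    have "1 / c * (c * \<Delta>) = \<Delta>" if "0 < c" for c using that by simp
    from this[OF cpos] show ?thesis .
  qed
  finally show ?thesis
    by (intro exI[of _ enc'] exI[of _ dec1'] exI[of _ dec2'] conjI) (auto simp: enc'_def)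
qed

text \<open>Of the slack \<open>2 * \<delta>\<close> in each rate condition, \<open>\<delta>\<close>
  pays for a threshold or for the cap on the weights; the rest is the exponent of that term.\<close>

lemma block_error_le:
  assumes nn: "0 \<le> R0" "0 \<le> p" "0 \<le> s" "p \<le> R1" "s \<le> R2" "0 \<le> a" "0 \<le> b" "0 \<le> \<Gamma>"
    and slack: "expect M hUV + 2 * \<delta> \<le> a + b"
      "R0 + R1 + s + a + 2 * \<delta> \<le> expect M hUW" "R0 + R2 + p + b + 2 * \<delta> \<le> expect M hVW"
      "p = R1 \<or> R1 - p + a + 2 * \<delta> \<le> expect M hU" "s = R2 \<or> R2 - s + b + 2 * \<delta> \<le> expect M hV"
  shows "\<exists>c. \<forall>N. block_error C \<Gamma> N \<delta> (msg_size R0 (Suc N) * (msg_size p (Suc N) * msg_size s (Suc N)))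
      (msg_size (R1 - p) (Suc N)) (msg_size a (Suc N)) (msg_size (R2 - s) (Suc N)) (msg_size b (Suc N))
    \<le> C / (\<delta>\<^sup>2 * real N) + c * 2 powr (- (real N * \<delta>))"
proof -
  define S where "S r N = real (msg_size r (Suc N))" for r N
  define k where "k r = (2 :: real) powr (1 + r)" for r
  have S: "S r N \<le> k r * 2 powr (real N * r)" if "0 \<le> r" for r N
    unfolding S_def k_def using that by (rule msg_size_Suc_le)
  have S0: "0 \<le> S r N" for r N by (simp add: S_def)
  have k0: "0 \<le> k r" for r by (simp add: k_def)
  define cA where "cA = k R0 * (k p * k s)"
  define c1 where "c1 = cA * k (R1 - p) * k a"
  define c2 where "c2 = cA * k (R2 - s) * k b"
  have A: "S R0 N * (S p N * S s N) \<le> cA * 2 powr (real N * (R0 + (p + s)))" for N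
    unfolding cA_def using nn by (intro powr_bound_mult S mult_nonneg_nonneg S0)
  have t1: "(S R0 N * (S p N * S s N)) * S (R1 - p) N * S a N * (1 / thr N \<delta> hUW) \<le> c1 * 2 powr (- (real N * \<delta>))" for N
  proof -
    have "(S R0 N * (S p N * S s N)) * S (R1 - p) N * S a N \<le> c1 * 2 powr (real N * (R0 + (p + s) + (R1 - p) + a))"
      unfolding c1_def by (rule powr_bound_mult[OF powr_bound_mult[OF A S] S]) (use nn S0 in auto)
    then show ?thesis unfolding thr_def
      by (rule powr_bound_divide) (use slack k0 in \<open>auto simp: c1_def cA_def\<close>)
  qed
  have t2: "(S R0 N * (S p N * S s N)) * S (R2 - s) N * S b N * (1 / thr N \<delta> hVW) \<le> c2 * 2 powr (- (real N * \<delta>))" for N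
  proof -
    have "(S R0 N * (S p N * S s N)) * S (R2 - s) N * S b N \<le> c2 * 2 powr (real N * (R0 + (p + s) + (R2 - s) + b))"
      unfolding c2_def by (rule powr_bound_mult[OF powr_bound_mult[OF A S] S]) (use nn S0 in auto)
    then show ?thesis unfolding thr_def
      by (rule powr_bound_divide) (use slack k0 in \<open>auto simp: c2_def cA_def\<close>)
  qed
  \<comment> \<open>For \<open>r = 0\<close> there is a single bin and the left side is 0, with no
    condition on \<open>h\<close>.\<close>
  have u: "real (msg_size r (Suc N) - 1) * S t N * (1 / thr N \<delta> h) \<le> k r * k t * 2 powr (- (real N * \<delta>))"
    if "0 \<le> r" "0 \<le> t" "r = 0 \<or> r + t + 2 * \<delta> \<le> expect M h" for r t h N
  proof (cases "r = 0")
    case True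
    then show ?thesis by (simp add: msg_size_0 k_def)
  next
    case False
    have "real (msg_size r (Suc N) - 1) * S t N * (1 / thr N \<delta> h) \<le> S r N * S t N * (1 / thr N \<delta> h)"
      unfolding S_def thr_def by (intro mult_right_mono) auto
    also have "\<dots> \<le> k r * k t * 2 powr (- (real N * \<delta>))"
      unfolding thr_def
      by (rule powr_bound_divide[OF powr_bound_mult[OF S S]]) (use that False k0 S0 in auto)
    finally show ?thesis .
  qed
  \<comment> \<open>\<open>K1 * K2\<close> is at least \<open>2 powr (real N * (a + b))\<close>,
    which exceeds \<open>2 powr (real N * (expect M hUV + \<delta>))\<close> by a factor of at least
    \<open>2 powr (real N * \<delta>)\<close>.\<close>
  have g: "\<Gamma> * 2 powr (real N * (expect M hUV + \<delta>)) / (S a N * S b N) \<le> \<Gamma> * 2 powr (- (real N * \<delta>))" for N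
  proof -
    have ge: "2 powr (real N * r) \<le> S r N" if "0 \<le> r" for r
    proof -
      have "2 powr (real N * r) \<le> 2 powr (real (Suc N) * r)" using that by (intro powr_mono) (auto intro: mult_right_mono)
      then show ?thesis unfolding S_def using msg_size_ge[of "Suc N" r] by linarith
    qed
    have "2 powr (real N * (a + b)) = 2 powr (real N * a) * 2 powr (real N * b)"
      by (simp add: distrib_left powr_add)
    also have "\<dots> \<le> S a N * S b N" using nn by (intro mult_mono ge S0) auto
    finally have "\<Gamma> * 2 powr (real N * (expect M hUV + \<delta>)) / (S a N * S b N)
      \<le> \<Gamma> * 2 powr (real N * (expect M hUV + \<delta>)) / 2 powr (real N * (a + b))"
      using nn by (intro divide_left_mono mult_pos_pos) (auto simp: S_def msg_size_pos)
    also have "\<dots> = \<Gamma> * 2 powr (real N * (expect M hUV + \<delta>) - real N * (a + b))" by (simp add: powr_diff)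
    also have "\<dots> \<le> \<Gamma> * 2 powr (- (real N * \<delta>))"
    proof (intro mult_left_mono powr_mono)
      have "real N * (expect M hUV + \<delta> - (a + b)) \<le> real N * (- \<delta>)" using slack by (intro mult_left_mono) auto
      then show "real N * (expect M hUV + \<delta>) - real N * (a + b) \<le> - (real N * \<delta>)" by (simp add: algebra_simps)
    qed (use nn in auto)
    finally show ?thesis .
  qed
  show ?thesis
  proof (intro exI allI)
    fix N
    show "block_error C \<Gamma> N \<delta> (msg_size R0 (Suc N) * (msg_size p (Suc N) * msg_size s (Suc N)))
      (msg_size (R1 - p) (Suc N)) (msg_size a (Suc N)) (msg_size (R2 - s) (Suc N)) (msg_size b (Suc N))
    \<le> C / (\<delta>\<^sup>2 * real N) + (\<Gamma> + c1 + k (R1 - p) * k a + c2 + k (R2 - s) * k b) * 2 powr (- (real N * \<delta>))"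
      using g[of N] t1[of N] t2[of N] u[of "R1 - p" a hU N] u[of "R2 - s" b hV N] nn slack(4,5)
      unfolding block_error_def S_def distrib_right of_nat_mult by auto
  qed
qed

lemma achievable_rates:
  assumes R: "0 \<le> R0" "0 \<le> R1" "0 \<le> R2"
    and nn: "0 \<le> expect M hU" "0 \<le> expect M hV" "0 \<le> expect M hUV"
    and c: "R0 + R1 < expect M hUW" "R0 + R2 < expect M hVW"
      "R0 + R1 + R2 < expect M hV + expect M hUW - expect M hUV"
      "R0 + R1 + R2 < expect M hU + expect M hVW - expect M hUV"
      "2 * R0 + R1 + R2 < expect M hUW + expect M hVW - expect M hUV"
  shows "achievable (\<lambda>x y z. pmf (qp x) (y, z)) R0 R1 R2"
proof -
  obtain p s a b \<delta> where ps: "0 \<le> p" "p \<le> R1" "0 \<le> s" "s \<le> R2" "0 \<le> a" "0 \<le> b" "0 < \<delta>"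
    and slack: "expect M hUV + 2 * \<delta> \<le> a + b"
      "R0 + R1 + s + a + 2 * \<delta> \<le> expect M hUW" "R0 + R2 + p + b + 2 * \<delta> \<le> expect M hVW"
      "p = R1 \<or> R1 - p + a + 2 * \<delta> \<le> expect M hU" "s = R2 \<or> R2 - s + b + 2 * \<delta> \<le> expect M hV"
    using rate_split[OF R nn c] by metis
  obtain C \<Gamma> where C: "0 \<le> C" "0 \<le> \<Gamma>" and code: "\<forall>N>0. \<forall>\<delta>>0. \<forall>(I :: (nat \<times> nat \<times> nat) set) B1 K1 B2 K2.
    finite I \<longrightarrow> 0 < K1 \<longrightarrow> 0 < K2 \<longrightarrow>
    (\<exists>enc dec1 dec2. (\<Sum>a\<in>I. \<Sum>b1<B1. \<Sum>b2<B2. expect (nQ N (enc a b1 b2)) (\<lambda>o'.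
        of_bool (\<not> (dec1 (fst o') = (a, b1) \<and> dec2 (snd o') = (a, b2)))))
      \<le> real (card I) * B1 * B2 * block_error C \<Gamma> N \<delta> (card I) B1 K1 B2 K2)"
    using exists_block_code by (elim exE conjE) (rule that)
  let ?S = "\<lambda>r N. msg_size r (Suc N)"
  obtain c' where c': "\<forall>N. block_error C \<Gamma> N \<delta> (?S R0 N * (?S p N * ?S s N))
      (?S (R1 - p) N) (?S a N) (?S (R2 - s) N) (?S b N) \<le> C / (\<delta>\<^sup>2 * real N) + c' * 2 powr (- (real N * \<delta>))"
    using block_error_le[OF R(1) ps(1,3,2,4,5,6) C(2) slack] by blast
  show ?thesis unfolding achievable_def
  proof (intro allI impI)
    fix \<epsilon> :: real assume "0 < \<epsilon>"
    then obtain N0 where N0: "\<And>N. N0 \<le> N \<Longrightarrow> C / (\<delta>\<^sup>2 * real N) + c' * 2 powr (- (real N * \<delta>)) < \<epsilon>"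
      using order_tendstoD(2)[OF error_exponent_tendsto_0[OF ps(7), of C c']]
      by (auto simp: eventually_sequentially)
    show "\<exists>N. \<forall>n\<ge>N. \<exists>M0 M1 M2 enc dec1 dec2. 2 powr (real n * R0) \<le> real M0 \<and>
      2 powr (real n * R1) \<le> real M1 \<and> 2 powr (real n * R2) \<le> real M2 \<and>
      (\<forall>m0<M0. \<forall>m1<M1. \<forall>m2<M2. length (enc m0 m1 m2) = n) \<and>
      avg_error (\<lambda>x y z. pmf (qp x) (y, z)) n M0 M1 M2 enc dec1 dec2 \<le> \<epsilon>"
    \<comment> \<open>Block length \<open>n\<close> corresponds to \<open>N = n - 1\<close> windows;
      starting at \<open>Suc (Suc N0)\<close> ensures both \<open>0 < N\<close> and
      \<open>N0 \<le> N\<close>.\<close>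
    proof (rule exI[of _ "Suc (Suc N0)"], intro allI impI)
      fix n assume "Suc (Suc N0) \<le> n"
      then obtain N where n: "n = Suc N" and N: "0 < N" "N0 \<le> N" by (cases n) auto
      let ?I = "{..<?S R0 N} \<times> {..<?S p N} \<times> {..<?S s N}"
      have card: "card ?I = ?S R0 N * (?S p N * ?S s N)" by (simp add: card_cartesian_product)
      obtain enc dec1 dec2 where "(\<Sum>a\<in>?I. \<Sum>b1<?S (R1 - p) N. \<Sum>b2<?S (R2 - s) N. expect (nQ N (enc a b1 b2)) (\<lambda>o'.
        of_bool (\<not> (dec1 (fst o') = (a, b1) \<and> dec2 (snd o') = (a, b2)))))
        \<le> real (card ?I) * ?S (R1 - p) N * ?S (R2 - s) N
          * block_error C \<Gamma> N \<delta> (card ?I) (?S (R1 - p) N) (?S a N) (?S (R2 - s) N) (?S b N)"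
        using code[rule_format, OF N(1) ps(7) _ msg_size_pos msg_size_pos, of ?I] by blast
      from avg_error_block_code[OF msg_size_pos msg_size_pos msg_size_pos msg_size_pos msg_size_pos this]
      obtain enc' dec1' dec2' where e:
        "\<forall>m0<?S R0 N. \<forall>m1<?S p N * ?S (R1 - p) N. \<forall>m2<?S s N * ?S (R2 - s) N. length (enc' m0 m1 m2) = Suc N"
        "avg_error (\<lambda>x y z. pmf (qp x) (y, z)) (Suc N) (?S R0 N) (?S p N * ?S (R1 - p) N) (?S s N * ?S (R2 - s) N) enc' dec1' dec2'
          \<le> block_error C \<Gamma> N \<delta> (card ?I) (?S (R1 - p) N) (?S a N) (?S (R2 - s) N) (?S b N)"
        by blast
      have size: "2 powr (real n * (r + t)) \<le> real (?S r N * ?S t N)" for r t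
      proof -
        have "2 powr (real n * (r + t)) = 2 powr (real n * r) * 2 powr (real n * t)"
          by (simp add: distrib_left powr_add)
        also have "\<dots> \<le> real (?S r N) * real (?S t N)" unfolding n by (intro mult_mono msg_size_ge) auto
        finally show ?thesis by simp
      qed
      have "block_error C \<Gamma> N \<delta> (card ?I) (?S (R1 - p) N) (?S a N) (?S (R2 - s) N) (?S b N) \<le> \<epsilon>"
        unfolding card using c'[rule_format, of N] N0[OF N(2)] by linarith
      then have err: "avg_error (\<lambda>x y z. pmf (qp x) (y, z)) n (?S R0 N) (?S p N * ?S (R1 - p) N) (?S s N * ?S (R2 - s) N)
        enc' dec1' dec2' \<le> \<epsilon>" using e(2) unfolding n by linarith
      have len: "\<forall>m0<?S R0 N. \<forall>m1<?S p N * ?S (R1 - p) N. \<forall>m2<?S s N * ?S (R2 - s) N. length (enc' m0 m1 m2) = n"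
        unfolding n by (rule e(1))
      have R0: "2 powr (real n * R0) \<le> real (?S R0 N)" unfolding n by (rule msg_size_ge)
      have R1: "2 powr (real n * R1) \<le> real (?S p N * ?S (R1 - p) N)"
        and R2: "2 powr (real n * R2) \<le> real (?S s N * ?S (R2 - s) N)"
        using size[of p "R1 - p"] size[of s "R2 - s"] by simp_all
      show "\<exists>M0 M1 M2 enc dec1 dec2. 2 powr (real n * R0) \<le> real M0 \<and>
        2 powr (real n * R1) \<le> real M1 \<and> 2 powr (real n * R2) \<le> real M2 \<and>
        (\<forall>m0<M0. \<forall>m1<M1. \<forall>m2<M2. length (enc m0 m1 m2) = n) \<and>
        avg_error (\<lambda>x y z. pmf (qp x) (y, z)) n M0 M1 M2 enc dec1 dec2 \<le> \<epsilon>"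
        by (intro exI conjI) (rule R0, rule R1, rule R2, rule len, rule err)
    qed
  qed
qed

end

theorem theorem4:
  fixes q :: "'x::finite \<Rightarrow> 'y::finite \<Rightarrow> 'z::finite \<Rightarrow> real"
    and r :: "'u::finite \<times> 'v::finite \<times> 'w::finite \<Rightarrow> real"
    and rc :: "'u \<times> 'v \<times> 'w \<Rightarrow> 'u \<times> 'v \<times> 'w \<Rightarrow> 'x \<Rightarrow> real"
    and R0 R1 R2 :: real
  assumes q_nonneg: "\<And>x y z. q x y z \<ge> 0"
    and q_sum: "\<And>x. (\<Sum>y\<in>UNIV. \<Sum>z\<in>UNIV. q x y z) = 1"
    and r_nonneg: "\<And>s. r s \<ge> 0"
    and r_sum: "(\<Sum>s\<in>UNIV. r s) = 1"
    and rc_nonneg: "\<And>s1 s2 x. rc s1 s2 x \<ge> 0"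
    and rc_sum: "\<And>s1 s2. (\<Sum>x\<in>UNIV. rc s1 s2 x) = 1"
  defines "rt \<equiv> (\<lambda>s x. \<Sum>s'\<in>UNIV. rc s' s x * r s')"
  defines "P \<equiv> (\<lambda>(s1, s2, x1, x2, y1, y2, z1, z2).
              r s1 * r s2 * rc s1 s2 x2 * q x2 y2 z2 * rt s1 x1 * q x1 y1 z1)"
  defines "U1 \<equiv> (\<lambda>(s1, s2, x1, x2, y1, y2, z1, z2). fst s1)"
    and "V1 \<equiv> (\<lambda>(s1, s2, x1, x2, y1, y2, z1, z2). fst (snd s1))"
    and "W1 \<equiv> (\<lambda>(s1, s2, x1, x2, y1, y2, z1, z2). snd (snd s1))"
    and "U2 \<equiv> (\<lambda>(s1, s2, x1, x2, y1, y2, z1, z2). fst s2)"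
    and "V2 \<equiv> (\<lambda>(s1, s2, x1, x2, y1, y2, z1, z2). fst (snd s2))"
    and "W2 \<equiv> (\<lambda>(s1, s2, x1, x2, y1, y2, z1, z2). snd (snd s2))"
    and "Y1 \<equiv> (\<lambda>(s1, s2, x1, x2, y1, y2, z1, z2). y1)"
    and "Y2 \<equiv> (\<lambda>(s1, s2, x1, x2, y1, y2, z1, z2). y2)"
    and "Z1 \<equiv> (\<lambda>(s1, s2, x1, x2, y1, y2, z1, z2). z1)"
    and "Z2 \<equiv> (\<lambda>(s1, s2, x1, x2, y1, y2, z1, z2). z2)"
  defines "IUW \<equiv> mutual_info P (\<lambda>\<omega>. (U2 \<omega>, W2 \<omega>)) (\<lambda>\<omega>. (Y1 \<omega>, Y2 \<omega>, U1 \<omega>, W1 \<omega>))"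
    and "IVW \<equiv> mutual_info P (\<lambda>\<omega>. (V2 \<omega>, W2 \<omega>)) (\<lambda>\<omega>. (Z1 \<omega>, Z2 \<omega>, V1 \<omega>, W1 \<omega>))"
    and "IV \<equiv> cond_mutual_info P V2 (\<lambda>\<omega>. (Z1 \<omega>, Z2 \<omega>, V1 \<omega>, W1 \<omega>)) W2"
    and "IU \<equiv> cond_mutual_info P U2 (\<lambda>\<omega>. (Y1 \<omega>, Y2 \<omega>, U1 \<omega>, W1 \<omega>)) W2"
    and "IUV \<equiv> cond_mutual_info P U2 V2 W2"
  assumes "R0 \<ge> 0" and "R1 \<ge> 0" and "R2 \<ge> 0"
    and "R0 + R1 < IUW"
    and "R0 + R2 < IVW"
    and "R0 + R1 + R2 < IV + IUW - IUV"
    and "R0 + R1 + R2 < IU + IVW - IUV"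
    and "2 * R0 + R1 + R2 < IUW + IVW - IUV"
  shows "achievable q R0 R1 R2"
proof -
  obtain rp where rp: "\<forall>s. pmf rp s = r s"
    using ex_pmf[of r] r_nonneg r_sum by blast
  have "\<forall>s1 s2. \<exists>p. \<forall>x. pmf p x = rc s1 s2 x"
    by (intro allI ex_pmf rc_nonneg rc_sum)
  then obtain rcp where rcp: "\<forall>s1 s2 x. pmf (rcp s1 s2) x = rc s1 s2 x" by metis
  have "\<forall>x. \<exists>p. \<forall>yz. pmf p yz = (case yz of (y, z) \<Rightarrow> q x y z)"
  proof (intro allI ex_pmf)
    show "(\<Sum>yz\<in>UNIV. case yz of (y, z) \<Rightarrow> q x y z) = 1" for x
      using q_sum[of x] by (simp add: sum.cartesian_product)
  qed (auto simp: q_nonneg)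
  from choice[OF this] obtain qp where "\<forall>x yz. pmf (qp x) yz = (case yz of (y, z) \<Rightarrow> q x y z)" ..
  then have qp: "pmf (qp x) (y, z) = q x y z" for x y z by simp
  interpret w: sliding_window rp rcp qp .
  have P: "P = pmf w.M"
    by (rule ext) (simp add: P_def rt_def w.pmf_M rp rcp qp split: prod.splits)
  have "\<forall>w. \<exists>k. \<forall>u. pmf k u * pmf (map_pmf w.W2 w.M) w = pmf (map_pmf (\<lambda>\<omega>. (w.U2 \<omega>, w.W2 \<omega>)) w.M) (u, w)"
    by (intro allI ex_conditional_pmf)
  from choice[OF this] obtain cU where
    cU: "\<forall>w u. pmf (cU w) u * pmf (map_pmf w.W2 w.M) w = pmf (map_pmf (\<lambda>\<omega>. (w.U2 \<omega>, w.W2 \<omega>)) w.M) (u, w)" ..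
  have "\<forall>w. \<exists>k. \<forall>v. pmf k v * pmf (map_pmf w.W2 w.M) w = pmf (map_pmf (\<lambda>\<omega>. (w.V2 \<omega>, w.W2 \<omega>)) w.M) (v, w)"
    by (intro allI ex_conditional_pmf)
  from choice[OF this] obtain cV where
    cV: "\<forall>w v. pmf (cV w) v * pmf (map_pmf w.W2 w.M) w = pmf (map_pmf (\<lambda>\<omega>. (w.V2 \<omega>, w.W2 \<omega>)) w.M) (v, w)" ..
  interpret c: sliding_code rp rcp qp cU cV
    by unfold_locales (rule cU[rule_format] cV[rule_format])+
  have rv: "U1 = w.U1" "V1 = w.V1" "W1 = w.W1" "U2 = w.U2" "V2 = w.V2" "W2 = w.W2"
    "Y1 = w.Y1" "Y2 = w.Y2" "Z1 = w.Z1" "Z2 = w.Z2"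
    by (simp_all add: U1_def V1_def W1_def U2_def V2_def W2_def Y1_def Y2_def Z1_def Z2_def
      w.U1_def w.V1_def w.W1_def w.U2_def w.V2_def w.W2_def w.Y1_def w.Y2_def w.Z1_def w.Z2_def)
  have I: "IUW = expect w.M c.hUW" "IVW = expect w.M c.hVW" "IU = expect w.M c.hU"
    "IV = expect w.M c.hV" "IUV = expect w.M c.hUV"
    unfolding IUW_def IVW_def IU_def IV_def IUV_def mutual_info_def P cond_mutual_info_eq_expect rv
      c.h_defs[abs_def] c.i_defs by (rule refl)+
  have nn: "0 \<le> IU" "0 \<le> IV" "0 \<le> IUV"
    unfolding IU_def IV_def IUV_def P by (rule cond_mutual_info_nonneg)+
  have "achievable (\<lambda>x y z. pmf (qp x) (y, z)) R0 R1 R2"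
    \<comment> \<open>The facts \<open>assms(24-)\<close> are the rate conditions; the 23 before
      them are the pmf hypotheses and the definitions.\<close>
    using assms(24-) nn unfolding I by (intro c.achievable_rates)
  then show ?thesis by (simp add: qp)
qed

end
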